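(* For each $(t,p)\in[0,T]\times\mathbb{R}$ the function $V(t,p,\cdot)$, defined on $[m-\bar u(T-t),M]$, is (1) concave, Lipschitz continuous and a.e. twice differentiable; (2) weakly increasing in $[m-(T-t)\bar u,\,M-(T-t)\bar u]$ and weakly decreasing in $[m,M]$. In particular, if $M-(T-t)\bar u\ge m$ then the function $V(t,p,\cdot)$ is constant in $[m,M-(T-t)\bar u]$ (all points of this interval are maximum points).
   Context: Setting (swing contract with strict constraints). Let $T>0$, $r\ge0$, $K>0$, $\bar u>0$, $m,M\ge0$ with $m<M$. Let $(\Omega,\mathcal{F}_T,\{\mathcal{F}_s\}_{s\in[0,T]},\mathbb{P})$ be a filtered probability space with a real $\{\mathcal{F}_s\}_s$-adapted Brownian motion $W$ (Brownian with respect to the filtration). Let $f,\sigma\in C([0,T]\times\mathbb{R};\mathbb{R})$ be Lipschitz continuous in the second variable uniformly in the first. For $(t,p)\in[0,T]\times\mathbb{R}$ let $P^{t,p}$ be the unique strong solution of $dP^{t,p}(s)=f(s,P^{t,p}(s))ds+\sigma(s,P^{t,p}(s))dW(s)$, $s\in[t,T]$, $P^{t,p}(t)=p$. Let $\mathcal{A}_t$ be the set of $[0,\bar u]$-valued progressively measurable processes $u=\{u(s)\}_{s\in[t,T]}$; for $z\in\mathbb{R}$ put $Z^{t,z;u}(s)=z+\int_t^s u(\tau)d\tau$ and $\mathcal{A}_{tz}^{\mathrm{adm}}=\{u\in\mathcal{A}_t:Z^{t,z;u}(T)\in[m,M]\ \mathbb{P}\text{-a.s.}\}$. Let $\mathcal{D}=\{(t,p,z)\in[0,T]\times\mathbb{R}^2: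 m-\bar u(T-t)\le z\le M\}$ and, for $(t,p,z)\in\mathcal{D}$, $$V(t,p,z)=\sup_{u\in\mathcal{A}_{tz}^{\mathrm{adm}}}\mathbb{E}\Big[\int_t^T e^{-r(s-t)}(P^{t,p}(s)-K)u(s)\,ds\Big].$$ *)

theory Defs
  imports "HOL-Probability.Probability"
begin

text \<open>
  Processes are functions \<open>real \<Rightarrow> 'a \<Rightarrow> real\<close> (time first); only their values at times in the
  relevant closed interval matter. Completeness of the filtration is not assumed, and path
  continuity is accordingly required only almost surely.
\<close>

definition filtration_upto :: "'a measure \<Rightarrow> real \<Rightarrow> (real \<Rightarrow> 'a measure) \<Rightarrow> bool" where
  "filtration_upto \<Omega> T F \<longleftrightarrow>
     (\<forall>s\<in>{0..T}. subalgebra \<Omega> (F s)) \<and>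
     (\<forall>s\<in>{0..T}. \<forall>s'\<in>{0..T}. s \<le> s' \<longrightarrow> sets (F s) \<subseteq> sets (F s'))"

definition progressively_measurable ::
    "(real \<Rightarrow> 'a measure) \<Rightarrow> real \<Rightarrow> real \<Rightarrow> (real \<Rightarrow> 'a \<Rightarrow> real) \<Rightarrow> bool" where
  "progressively_measurable F a b X \<longleftrightarrow>
     (\<forall>s\<in>{a..b}. (\<lambda>(\<tau>, \<omega>). X \<tau> \<omega>)
        \<in> borel_measurable (restrict_space borel {a..s} \<Otimes>\<^sub>M F s))"

text \<open>The second parameter of \<^const>\<open>normal_density\<close> is the standard deviation.\<close>

definition brownian_motion ::
    "'a measure \<Rightarrow> real \<Rightarrow> (real \<Rightarrow> 'a measure) \<Rightarrow> (real \<Rightarrow> 'a \<Rightarrow> real) \<Rightarrow> bool" where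
  "brownian_motion \<Omega> T F W \<longleftrightarrow>
     (\<forall>s\<in>{0..T}. W s \<in> borel_measurable (F s)) \<and>
     (AE \<omega> in \<Omega>. W 0 \<omega> = 0) \<and>
     (AE \<omega> in \<Omega>. continuous_on {0..T} (\<lambda>s. W s \<omega>)) \<and>
     (\<forall>s s'. 0 \<le> s \<and> s < s' \<and> s' \<le> T \<longrightarrow>
        distributed \<Omega> lborel (\<lambda>\<omega>. W s' \<omega> - W s \<omega>) (normal_density 0 (sqrt (s' - s))) \<and>
        prob_space.indep_set \<Omega>
          (sets (vimage_algebra (space \<Omega>) (\<lambda>\<omega>. W s' \<omega> - W s \<omega>) borel)) (sets (F s)))"

definition conv_in_prob :: "'a measure \<Rightarrow> (nat \<Rightarrow> 'a \<Rightarrow> real) \<Rightarrow> ('a \<Rightarrow> real) \<Rightarrow> bool" where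
  "conv_in_prob \<Omega> Y Z \<longleftrightarrow>
     (\<forall>\<epsilon>>0. (\<lambda>n. measure \<Omega> {\<omega> \<in> space \<Omega>. \<bar>Y n \<omega> - Z \<omega>\<bar> > \<epsilon>}) \<longlonglongrightarrow> 0)"

text \<open>
  The simple integrand \<open>H = (\<Sum>i<N. \<xi> i * indicator {\<tau> i<..\<tau> (i+1)})\<close> on \<open>[a,b]\<close>
  is represented by its data \<open>N, \<tau>, \<xi>\<close>.
\<close>

definition simple_integrand ::
    "'a measure \<Rightarrow> (real \<Rightarrow> 'a measure) \<Rightarrow> real \<Rightarrow> real
      \<Rightarrow> nat \<Rightarrow> (nat \<Rightarrow> real) \<Rightarrow> (nat \<Rightarrow> 'a \<Rightarrow> real) \<Rightarrow> bool" where
  "simple_integrand \<Omega> F a b N \<tau> \<xi> \<longleftrightarrow>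
     \<tau> 0 = a \<and> \<tau> N = b \<and> (\<forall>i<N. \<tau> i \<le> \<tau> (Suc i)) \<and>
     (\<forall>i<N. \<xi> i \<in> borel_measurable (F (\<tau> i)) \<and> bounded (\<xi> i ` space \<Omega>))"

definition simple_process ::
    "nat \<Rightarrow> (nat \<Rightarrow> real) \<Rightarrow> (nat \<Rightarrow> 'a \<Rightarrow> real) \<Rightarrow> real \<Rightarrow> 'a \<Rightarrow> real" where
  "simple_process N \<tau> \<xi> s \<omega> = (\<Sum>i<N. \<xi> i \<omega> * indicator {\<tau> i<..\<tau> (Suc i)} s)"

definition simple_integral ::
    "(real \<Rightarrow> 'a \<Rightarrow> real) \<Rightarrow> nat \<Rightarrow> (nat \<Rightarrow> real) \<Rightarrow> (nat \<Rightarrow> 'a \<Rightarrow> real) \<Rightarrow> real \<Rightarrow> 'a \<Rightarrow> real" where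
  "simple_integral W N \<tau> \<xi> s \<omega> =
     (\<Sum>i<N. \<xi> i \<omega> * (W (min (\<tau> (Suc i)) s) \<omega> - W (min (\<tau> i) s) \<omega>))"

text \<open>
  \<open>ito_integral \<Omega> F W a b X I\<close>: the process \<open>I\<close> is (a version of) the Ito integral process
  \<open>s \<mapsto> \<integral> X dW\<close> over \<open>[a,s]\<close>, \<open>s \<in> [a,b]\<close>, for progressively measurable \<open>X\<close> with almost surely
  square integrable paths: the limit in probability of the integrals of simple integrands
  approximating \<open>X\<close> in \<open>L\<^sup>2[a,b]\<close> in probability.
\<close>

definition ito_integral ::
    "'a measure \<Rightarrow> (real \<Rightarrow> 'a measure) \<Rightarrow> (real \<Rightarrow> 'a \<Rightarrow> real) \<Rightarrow> real \<Rightarrow> real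
      \<Rightarrow> (real \<Rightarrow> 'a \<Rightarrow> real) \<Rightarrow> (real \<Rightarrow> 'a \<Rightarrow> real) \<Rightarrow> bool" where
  "ito_integral \<Omega> F W a b X I \<longleftrightarrow>
     progressively_measurable F a b X \<and>
     (AE \<omega> in \<Omega>. set_integrable lborel {a..b} (\<lambda>s. (X s \<omega>)\<^sup>2)) \<and>
     (\<forall>s\<in>{a..b}. I s \<in> borel_measurable (F s)) \<and>
     (AE \<omega> in \<Omega>. continuous_on {a..b} (\<lambda>s. I s \<omega>)) \<and>
     (\<exists>N \<tau> \<xi>.
        (\<forall>n. simple_integrand \<Omega> F a b (N n) (\<tau> n) (\<xi> n)) \<and>
        conv_in_prob \<Omega>
          (\<lambda>n \<omega>. LINT s:{a..b}|lborel. (simple_process (N n) (\<tau> n) (\<xi> n) s \<omega> - X s \<omega>)\<^sup>2)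
          (\<lambda>\<omega>. 0) \<and>
        (\<forall>s\<in>{a..b}. conv_in_prob \<Omega> (\<lambda>n. simple_integral W (N n) (\<tau> n) (\<xi> n) s) (I s)))"

text \<open>\<open>X\<close> solves \<open>dX = f(s,X) ds + \<sigma>(s,X) dW\<close> on \<open>[t,T]\<close> with \<open>X t = p\<close>, on the given
  filtered probability space and with the given Brownian motion.\<close>

definition strong_solution ::
    "'a measure \<Rightarrow> (real \<Rightarrow> 'a measure) \<Rightarrow> (real \<Rightarrow> 'a \<Rightarrow> real)
      \<Rightarrow> (real \<Rightarrow> real \<Rightarrow> real) \<Rightarrow> (real \<Rightarrow> real \<Rightarrow> real) \<Rightarrow> real \<Rightarrow> real \<Rightarrow> real
      \<Rightarrow> (real \<Rightarrow> 'a \<Rightarrow> real) \<Rightarrow> bool" where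
  "strong_solution \<Omega> F W f \<sigma> T t p X \<longleftrightarrow>
     progressively_measurable F t T X \<and>
     (AE \<omega> in \<Omega>. continuous_on {t..T} (\<lambda>s. X s \<omega>)) \<and>
     (AE \<omega> in \<Omega>. set_integrable lborel {t..T} (\<lambda>s. f s (X s \<omega>))) \<and>
     (AE \<omega> in \<Omega>. X t \<omega> = p) \<and>
     (\<exists>I. ito_integral \<Omega> F W t T (\<lambda>s \<omega>. \<sigma> s (X s \<omega>)) I \<and>
        (AE \<omega> in \<Omega>. \<forall>s\<in>{t..T}. X s \<omega> = p + (LINT \<tau>:{t..s}|lborel. f \<tau> (X \<tau> \<omega>)) + I s \<omega>))"

definition controls ::
    "'a measure \<Rightarrow> (real \<Rightarrow> 'a measure) \<Rightarrow> real \<Rightarrow> real \<Rightarrow> real \<Rightarrow> (real \<Rightarrow> 'a \<Rightarrow> real) set" where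
  "controls \<Omega> F T ubar t =
     {u. progressively_measurable F t T u \<and> (\<forall>s\<in>{t..T}. \<forall>\<omega>\<in>space \<Omega>. u s \<omega> \<in> {0..ubar})}"

definition Z_process :: "real \<Rightarrow> real \<Rightarrow> (real \<Rightarrow> 'a \<Rightarrow> real) \<Rightarrow> real \<Rightarrow> 'a \<Rightarrow> real" where
  "Z_process t z u s \<omega> = z + (LINT \<tau>:{t..s}|lborel. u \<tau> \<omega>)"

definition admissible_controls ::
    "'a measure \<Rightarrow> (real \<Rightarrow> 'a measure) \<Rightarrow> real \<Rightarrow> real \<Rightarrow> real \<Rightarrow> real \<Rightarrow> real \<Rightarrow> real
      \<Rightarrow> (real \<Rightarrow> 'a \<Rightarrow> real) set" where
  "admissible_controls \<Omega> F T ubar m M t z =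
     {u \<in> controls \<Omega> F T ubar t. AE \<omega> in \<Omega>. Z_process t z u T \<omega> \<in> {m..M}}"

text \<open>A supremum of reals, hence meaningful only for \<open>(t,p,z)\<close> in the domain
  \<open>m - ubar * (T - t) \<le> z \<le> M\<close>, where there are admissible controls.\<close>

definition swing_value ::
    "'a measure \<Rightarrow> (real \<Rightarrow> 'a measure) \<Rightarrow> (real \<Rightarrow> real \<Rightarrow> real \<Rightarrow> 'a \<Rightarrow> real)
      \<Rightarrow> real \<Rightarrow> real \<Rightarrow> real \<Rightarrow> real \<Rightarrow> real \<Rightarrow> real \<Rightarrow> real \<Rightarrow> real \<Rightarrow> real \<Rightarrow> real" where
  "swing_value \<Omega> F P T r K ubar m M t p z =
     (SUP u\<in>admissible_controls \<Omega> F T ubar m M t z.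
        prob_space.expectation \<Omega>
          (\<lambda>\<omega>. LINT s:{t..T}|lborel. exp (- r * (s - t)) * (P t p s \<omega> - K) * u s \<omega>))"

text \<open>
  For a function that is differentiable only almost everywhere, the second derivative at \<open>x\<close> is
  the derivative at \<open>x\<close> of \<open>g'\<close>, regarded as a function on the set of points where \<open>g\<close> is
  differentiable. (A concave function may fail to be differentiable on a dense set, so \<open>g'\<close> need
  not exist in a neighbourhood of any point.) The notion is used almost everywhere on an interval,
  where differentiability at almost every point makes \<open>x\<close> a limit point of that set.
\<close>

definition twice_differentiable_at :: "(real \<Rightarrow> real) \<Rightarrow> real \<Rightarrow> bool" where
  "twice_differentiable_at g x \<longleftrightarrow>
     g field_differentiable (at x) \<and>
     (\<exists>D. (deriv g has_real_derivative D) (at x within {y. g field_differentiable (at y)}))"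

end

theory Submission
  imports Defs
begin

text \<open>
  Fix \<open>t\<close> and \<open>p\<close>, write $P_s$ for the price and $V(z)$ for the value.

  \<^bold>\<open>Shape.\<close> The payoff is linear in the control, and the constraint $m \le z + \int u \le M$ is convex in
  $(z,u)$; mixing controls shows that \<open>V\<close> is concave (\<open>val_concave\<close>). Because $0 \le \int u \le \bar u (T-t)$,
  only the lower constraint is active for $z \le M - \bar u(T-t)$ and only the upper one for $z \ge m$. So
  the set of admissible controls grows with \<open>z\<close> in the first range and shrinks in the second, which gives the
  two monotonicity statements and, where the ranges overlap, the plateau of maximum points.

  \<^bold>\<open>Lipschitz continuity.\<close> A concave function on a compact interval is Lipschitz as soon as its slopes at the
  end points are bounded. At the left end point $a = m - \bar u(T-t)$ full exercise is admissible, at \<open>M\<close> no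
  exercise is; an admissible control for \<open>z\<close> differs from them by a control \<open>v\<close> of constant sign with
  $\int |v| \le z - a$ and $\int |v| \le M - z$, respectively. So it suffices to bound
  $|E \int w_s (P_s - K) v_s \, ds|$ by a multiple of the total of a nonnegative control \<open>v\<close>
  (\<open>payoff_bound\<close>). Here $P_s = p + \int_t^s f + N_s$ with a stochastic integral \<open>N\<close>. As $v_s$ is known at
  time \<open>s\<close>, the martingale property replaces $N_s$ by $N_T$, and what then multiplies $v_s$ is dominated by
  one integrable random variable for all \<open>s\<close>.

  \<^bold>\<open>Moments.\<close> This needs $E N_s^2 < \infty$ and the martingale property, both from the definition of the Ito
  integral as a limit in probability. Stopping simple integrands when their quadratic variation becomes large
  yields $E[N_s^2; A_s \le R] \le 4 E \min(A_s, R) + 7$ for the quadratic variation \<open>A\<close>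
  (\<open>ito_localized_second_moment\<close>). Linear growth of the coefficients and a pathwise Gronwall argument bound
  the right-hand side by the integral over time of the left-hand side, with constants independent of \<open>R\<close>; so
  Gronwall's inequality and $R \to \infty$ give the moment bound (\<open>noise_second_moment\<close>). Convergence in
  probability together with bounded second moments is convergence in mean, which preserves the martingale
  property (\<open>ito_integral_martingale\<close>).

  \<^bold>\<open>Second derivative.\<close> Supergradients of a concave function form a monotone function, which is
  differentiable almost everywhere by Lebesgue's theorem (\<open>mono_differentiable_AE\<close>). The latter follows from
  Vitali's covering theorem: between two slopes $p < q$, the set of points at which a monotone function
  oscillates between them has density at most $p/q$ in arbitrarily small intervals, hence is a null set.
\<close>

section \<open>Differentiability of monotone and concave functions\<close>

text \<open>
  Monotonicity sends disjoint intervals $[l_i,u_i]$ to disjoint open intervals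
  $(g(l_i),g(u_i))$ inside $[g(\alpha),g(\beta)]$. The increments of $g$ are thus lengths of
  disjoint sets, so that countable additivity bounds their sum even if $g$ has jumps and the
  family has no natural order.
\<close>

lemma mono_disjoint_intervals_emeasure:
  fixes g :: "real \<Rightarrow> real" and l u :: "'i \<Rightarrow> real"
  assumes g: "mono g" and q: "0 < q" and C: "countable C"
    and disj: "disjoint_family_on (\<lambda>i. {l i..u i}) C"
    and sub: "\<And>i. i \<in> C \<Longrightarrow> \<alpha> \<le> l i \<and> l i < u i \<and> u i \<le> \<beta>"
    and steep: "\<And>i. i \<in> C \<Longrightarrow> q * (u i - l i) \<le> g (u i) - g (l i)"
  shows "emeasure lborel (\<Union>i\<in>C. {l i..u i}) \<le> ennreal ((g \<beta> - g \<alpha>) / q)"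
proof (cases "C = {}")
  case False
  then have "\<alpha> \<le> \<beta>" using sub by force
  then have gab: "g \<alpha> \<le> g \<beta>" using g by (simp add: monoD)
  have disj': "disjoint_family_on (\<lambda>i. {g (l i)<..<g (u i)}) C"
    unfolding disjoint_family_on_def
  proof (intro ballI impI)
    fix i j assume ij: "i \<in> C" "j \<in> C" "i \<noteq> j"
    then have "{l i..u i} \<inter> {l j..u j} = {}" using disj by (auto simp: disjoint_family_on_def)
    moreover have "l i < u i" "l j < u j" using sub ij by auto
    ultimately have "u i < l j \<or> u j < l i" by (auto simp: Int_atLeastAtMost)
    then have "g (u i) \<le> g (l j) \<or> g (u j) \<le> g (l i)" using g by (auto simp: monoD)
    then show "{g (l i)<..<g (u i)} \<inter> {g (l j)<..<g (u j)} = {}" by auto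
  qed
  have "ennreal q * emeasure lborel (\<Union>i\<in>C. {l i..u i})
      = ennreal q * (\<integral>\<^sup>+i. emeasure lborel {l i..u i} \<partial>count_space C)"
    using C disj by (subst emeasure_UN_countable) auto
  also have "\<dots> = (\<integral>\<^sup>+i. ennreal q * emeasure lborel {l i..u i} \<partial>count_space C)"
    by (simp add: nn_integral_cmult)
  also have "\<dots> \<le> (\<integral>\<^sup>+i. emeasure lborel {g (l i)<..<g (u i)} \<partial>count_space C)"
  proof (intro nn_integral_mono)
    fix i assume "i \<in> space (count_space C)"
    then have i: "i \<in> C" by simp
    have "0 \<le> q * (u i - l i)" using q sub[OF i] by simp
    then have "g (l i) \<le> g (u i)" using steep[OF i] by linarith
    then show "ennreal q * emeasure lborel {l i..u i} \<le> emeasure lborel {g (l i)<..<g (u i)}"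
      using q sub[OF i] steep[OF i] by (simp add: ennreal_mult[symmetric])
  qed
  also have "\<dots> = emeasure lborel (\<Union>i\<in>C. {g (l i)<..<g (u i)})"
    using C disj' by (subst emeasure_UN_countable) auto
  also have "\<dots> \<le> emeasure lborel {g \<alpha>..g \<beta>}"
  proof (rule emeasure_mono)
    show "(\<Union>i\<in>C. {g (l i)<..<g (u i)}) \<subseteq> {g \<alpha>..g \<beta>}"
    proof clarify
      fix i x assume i: "i \<in> C" and x: "x \<in> {g (l i)<..<g (u i)}"
      have "g \<alpha> \<le> g (l i)" "g (u i) \<le> g \<beta>" using sub[OF i] g by (auto simp: monoD)
      then show "x \<in> {g \<alpha>..g \<beta>}" using x by auto
    qed
  qed simp
  also have "\<dots> = ennreal q * ennreal ((g \<beta> - g \<alpha>) / q)"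
    using gab q by (simp add: ennreal_mult[symmetric])
  finally show ?thesis using q
    by (subst (asm) ennreal_mult_le_mult_iff) auto
qed simp

text \<open>
  Vitali's theorem selects disjoint steep intervals that cover \<open>S\<close> up to a null set, and disjoint
  steep intervals have small total length because the increment of \<open>g\<close> over \<open>[\<alpha>,\<beta>]\<close> is limited.
\<close>

lemma Vitali_cover_steep_intervals:
  fixes g :: "real \<Rightarrow> real"
  assumes g: "mono g" and q: "0 < q" and ab: "\<alpha> \<le> \<beta>" and S: "S \<subseteq> {\<alpha><..<\<beta>}"
    and steep: "\<And>x d. x \<in> S \<Longrightarrow> 0 < d \<Longrightarrow>
      \<exists>l u. l < u \<and> x \<in> {l..u} \<and> u - l < d \<and> q * (u - l) \<le> g u - g l"
  obtains U where "U \<in> lmeasurable" "S \<subseteq> U" "measure lebesgue U \<le> (g \<beta> - g \<alpha>) / q"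
proof -
  define K where "K = {(l,u). \<alpha> \<le> l \<and> l < u \<and> u \<le> \<beta> \<and> q * (u - l) \<le> g u - g l}"
  \<comment> \<open>The covering theorem speaks of balls: an interval is the ball around its midpoint.\<close>
  define a r where "a = (\<lambda>(l::real,u). (l + u) / 2)" and "r = (\<lambda>(l::real,u). (u - l) / 2)"
  have cb: "cball (a i) (r i) = {fst i..snd i}" for i
    by (cases i) (auto simp: a_def r_def cball_eq_atLeastAtMost field_simps)
  obtain C where C: "countable C" "C \<subseteq> K"
      "pairwise (\<lambda>i j. disjnt (cball (a i) (r i)) (cball (a j) (r j))) C"
      "negligible (S - (\<Union>i\<in>C. cball (a i) (r i)))"
  proof (rule Vitali_covering_theorem_cballs[of K r S a])
    show "0 < r i" if "i \<in> K" for i using that by (auto simp: K_def r_def)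
    show "\<exists>i. i \<in> K \<and> x \<in> cball (a i) (r i) \<and> r i < d" if x: "x \<in> S" and d: "0 < d" for x d
    proof -
      have xab: "\<alpha> < x" "x < \<beta>" using x S by auto
      obtain l u where lu: "l < u" "x \<in> {l..u}" "u - l < min d (min (x - \<alpha>) (\<beta> - x))"
          "q * (u - l) \<le> g u - g l"
        using steep[OF x, of "min d (min (x - \<alpha>) (\<beta> - x))"] xab d by auto
      then have "(l,u) \<in> K" by (auto simp: K_def)
      moreover have "r (l,u) < d" using lu by (auto simp: r_def)
      ultimately show ?thesis using lu cb[of "(l,u)"] by (intro exI[of _ "(l,u)"]) auto
    qed
  qed blast
  let ?B = "\<Union>i\<in>C. {fst i..snd i}"
  have meas: "?B \<in> sets borel" using C(1) by (intro sets.countable_UN') auto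
  have bd: "emeasure lborel ?B \<le> ennreal ((g \<beta> - g \<alpha>) / q)"
  proof (rule mono_disjoint_intervals_emeasure[OF g q C(1)])
    show "disjoint_family_on (\<lambda>i. {fst i..snd i}) C"
      using C(3) unfolding cb by (auto simp: disjoint_family_on_def pairwise_def disjnt_def)
  qed (use C(2) in \<open>auto simp: K_def\<close>)
  have gab: "0 \<le> (g \<beta> - g \<alpha>) / q" using q g ab by (simp add: monoD)
  have em: "emeasure lebesgue ?B \<le> ennreal ((g \<beta> - g \<alpha>) / q)" using bd meas by simp
  have fin: "?B \<in> lmeasurable"
    using em meas by (intro fmeasurableI) (auto simp: top_unique less_top[symmetric] intro: le_less_trans)
  have "measure lebesgue ?B \<le> (g \<beta> - g \<alpha>) / q"
    using em gab by (simp add: measure_def enn2real_leI)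
  moreover have "measure lebesgue (?B \<union> (S - ?B)) = measure lebesgue ?B"
    using C(4) fin unfolding cb
    by (intro measure_Un_null_set) (auto simp: negligible_iff_null_sets fmeasurableD)
  moreover have "?B \<union> (S - ?B) \<in> lmeasurable"
    using fmeasurable.Un[OF fin negligible_imp_measurable] C(4) unfolding cb by blast
  ultimately show ?thesis using that[of "?B \<union> (S - ?B)"] by auto
qed

text \<open>
  A weak form of the density theorem, for outer measure, so that \<open>S\<close> may be non-measurable. Let
  \<open>\<mu>\<close> be the infimum of the measures of the measurable sets that contain \<open>S\<close>. If \<open>\<mu> > 0\<close>, take an open
  superset of measure less than \<open>\<mu> / \<theta>\<close> and cover \<open>S\<close>, up to a null set, by disjoint intervals inside
  it; the pieces of \<open>S\<close> in these intervals are contained in sets of total measure less than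
  \<open>\<theta> * (\<mu> / \<theta>) = \<mu>\<close>, a contradiction.
\<close>

lemma negligible_if_density_bounded:
  fixes S :: "real set"
  assumes bdd: "bounded S" and th: "0 < \<theta>" "\<theta> < 1"
    and dens: "\<And>x d. x \<in> S \<Longrightarrow> 0 < d \<Longrightarrow>
      \<exists>l u U. l < u \<and> x \<in> {l..u} \<and> u - l < d \<and> S \<inter> {l..u} \<subseteq> U \<and> U \<in> lmeasurable \<and>
        measure lebesgue U \<le> \<theta> * (u - l)"
  shows "negligible S"
proof -
  define MS where "MS = {measure lebesgue U | U. U \<in> lmeasurable \<and> S \<subseteq> U}"
  have bb: "bdd_below MS" by (auto simp: MS_def intro!: bdd_belowI[of _ 0])
  obtain B where B: "S \<subseteq> cball 0 B" using bdd by (auto simp: bounded_iff subset_iff)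
  then have ne: "MS \<noteq> {}" by (auto simp: MS_def intro!: exI[of _ "cball 0 B"])
  define \<mu> where "\<mu> = Inf MS"
  have mu: "\<mu> \<le> measure lebesgue U" if "U \<in> lmeasurable" "S \<subseteq> U" for U
    unfolding \<mu>_def using that bb by (intro cInf_lower) (auto simp: MS_def)
  have "\<mu> \<le> 0"
  proof (rule ccontr)
    assume "\<not> \<mu> \<le> 0"
    then have mupos: "0 < \<mu>" by simp
    then have "\<mu> < \<mu> / \<theta>" using th by (simp add: field_simps)
    then obtain U0 where U0: "U0 \<in> lmeasurable" "S \<subseteq> U0" "measure lebesgue U0 < \<mu> / \<theta>"
      using cInf_lessD[OF ne, of "\<mu> / \<theta>"] unfolding \<mu>_def[symmetric] by (auto simp: MS_def)
    obtain G where G: "open G" "U0 \<subseteq> G" "G - U0 \<in> lmeasurable"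
        "measure lebesgue (G - U0) < \<mu> / \<theta> - measure lebesgue U0"
    proof -
      have "0 < \<mu> / \<theta> - measure lebesgue U0" using U0 by simp
      moreover have "U0 \<in> sets lebesgue" using U0 by blast
      ultimately obtain G where "open G" "U0 \<subseteq> G" "G - U0 \<in> lmeasurable"
        "emeasure lebesgue (G - U0) < ennreal (\<mu> / \<theta> - measure lebesgue U0)"
        by (meson sets_lebesgue_outer_open)
      then show ?thesis using that
        by (metis \<open>0 < \<mu> / \<theta> - measure lebesgue U0\<close> emeasure_eq_measure2 ennreal_less_iff measure_nonneg)
    qed
    have GU: "G = U0 \<union> (G - U0)" using G by auto
    have Gm: "G \<in> lmeasurable" using U0 G by (subst GU) (intro fmeasurable.Un)
    have "measure lebesgue G \<le> measure lebesgue U0 + measure lebesgue (G - U0)"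
      using U0 G by (subst GU) (intro measure_Un_le, auto)
    with G have mG: "measure lebesgue G < \<mu> / \<theta>" by linarith
    define K where "K = {(l,u). l < u \<and> {l..u} \<subseteq> G \<and>
      (\<exists>U. S \<inter> {l..u} \<subseteq> U \<and> U \<in> lmeasurable \<and> measure lebesgue U \<le> \<theta> * (u - l))}"
    define a r where "a = (\<lambda>(l::real,u). (l + u) / 2)" and "r = (\<lambda>(l::real,u). (u - l) / 2)"
    have cb: "cball (a i) (r i) = {fst i..snd i}" for i
      by (cases i) (auto simp: a_def r_def cball_eq_atLeastAtMost field_simps)
    obtain C where C: "countable C" "C \<subseteq> K"
        "pairwise (\<lambda>i j. disjnt (cball (a i) (r i)) (cball (a j) (r j))) C"
        "negligible (S - (\<Union>i\<in>C. cball (a i) (r i)))"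
    proof (rule Vitali_covering_theorem_cballs[of K r S a])
      show "0 < r i" if "i \<in> K" for i using that by (auto simp: K_def r_def)
      show "\<exists>i. i \<in> K \<and> x \<in> cball (a i) (r i) \<and> r i < d" if x: "x \<in> S" and d: "0 < d" for x d
      proof -
        have "x \<in> G" using x U0 G by auto
        then obtain e where e: "0 < e" "cball x e \<subseteq> G" using G(1) by (meson open_contains_cball)
        obtain l u U where lu: "l < u" "x \<in> {l..u}" "u - l < min d e" "S \<inter> {l..u} \<subseteq> U"
            "U \<in> lmeasurable" "measure lebesgue U \<le> \<theta> * (u - l)"
          using dens[OF x, of "min d e"] d e by auto
        have "{l..u} \<subseteq> cball x e" using lu by (auto simp: dist_real_def)
        then have "(l,u) \<in> K" using lu e by (auto simp: K_def)
        moreover have "r (l,u) < d" using lu by (auto simp: r_def)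
        ultimately show ?thesis using lu cb[of "(l,u)"] by (intro exI[of _ "(l,u)"]) auto
      qed
    qed blast
    have "\<forall>i\<in>C. \<exists>U. S \<inter> {fst i..snd i} \<subseteq> U \<and> U \<in> lmeasurable \<and>
        measure lebesgue U \<le> \<theta> * (snd i - fst i)"
    proof
      fix i assume "i \<in> C"
      then have "i \<in> K" using C(2) by blast
      then show "\<exists>U. S \<inter> {fst i..snd i} \<subseteq> U \<and> U \<in> lmeasurable \<and>
        measure lebesgue U \<le> \<theta> * (snd i - fst i)" by (cases i) (auto simp: K_def)
    qed
    then obtain U where U: "\<And>i. i \<in> C \<Longrightarrow> S \<inter> {fst i..snd i} \<subseteq> U i"
        "\<And>i. i \<in> C \<Longrightarrow> U i \<in> lmeasurable"
        "\<And>i. i \<in> C \<Longrightarrow> measure lebesgue (U i) \<le> \<theta> * (snd i - fst i)" by metis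
    \<comment> \<open>Cutting the sets \<open>U i\<close> down to the disjoint intervals makes them disjoint.\<close>
    define D where "D i = U i \<inter> {fst i..snd i}" for i
    have Dm: "D i \<in> lmeasurable" if "i \<in> C" for i
      using U(2)[OF that] unfolding D_def by (intro fmeasurable_Int_fmeasurable) auto
    have disj: "disjoint_family_on (\<lambda>i. {fst i..snd i}) C"
      using C(3) unfolding cb by (auto simp: disjoint_family_on_def pairwise_def disjnt_def)
    then have disjD: "disjoint_family_on D C" unfolding disjoint_family_on_def D_def by blast
    have "emeasure lebesgue (\<Union>i\<in>C. D i) = (\<integral>\<^sup>+i. emeasure lebesgue (D i) \<partial>count_space C)"
      using C(1) Dm disjD by (intro emeasure_UN_countable) auto
    also have "\<dots> \<le> (\<integral>\<^sup>+i. ennreal \<theta> * emeasure lebesgue {fst i..snd i} \<partial>count_space C)"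
    proof (intro nn_integral_mono)
      fix i assume "i \<in> space (count_space C)"
      then have i: "i \<in> C" by simp
      then have lt: "fst i < snd i" using C(2) by (auto simp: K_def)
      have "emeasure lebesgue (D i) \<le> emeasure lebesgue (U i)"
        using U(2)[OF i] by (intro emeasure_mono) (auto simp: D_def)
      also have "\<dots> = ennreal (measure lebesgue (U i))" using U(2)[OF i] by (simp add: emeasure_eq_measure2)
      also have "\<dots> \<le> ennreal (\<theta> * (snd i - fst i))" using U(3)[OF i] by (rule ennreal_leI)
      also have "\<dots> = ennreal \<theta> * emeasure lebesgue {fst i..snd i}"
        using lt th by (simp add: ennreal_mult)
      finally show "emeasure lebesgue (D i) \<le> ennreal \<theta> * emeasure lebesgue {fst i..snd i}" .
    qed
    also have "\<dots> = ennreal \<theta> * (\<integral>\<^sup>+i. emeasure lebesgue {fst i..snd i} \<partial>count_space C)"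
      by (simp add: nn_integral_cmult)
    also have "\<dots> = ennreal \<theta> * emeasure lebesgue (\<Union>i\<in>C. {fst i..snd i})"
      using C(1) disj by (subst emeasure_UN_countable) auto
    also have "\<dots> \<le> ennreal \<theta> * emeasure lebesgue G"
    proof (intro mult_left_mono emeasure_mono)
      show "(\<Union>i\<in>C. {fst i..snd i}) \<subseteq> G"
      proof (intro UN_least)
        fix i assume "i \<in> C"
        then have "i \<in> K" using C(2) by blast
        then show "{fst i..snd i} \<subseteq> G" by (cases i) (simp add: K_def)
      qed
    qed (use Gm in auto)
    also have "\<dots> = ennreal (\<theta> * measure lebesgue G)"
      using Gm th by (simp add: emeasure_eq_measure2 ennreal_mult)
    finally have em: "emeasure lebesgue (\<Union>i\<in>C. D i) \<le> ennreal (\<theta> * measure lebesgue G)" .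
    let ?D = "\<Union>i\<in>C. D i" and ?N = "S - (\<Union>i\<in>C. {fst i..snd i})"
    have Dsets: "?D \<in> sets lebesgue" using C(1) Dm by (intro sets.countable_UN') auto
    have fin: "?D \<in> lmeasurable"
      using em Dsets by (intro fmeasurableI) (auto simp: top_unique less_top[symmetric] intro: le_less_trans)
    have neg: "negligible ?N" using C(4) unfolding cb .
    have "measure lebesgue ?D \<le> \<theta> * measure lebesgue G"
      using em th by (simp add: measure_def enn2real_leI)
    also have "\<dots> < \<mu>" using mG th by (simp add: field_simps)
    finally have "measure lebesgue ?D < \<mu>" .
    moreover have "measure lebesgue (?D \<union> ?N) = measure lebesgue ?D"
      using neg fin by (intro measure_Un_null_set) (auto simp: negligible_iff_null_sets)
    moreover have "\<mu> \<le> measure lebesgue (?D \<union> ?N)"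
    proof (rule mu)
      show "?D \<union> ?N \<in> lmeasurable" using fmeasurable.Un[OF fin negligible_imp_measurable[OF neg]] .
      show "S \<subseteq> ?D \<union> ?N"
      proof
        fix x assume x: "x \<in> S"
        show "x \<in> ?D \<union> ?N"
        proof (cases "\<exists>i\<in>C. x \<in> {fst i..snd i}")
          case True
          then obtain i where i: "i \<in> C" "x \<in> {fst i..snd i}" by blast
          then have "x \<in> D i" using U(1)[OF i(1)] x by (auto simp: D_def)
          then show ?thesis using i(1) by blast
        qed (use x in blast)
      qed
    qed
    ultimately show False by simp
  qed
  show ?thesis unfolding negligible_outer
  proof (intro allI impI)
    fix e :: real assume "0 < e"
    then have "Inf MS < e" using \<open>\<mu> \<le> 0\<close> by (simp add: \<mu>_def)
    then show "\<exists>T. S \<subseteq> T \<and> T \<in> lmeasurable \<and> measure lebesgue T < e"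
      using cInf_lessD[OF ne \<open>Inf MS < e\<close>] by (auto simp: MS_def)
  qed
qed

text \<open>
  On a flat interval \<open>I\<close> around a point of \<open>S\<close> the function grows by at most \<open>p * \<bar>I\<bar>\<close>, while the points of
  \<open>S\<close> inside \<open>I\<close> lie in disjoint intervals of slope at least \<open>q\<close>. These have total length at most
  \<open>(p / q) * \<bar>I\<bar>\<close>, so the density of \<open>S\<close> stays below \<open>p / q < 1\<close>.
\<close>

lemma negligible_mono_derivate_gap:
  fixes g :: "real \<Rightarrow> real"
  assumes g: "mono g" and pq: "0 < p" "p < q" and S: "bounded S"
    and flat: "\<And>x d. x \<in> S \<Longrightarrow> 0 < d \<Longrightarrow>
      \<exists>l u. l < u \<and> x \<in> {l..u} \<and> u - l < d \<and> g u - g l \<le> p * (u - l)"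
    and steep: "\<And>x d. x \<in> S \<Longrightarrow> 0 < d \<Longrightarrow>
      \<exists>l u. l < u \<and> x \<in> {l..u} \<and> u - l < d \<and> q * (u - l) \<le> g u - g l"
  shows "negligible S"
proof (rule negligible_if_density_bounded[OF S, of "p / q"])
  show "0 < p / q" "p / q < 1" using pq by auto
  fix x d :: real assume x: "x \<in> S" and d: "0 < d"
  obtain l u where lu: "l < u" "x \<in> {l..u}" "u - l < d" "g u - g l \<le> p * (u - l)"
    using flat[OF x d] by blast
  obtain U where U: "U \<in> lmeasurable" "S \<inter> {l<..<u} \<subseteq> U" "measure lebesgue U \<le> (g u - g l) / q"
  proof (rule Vitali_cover_steep_intervals[OF g _ less_imp_le[OF lu(1)], of q "S \<inter> {l<..<u}"])
    show "0 < q" using pq by simp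
    show "\<exists>l u. l < u \<and> y \<in> {l..u} \<and> u - l < e \<and> q * (u - l) \<le> g u - g l"
      if "y \<in> S \<inter> {l<..<u}" "0 < e" for y e using steep that by blast
  qed blast+
  \<comment> \<open>The covering argument works in the open interval; the end points form a null set.\<close>
  have 1: "S \<inter> {l..u} \<subseteq> U \<union> {l,u}"
  proof
    fix y assume "y \<in> S \<inter> {l..u}"
    then show "y \<in> U \<union> {l,u}" using U(2) by (cases "y = l \<or> y = u") auto
  qed
  have 2: "measure lebesgue (U \<union> {l,u}) = measure lebesgue U"
    using U(1) by (intro measure_Un_null_set) (auto simp: negligible_iff_null_sets[symmetric])
  have 3: "U \<union> {l,u} \<in> lmeasurable"
    by (rule fmeasurable.Un[OF U(1) negligible_imp_measurable]) simp
  have "measure lebesgue U \<le> (g u - g l) / q" by (rule U)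
  also have "\<dots> \<le> p * (u - l) / q" using lu(4) pq by (simp add: divide_right_mono)
  finally have "measure lebesgue U \<le> p / q * (u - l)" by simp
  with 1 2 3 lu show "\<exists>l u U. l < u \<and> x \<in> {l..u} \<and> u - l < d \<and> S \<inter> {l..u} \<subseteq> U \<and> U \<in> lmeasurable \<and>
        measure lebesgue U \<le> p / q * (u - l)" by metis
qed

text \<open>
  Inside a bounded window the increment of \<open>g\<close> is a fixed number, so intervals of slope \<open>q\<close> cover
  measure at most \<open>O(1 / q)\<close>.
\<close>

lemma negligible_mono_derivate_infinite:
  fixes g :: "real \<Rightarrow> real"
  assumes g: "mono g" and S: "bounded S"
    and steep: "\<And>x d q. x \<in> S \<Longrightarrow> 0 < d \<Longrightarrow> 0 < q \<Longrightarrow>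
      \<exists>l u. l < u \<and> x \<in> {l..u} \<and> u - l < d \<and> q * (u - l) \<le> g u - g l"
  shows "negligible S"
proof -
  obtain B where B: "0 < B" "S \<subseteq> {-B<..<B}"
  proof -
    obtain B where "0 < B" "\<forall>x\<in>S. \<bar>x\<bar> < B" using S by (auto simp: bounded_pos_less)
    moreover from this have "S \<subseteq> {-B<..<B}" by (force simp: abs_less_iff)
    ultimately show ?thesis using that by blast
  qed
  show ?thesis unfolding negligible_outer
  proof (intro allI impI)
    fix e :: real assume e: "0 < e"
    define q where "q = (g B - g (-B) + 1) / (e/2)"
    have gB: "g (-B) \<le> g B" using g B(1) by (simp add: monoD)
    have q: "0 < q" using gB e by (simp add: q_def)
    obtain U where U: "U \<in> lmeasurable" "S \<subseteq> U" "measure lebesgue U \<le> (g B - g (-B)) / q"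
      using Vitali_cover_steep_intervals[OF g q _ B(2)] steep q B(1) by auto
    have "(g B - g (-B)) / q \<le> e / 2" using gB e by (simp add: q_def field_simps)
    then have "measure lebesgue U < e" using U(3) e by linarith
    then show "\<exists>T. S \<subseteq> T \<and> T \<in> lmeasurable \<and> measure lebesgue T < e"
      using U by blast
  qed
qed

text \<open>
  The slopes over all small intervals that contain \<open>x\<close> are compared, not one-sided derivates.
  Intervals with end point \<open>x\<close> are among them, so a common limit of the slopes is the derivative. The
  limit is the infimum of the numbers that eventually bound the slopes from above.
\<close>

lemma differentiable_if_interval_slopes_converge:
  fixes g :: "real \<Rightarrow> real"
  assumes g: "mono g"
    and bdd: "\<exists>q>0. \<exists>d>0. \<forall>l u. l < u \<and> x \<in> {l..u} \<and> u - l < d \<longrightarrow> g u - g l < q * (u - l)"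
    and gap: "\<And>p q. 0 < p \<Longrightarrow> p < q \<Longrightarrow>
      (\<exists>d>0. \<forall>l u. l < u \<and> x \<in> {l..u} \<and> u - l < d \<longrightarrow> p * (u - l) < g u - g l) \<or>
      (\<exists>d>0. \<forall>l u. l < u \<and> x \<in> {l..u} \<and> u - l < d \<longrightarrow> g u - g l < q * (u - l))"
  shows "g field_differentiable (at x)"
proof -
  define up where "up q d \<longleftrightarrow> (\<forall>l u. l < u \<and> x \<in> {l..u} \<and> u - l < d \<longrightarrow> g u - g l < q * (u - l))" for q d
  define A where "A = {q. 0 < q \<and> (\<exists>d>0. up q d)}"
  have ne: "A \<noteq> {}" using bdd by (auto simp: A_def up_def)
  have bb: "bdd_below A" by (auto simp: A_def intro!: bdd_belowI[of _ 0])
  define D where "D = Inf A"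
  have D0: "0 \<le> D" unfolding D_def using ne by (intro cInf_greatest) (auto simp: A_def)
  have ev: "\<exists>d>0. \<forall>l u. l < u \<and> x \<in> {l..u} \<and> u - l < d \<longrightarrow> \<bar>(g u - g l) / (u - l) - D\<bar> < e"
    if e: "0 < e" for e
  proof -
    have "Inf A < D + e" using e by (simp add: D_def)
    then obtain q d1 where q: "q < D + e" "0 < d1" "up q d1"
      using cInf_lessD[OF ne \<open>Inf A < D + e\<close>] by (auto simp: A_def)
    have "\<exists>d>0. \<forall>l u. l < u \<and> x \<in> {l..u} \<and> u - l < d \<longrightarrow> D - e < (g u - g l) / (u - l)"
    proof (cases "D = 0")
      case True
      have "D - e < (g u - g l) / (u - l)" if "l < u" for l u
      proof -
        have "0 \<le> (g u - g l) / (u - l)" using that g by (simp add: monoD)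
        then show ?thesis using True e by linarith
      qed
      then show ?thesis by (intro exI[of _ 1]) auto
    next
      case False
      define p where "p = max (D/2) (D - e/2)"
      have p: "0 < p" "p < D" "D - e < p" using False D0 e by (auto simp: p_def)
      have "(p + D) / 2 \<notin> A"
      proof
        assume "(p + D) / 2 \<in> A"
        then have "D \<le> (p + D) / 2" unfolding D_def using bb by (intro cInf_lower)
        then show False using p by simp
      qed
      then have "\<not> (\<exists>d>0. up ((p + D) / 2) d)" using p by (auto simp: A_def)
      then obtain d where d: "d > 0" "\<forall>l u. l < u \<and> x \<in> {l..u} \<and> u - l < d \<longrightarrow> p * (u - l) < g u - g l"
        using gap[of p "(p + D) / 2"] p unfolding up_def by auto
      have "D - e < (g u - g l) / (u - l)" if "l < u \<and> x \<in> {l..u} \<and> u - l < d" for l u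
      proof -
        have "p < (g u - g l) / (u - l)" using d(2) that by (simp add: pos_less_divide_eq)
        then show ?thesis using p by simp
      qed
      then show ?thesis using d(1) by blast
    qed
    then obtain d2 where d2: "d2 > 0"
      "\<forall>l u. l < u \<and> x \<in> {l..u} \<and> u - l < d2 \<longrightarrow> D - e < (g u - g l) / (u - l)" by blast
    have "\<bar>(g u - g l) / (u - l) - D\<bar> < e" if "l < u \<and> x \<in> {l..u} \<and> u - l < min d1 d2" for l u
    proof -
      have "g u - g l < q * (u - l)" using q(3) that by (auto simp: up_def)
      then have "(g u - g l) / (u - l) < q" using that by (simp add: pos_divide_less_eq)
      moreover have "D - e < (g u - g l) / (u - l)" using d2(2) that by auto
      ultimately show ?thesis using q(1) by linarith
    qed
    then show ?thesis using q(2) d2(1) by (intro exI[of _ "min d1 d2"]) auto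
  qed
  have "(g has_real_derivative D) (at x)"
    unfolding DERIV_def
  proof (rule LIM_I)
    fix e :: real assume "0 < e"
    then obtain d where d: "d > 0"
      "\<forall>l u. l < u \<and> x \<in> {l..u} \<and> u - l < d \<longrightarrow> \<bar>(g u - g l) / (u - l) - D\<bar> < e" using ev by blast
    have "norm ((g (x + h) - g x) / h - D) < e" if "h \<noteq> 0" "norm (h - 0) < d" for h
    proof (cases "0 < h")
      case True
      then show ?thesis using d(2)[rule_format, of x "x + h"] that by auto
    next
      case False
      then have "(g x - g (x + h)) / (- h) = (g (x + h) - g x) / h" using that(1)
        by (simp add: field_simps)
      then show ?thesis using d(2)[rule_format, of "x + h" x] that False by auto
    qed
    then show "\<exists>s>0. \<forall>h. h \<noteq> 0 \<and> norm (h - 0) < s \<longrightarrow> norm ((g (x + h) - g x) / h - D) < e"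
      using d(1) by blast
  qed
  then show ?thesis by (auto simp: field_differentiable_def)
qed

text \<open>
  Lebesgue's theorem. If \<open>g\<close> is not differentiable at \<open>x\<close>, then the slopes near \<open>x\<close> are unbounded or
  some pair of rationals separates their lower from their upper limit; each of these countably many
  cases is a null set on every bounded window.
\<close>

theorem mono_differentiable_AE:
  fixes g :: "real \<Rightarrow> real"
  assumes g: "mono g"
  shows "AE x in lborel. g field_differentiable (at x)"
proof -
  define steep where "steep q x \<longleftrightarrow>
     (\<forall>d>0. \<exists>l u. l < u \<and> x \<in> {l..u} \<and> u - l < d \<and> q * (u - l) \<le> g u - g l)" for q x
  define flat where "flat p x \<longleftrightarrow>
     (\<forall>d>0. \<exists>l u. l < u \<and> x \<in> {l..u} \<and> u - l < d \<and> g u - g l \<le> p * (u - l))" for p x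
  define N1 where "N1 n = {x. \<bar>x\<bar> \<le> real n \<and> (\<forall>q>0. steep q x)}" for n
  define N2 where "N2 n p q = {x. \<bar>x\<bar> \<le> real n \<and> flat p x \<and> steep q x}" for n p q
  have bd: "bounded {x::real. \<bar>x\<bar> \<le> real n \<and> Q x}" for n Q
    by (auto simp: bounded_iff)
  have neg1: "negligible (N1 n)" for n
    unfolding N1_def by (rule negligible_mono_derivate_infinite[OF g bd]) (auto simp: steep_def)
  have neg2: "negligible (N2 n p q)" if "0 < p" "p < q" for n p q
    unfolding N2_def
    by (rule negligible_mono_derivate_gap[OF g that bd]) (auto simp: steep_def flat_def)
  define PQ where "PQ = {(p::real,q). p \<in> \<rat> \<and> q \<in> \<rat> \<and> 0 < p \<and> p < q}"
  have cPQ: "countable PQ"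
    by (rule countable_subset[of _ "\<rat> \<times> \<rat>"]) (auto simp: PQ_def countable_rat)
  define N where "N = (\<Union>n. N1 n) \<union> (\<Union>n. \<Union>(p,q)\<in>PQ. N2 n p q)"
  have "negligible (\<Union>n. N1 n)" using neg1 by (intro negligible_Union_nat)
  moreover have "negligible (\<Union>n. \<Union>(p,q)\<in>PQ. N2 n p q)"
  proof (intro negligible_Union_nat negligible_countable_Union)
    fix n :: nat
    have "negligible (case pq of (p,q) \<Rightarrow> N2 n p q)" if "pq \<in> PQ" for pq
      using that neg2 by (cases pq) (simp add: PQ_def)
    then show "negligible A" if "A \<in> (\<lambda>(p,q). N2 n p q) ` PQ" for A
      using that by (elim imageE) simp
  qed (use cPQ in simp)
  ultimately have "negligible N" unfolding N_def by (rule negligible_Un)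
  have "g field_differentiable (at x)" if x: "x \<notin> N" for x
  proof (rule differentiable_if_interval_slopes_converge[OF g])
    obtain n :: nat where n: "\<bar>x\<bar> \<le> real n" using real_arch_simple by blast
    have "x \<notin> N1 n" using x by (auto simp: N_def)
    then show "\<exists>q>0. \<exists>d>0. \<forall>l u. l < u \<and> x \<in> {l..u} \<and> u - l < d \<longrightarrow> g u - g l < q * (u - l)"
    proof -
      obtain q where q: "0 < q" "\<not> steep q x" using \<open>x \<notin> N1 n\<close> n by (auto simp: N1_def)
      then obtain d where "0 < d" "\<forall>l u. l < u \<and> x \<in> {l..u} \<and> u - l < d \<longrightarrow> \<not> q * (u - l) \<le> g u - g l"
        unfolding steep_def by blast
      then show ?thesis using q(1) by (intro exI[of _ q] exI[of _ d] conjI) (auto simp: not_le)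
    qed
    fix p q :: real assume pq: "0 < p" "p < q"
    \<comment> \<open>Two rationals between \<open>p\<close> and \<open>q\<close> lead to one of the countably many exceptional sets.\<close>
    obtain p' where p': "p' \<in> \<rat>" "p < p'" "p' < q" using Rats_dense_in_real[OF pq(2)] by auto
    obtain q' where q': "q' \<in> \<rat>" "p' < q'" "q' < q" using Rats_dense_in_real[OF p'(3)] by auto
    have "(p',q') \<in> PQ" using p' q' pq by (auto simp: PQ_def)
    then have "x \<notin> N2 n p' q'" using x by (auto simp: N_def)
    then have "\<not> flat p' x \<or> \<not> steep q' x" using n by (auto simp: N2_def)
    then consider "\<not> flat p' x" | "\<not> steep q' x" by blast
    then show "(\<exists>d>0. \<forall>l u. l < u \<and> x \<in> {l..u} \<and> u - l < d \<longrightarrow> p * (u - l) < g u - g l) \<or>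
      (\<exists>d>0. \<forall>l u. l < u \<and> x \<in> {l..u} \<and> u - l < d \<longrightarrow> g u - g l < q * (u - l))"
    proof cases
      assume "\<not> flat p' x"
      then obtain d where d: "d > 0" "\<And>l u. l < u \<Longrightarrow> x \<in> {l..u} \<Longrightarrow> u - l < d \<Longrightarrow> p' * (u - l) < g u - g l"
        unfolding flat_def not_le[symmetric] by blast
      have "p * (u - l) < g u - g l" if "l < u" "x \<in> {l..u}" "u - l < d" for l u
      proof -
        have "p * (u - l) \<le> p' * (u - l)" using that p' by (intro mult_right_mono) auto
        then show ?thesis using d(2)[OF that] by linarith
      qed
      then show ?thesis using d(1) by blast
    next
      assume "\<not> steep q' x"
      then obtain d where d: "d > 0" "\<And>l u. l < u \<Longrightarrow> x \<in> {l..u} \<Longrightarrow> u - l < d \<Longrightarrow> g u - g l < q' * (u - l)"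
        unfolding steep_def not_le[symmetric] by blast
      have "g u - g l < q * (u - l)" if "l < u" "x \<in> {l..u}" "u - l < d" for l u
      proof -
        have "q' * (u - l) \<le> q * (u - l)" using that q' by (intro mult_right_mono) auto
        then show ?thesis using d(2)[OF that] by linarith
      qed
      then show ?thesis using d(1) by blast
    qed
  qed
  then have "{x. \<not> g field_differentiable (at x)} \<subseteq> N" by blast
  then have "negligible {x. \<not> g field_differentiable (at x)}"
    using \<open>negligible N\<close> negligible_subset by blast
  then have "{x. \<not> g field_differentiable (at x)} \<in> null_sets lebesgue"
    by (simp add: negligible_iff_null_sets)
  then have "AE x in lebesgue. g field_differentiable (at x)"
    by (intro AE_I'[of "{x. \<not> g field_differentiable (at x)}"]) auto
  then show ?thesis by (simp add: AE_completion_iff)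
qed

lemma concave_supergradient:
  fixes v :: "real \<Rightarrow> real"
  assumes v: "concave_on {a..b} v" and x: "a < x" "x < b"
  shows "\<exists>c. \<forall>y\<in>{a..b}. v y \<le> v x + c * (y - x)"
proof -
  have "convex_on {a..b} (\<lambda>x. - v x)" using v by (simp add: concave_on_def)
  moreover have "x \<in> interior {a..b}" using x by simp
  ultimately have "\<forall>y\<in>{a..b}. - v y \<ge> - v x +
      Inf ((\<lambda>t. (- v x - - v t) / (x - t)) ` ({x<..} \<inter> {a..b})) * (y - x)"
    by (intro ballI convex_le_Inf_differential)
  then show ?thesis
    by (intro exI[of _ "- Inf ((\<lambda>t. (- v x - - v t) / (x - t)) ` ({x<..} \<inter> {a..b}))"]) force
qed

text \<open>
  The function \<open>y \<mapsto> v y - c * y\<close> has a local maximum at \<open>x\<close>.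
\<close>

lemma derivative_eq_supergradient:
  fixes v :: "real \<Rightarrow> real"
  assumes x: "a < x" "x < b" and c: "\<forall>y\<in>{a..b}. v y \<le> v x + c * (y - x)"
    and D: "(v has_real_derivative D) (at x)"
  shows "D = c"
proof -
  define h where "h y = v y - c * y" for y
  have "(h has_real_derivative D - c) (at x)"
    unfolding h_def by (auto intro!: derivative_eq_intros D)
  moreover have "0 < min (x - a) (b - x)" using x by simp
  moreover have "\<forall>y. \<bar>x - y\<bar> < min (x - a) (b - x) \<longrightarrow> h y \<le> h x"
  proof (intro allI impI)
    fix y assume "\<bar>x - y\<bar> < min (x - a) (b - x)"
    then have "y \<in> {a..b}" by auto
    then show "h y \<le> h x" using c by (auto simp: h_def algebra_simps)
  qed
  ultimately have "D - c = 0" by (rule DERIV_local_max)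
  then show ?thesis by simp
qed

text \<open>
  The difference quotient over \<open>[x, x + h]\<close> lies between the supergradients at the two end points.
\<close>

lemma has_derivative_if_supergradient_continuous:
  fixes v :: "real \<Rightarrow> real"
  assumes x: "a < x" "x < b"
    and c: "\<And>x y. x \<in> {a<..<b} \<Longrightarrow> y \<in> {a<..<b} \<Longrightarrow> v y \<le> v x + c x * (y - x)"
    and cont: "isCont c x"
  shows "(v has_real_derivative c x) (at x)"
  unfolding DERIV_def
proof (rule LIM_I)
  fix e :: real assume e: "0 < e"
  obtain d where d: "0 < d" "\<And>y. \<bar>y - x\<bar> < d \<Longrightarrow> \<bar>c y - c x\<bar> < e"
    using cont e unfolding continuous_at_eps_delta by (auto simp: dist_real_def)
  show "\<exists>s>0. \<forall>h. h \<noteq> 0 \<and> norm (h - 0) < s \<longrightarrow> norm ((v (x + h) - v x) / h - c x) < e"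
  proof (intro exI[of _ "min d (min (x - a) (b - x))"] conjI allI impI)
    show "0 < min d (min (x - a) (b - x))" using d x by simp
    fix h :: real assume h: "h \<noteq> 0 \<and> norm (h - 0) < min d (min (x - a) (b - x))"
    then have xh: "x + h \<in> {a<..<b}" by (auto simp: abs_less_iff)
    have ce: "\<bar>c (x + h) - c x\<bar> < e" using d(2)[of "x + h"] h by simp
    have 1: "v (x + h) - v x \<le> c x * h" using c[of x "x + h"] xh x by simp
    have 2: "c (x + h) * h \<le> v (x + h) - v x" using c[of "x + h" x] xh x by simp
    have "\<bar>(v (x + h) - v x) - c x * h\<bar> \<le> \<bar>(c (x + h) - c x) * h\<bar>"
      using 1 2 by (simp add: algebra_simps abs_if)
    then have "\<bar>(v (x + h) - v x) - c x * h\<bar> \<le> \<bar>c (x + h) - c x\<bar> * \<bar>h\<bar>" by (simp add: abs_mult)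
    then have "\<bar>(v (x + h) - v x) - c x * h\<bar> / \<bar>h\<bar> \<le> \<bar>c (x + h) - c x\<bar>"
      using h by (simp add: pos_divide_le_eq)
    moreover have "\<bar>(v (x + h) - v x) - c x * h\<bar> / \<bar>h\<bar> = \<bar>(v (x + h) - v x) / h - c x\<bar>"
      using h by (simp add: diff_divide_distrib flip: abs_divide)
    ultimately show "norm ((v (x + h) - v x) / h - c x) < e" using ce by simp
  qed
qed

text \<open>
  A selection \<open>c\<close> of supergradients is decreasing, hence differentiable almost everywhere by Lebesgue's
  theorem. Where \<open>c\<close> is continuous it is the derivative of \<open>v\<close>, and wherever \<open>v\<close> is differentiable its
  derivative is \<open>c\<close>; so the derivative of \<open>c\<close> is the second derivative of \<open>v\<close> along the
  differentiability points. The Lipschitz constant bounds \<open>c\<close>, which lets \<open>- c\<close> extend to a monotone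
  function on the whole line.
\<close>

theorem concave_twice_differentiable_AE:
  fixes v :: "real \<Rightarrow> real"
  assumes v: "concave_on {a..b} v" and L: "L-lipschitz_on {a..b} v"
  shows "AE x in lborel. x \<in> {a..b} \<longrightarrow> twice_differentiable_at v x"
proof -
  have "\<forall>x\<in>{a<..<b}. \<exists>c. \<forall>y\<in>{a..b}. v y \<le> v x + c * (y - x)"
    using concave_supergradient[OF v] by auto
  then obtain c where c: "\<And>x y. x \<in> {a<..<b} \<Longrightarrow> y \<in> {a..b} \<Longrightarrow> v y \<le> v x + c x * (y - x)"
    by metis
  have cL: "\<bar>c x\<bar> \<le> L" if x: "x \<in> {a<..<b}" for x
  proof -
    have la: "v x - v a \<le> L * (x - a)" using lipschitz_onD[OF L, of x a] x by (auto simp: dist_real_def)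
    have lb: "v x - v b \<le> L * (b - x)" using lipschitz_onD[OF L, of x b] x by (auto simp: dist_real_def)
    have "c x * (x - a) \<le> L * (x - a)" using c[OF x, of a] la x by (auto simp: algebra_simps)
    then have "c x \<le> L" using x by simp
    moreover have "- c x * (b - x) \<le> L * (b - x)" using c[OF x, of b] lb x by (auto simp: algebra_simps)
    then have "- c x \<le> L" using x by (subst (asm) mult_le_cancel_right) auto
    ultimately show ?thesis by simp
  qed
  have anti: "c y \<le> c x" if "x \<in> {a<..<b}" "y \<in> {a<..<b}" "x \<le> y" for x y
  proof (cases "x = y")
    case False
    have "v y \<le> v x + c x * (y - x)" "v x \<le> v y + c y * (x - y)" using c that by auto
    then have "c y * (y - x) \<le> c x * (y - x)" by (simp add: algebra_simps)
    then show ?thesis using False that by simp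
  qed simp
  define g where "g x = (if x \<le> a then - \<bar>L\<bar> else if b \<le> x then \<bar>L\<bar> else - c x)" for x
  have "mono g"
  proof (rule monoI)
    fix x y :: real assume xy: "x \<le> y"
    have "- \<bar>L\<bar> \<le> g z \<and> g z \<le> \<bar>L\<bar>" for z using cL[of z] by (auto simp: g_def)
    then have b1: "- \<bar>L\<bar> \<le> g y" "g x \<le> \<bar>L\<bar>" by auto
    consider "x \<le> a" | "b \<le> y" "a < x" | "x \<in> {a<..<b}" "y \<in> {a<..<b}" using xy by fastforce
    then show "g x \<le> g y"
    proof cases
      case 1 then show ?thesis using b1 by (simp add: g_def)
    next
      case 2 then show ?thesis using b1 xy by (simp add: g_def)
    next
      case 3 then show ?thesis using anti[OF 3 xy] by (simp add: g_def)
    qed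
  qed
  then have gd: "AE x in lborel. g field_differentiable (at x)" by (rule mono_differentiable_AE)
  have "twice_differentiable_at v x" if x: "x \<in> {a<..<b}" and gx: "g field_differentiable (at x)" for x
  proof -
    obtain D where D: "(g has_real_derivative D) (at x)"
      using gx by (auto simp: field_differentiable_def)
    have ev: "eventually (\<lambda>y. y \<in> {a<..<b}) (nhds x)"
      using x by (intro eventually_nhds_in_open) auto
    have "((\<lambda>y. - g y) has_real_derivative - D) (at x)" using D by (rule DERIV_minus)
    then have Dc: "(c has_real_derivative - D) (at x)"
      by (rule DERIV_cong_ev[THEN iffD1, rotated -1])
         (auto intro!: eventually_mono[OF ev] simp: g_def)
    have der: "(v has_real_derivative c y) (at y)" if "y \<in> {a<..<b}" "isCont c y" for y
      by (rule has_derivative_if_supergradient_continuous[of a y b v c]) (use that c in auto)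
    have "(v has_real_derivative c x) (at x)" using der[OF x DERIV_isCont[OF Dc]] .
    then have 1: "v field_differentiable (at x)" by (auto simp: field_differentiable_def)
    have dv: "deriv v y = c y" if y: "y \<in> {a<..<b}" "v field_differentiable (at y)" for y
    proof (rule derivative_eq_supergradient[of a y b v])
      show "(v has_real_derivative deriv v y) (at y)"
        using y(2) by (simp add: field_differentiable_derivI)
    qed (use y c in auto)
    have "(deriv v has_real_derivative - D) (at x within {y. v field_differentiable (at y)})"
    proof (rule has_field_derivative_transform_within)
      show "(c has_real_derivative - D) (at x within {y. v field_differentiable (at y)})"
        using Dc by (rule has_field_derivative_at_within)
      show "0 < min (x - a) (b - x)" using x by simp
      show "x \<in> {y. v field_differentiable (at y)}" using 1 by simp
      fix y assume y: "y \<in> {y. v field_differentiable (at y)}" "dist y x < min (x - a) (b - x)"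
      then have "y \<in> {a<..<b}" by (auto simp: dist_real_def abs_less_iff)
      then show "c y = deriv v y" using dv y(1) by simp
    qed
    then show ?thesis using 1 by (auto simp: twice_differentiable_at_def)
  qed
  moreover have "AE x in lborel. x \<noteq> a" "AE x in lborel. x \<noteq> b"
    by (rule AE_lborel_singleton)+
  ultimately show ?thesis using gd by (auto elim!: eventually_elim2 simp: less_le)
qed

section \<open>Brownian increments and simple stochastic integrals\<close>

locale filtered_brownian = prob_space \<Omega> for \<Omega> :: "'a measure" +
  fixes F :: "real \<Rightarrow> 'a measure" and W :: "real \<Rightarrow> 'a \<Rightarrow> real" and T :: real
  assumes filtration: "filtration_upto \<Omega> T F"
    and brownian: "brownian_motion \<Omega> T F W"
begin

lemma subalgebra_F: "s \<in> {0..T} \<Longrightarrow> subalgebra \<Omega> (F s)"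
  using filtration by (auto simp: filtration_upto_def)

lemma space_F: "s \<in> {0..T} \<Longrightarrow> space (F s) = space \<Omega>"
  using subalgebra_F by (auto simp: subalgebra_def)

lemma measurable_F_mono:
  assumes "Y \<in> borel_measurable (F s)" "0 \<le> s" "s \<le> s'" "s' \<le> T"
  shows "Y \<in> borel_measurable (F s')"
proof -
  have "subalgebra (F s') (F s)"
    using assms filtration space_F[of s] space_F[of s'] by (auto simp: subalgebra_def filtration_upto_def)
  then show ?thesis using assms(1) by (rule measurable_from_subalg)
qed

lemma measurable_F_imp: "Y \<in> borel_measurable (F s) \<Longrightarrow> s \<in> {0..T} \<Longrightarrow> Y \<in> borel_measurable \<Omega>"
  using measurable_from_subalg[OF subalgebra_F] by blast

lemma W_measurable: "s \<in> {0..T} \<Longrightarrow> W s \<in> borel_measurable (F s)"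
  using brownian by (auto simp: brownian_motion_def)

text \<open>
  The increment is independent of \<open>F a\<close> and has mean \<open>0\<close> and variance \<open>b - a\<close>, so the expectations
  factor.
\<close>

lemma brownian_increment:
  assumes ab: "0 \<le> a" "a \<le> b" "b \<le> T"
    and Y: "Y \<in> borel_measurable (F a)" "integrable \<Omega> Y"
  shows "integrable \<Omega> (\<lambda>\<omega>. Y \<omega> * (W b \<omega> - W a \<omega>))" (is ?i1)
    and "expectation (\<lambda>\<omega>. Y \<omega> * (W b \<omega> - W a \<omega>)) = 0" (is ?e1)
    and "integrable \<Omega> (\<lambda>\<omega>. Y \<omega> * (W b \<omega> - W a \<omega>)\<^sup>2)" (is ?i2)
    and "expectation (\<lambda>\<omega>. Y \<omega> * (W b \<omega> - W a \<omega>)\<^sup>2) = expectation Y * (b - a)" (is ?e2)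
proof -
  have "?i1 \<and> ?e1 \<and> ?i2 \<and> ?e2"
  proof (cases "a = b")
    case False
    define D where "D = (\<lambda>\<omega>. W b \<omega> - W a \<omega>)"
    define \<sigma> where "\<sigma> = sqrt (b - a)"
    have lt: "a < b" and \<sigma>: "0 < \<sigma>" using False ab by (auto simp: \<sigma>_def)
    have dist: "distributed \<Omega> lborel D (normal_density 0 \<sigma>)"
      and ind: "indep_set (sets (vimage_algebra (space \<Omega>) D borel)) (sets (F a))"
      using brownian lt ab by (auto simp: brownian_motion_def D_def \<sigma>_def)
    have Dm: "D \<in> borel_measurable \<Omega>" using distributed_measurable[OF dist] by simp
    have Ym: "Y \<in> borel_measurable \<Omega>" using Y ab by (intro measurable_F_imp[of Y a]) auto
    have ind1: "indep_var borel D borel Y"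
      unfolding indep_var_eq
    proof (intro conjI indep_set_sigma_sets)
      \<comment> \<open>Independence of the generated sigma-algebras follows from that of the preimages.\<close>
      have stable: "Int_stable {X -` A \<inter> space \<Omega> |A. A \<in> sets borel}" for X :: "'a \<Rightarrow> real"
      proof (rule Int_stableI, elim CollectE exE conjE)
        fix S S' and A B :: "real set"
        assume "S = X -` A \<inter> space \<Omega>" "S' = X -` B \<inter> space \<Omega>" "A \<in> sets borel" "B \<in> sets borel"
        then show "S \<inter> S' \<in> {X -` A \<inter> space \<Omega> |A. A \<in> sets borel}"
          by (intro CollectI exI[of _ "A \<inter> B"]) auto
      qed
      show "Int_stable {D -` A \<inter> space \<Omega> |A. A \<in> sets borel}"
        "Int_stable {Y -` A \<inter> space \<Omega> |A. A \<in> sets borel}" by (rule stable)+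
      show "indep_set {D -` A \<inter> space \<Omega> |A. A \<in> sets borel} {Y -` A \<inter> space \<Omega> |A. A \<in> sets borel}"
      proof (safe intro!: indep_setI)
        fix A B :: "real set" assume A: "A \<in> sets borel" and B: "B \<in> sets borel"
        show "D -` A \<inter> space \<Omega> \<in> events" "Y -` B \<inter> space \<Omega> \<in> events"
          using A B Dm Ym by (auto intro: measurable_sets)
        have "D -` A \<inter> space \<Omega> \<in> sets (vimage_algebra (space \<Omega>) D borel)"
          using A by (rule in_vimage_algebra)
        moreover have "Y -` B \<inter> space \<Omega> \<in> sets (F a)"
          using measurable_sets[OF Y(1) B] space_F[of a] ab by simp
        ultimately show "prob ((D -` A \<inter> space \<Omega>) \<inter> (Y -` B \<inter> space \<Omega>)) =
            prob (D -` A \<inter> space \<Omega>) * prob (Y -` B \<inter> space \<Omega>)"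
          using ind by (rule indep_setD[rotated])
      qed
    qed (use Dm Ym in auto)
    have ind2: "indep_var borel (\<lambda>\<omega>. (D \<omega>)\<^sup>2) borel Y"
    proof -
      have "(\<lambda>x::real. x\<^sup>2) \<in> borel_measurable borel" by measurable
      from indep_var_compose[OF ind1 this measurable_ident] show ?thesis unfolding comp_def id_def .
    qed
    have D1: "integrable \<Omega> D"
      using integrable_normal_moment[OF \<sigma>, of 0 1] distributed_integrable[OF dist, of "\<lambda>x. x"] by simp
    have D2: "integrable \<Omega> (\<lambda>\<omega>. (D \<omega>)\<^sup>2)"
      using integrable_normal_moment[OF \<sigma>, of 0 2] distributed_integrable[OF dist, of "\<lambda>x. x\<^sup>2"] by simp
    have E1: "expectation D = 0" using normal_distributed_expectation[OF \<sigma> dist] .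
    have E2: "expectation (\<lambda>\<omega>. (D \<omega>)\<^sup>2) = b - a"
      using normal_distributed_variance[OF \<sigma> dist] E1 lt by (simp add: \<sigma>_def)
    show ?thesis
      using indep_var_integrable[OF ind1 D1 Y(2)] indep_var_lebesgue_integral[OF ind1 D1 Y(2)]
        indep_var_integrable[OF ind2 D2 Y(2)] indep_var_lebesgue_integral[OF ind2 D2 Y(2)] E1 E2
      by (simp add: D_def mult.commute)
  qed simp
  then show ?i1 ?e1 ?i2 ?e2 by auto
qed

lemma simple_integrand_times:
  assumes si: "simple_integrand \<Omega> F a b N \<tau> \<xi>" and ij: "i \<le> j" "j \<le> N"
  shows "\<tau> i \<le> \<tau> j" "a \<le> \<tau> i" "\<tau> j \<le> b"
proof -
  have step: "\<And>k. k < N \<Longrightarrow> \<tau> k \<le> \<tau> (Suc k)" and ends: "\<tau> 0 = a" "\<tau> N = b"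
    using si by (auto simp: simple_integrand_def)
  have mono: "\<tau> k \<le> \<tau> l" if "k \<le> l" "l \<le> N" for k l
    using that
  proof (induction l rule: dec_induct)
    case (step n)
    then show ?case using \<open>\<And>k. k < N \<Longrightarrow> \<tau> k \<le> \<tau> (Suc k)\<close>[of n] by simp
  qed simp
  show "\<tau> i \<le> \<tau> j" using mono ij by auto
  show "a \<le> \<tau> i" "\<tau> j \<le> b" using mono[of 0 i] mono[of j N] ij ends by auto
qed

lemma simple_integral_measurable:
  assumes si: "simple_integrand \<Omega> F a b N \<tau> \<xi>" and ab: "0 \<le> a" "b \<le> T" and s: "s \<in> {a..b}"
  shows "k \<le> N \<Longrightarrow> simple_integral W k \<tau> \<xi> s \<in> borel_measurable (F (min (\<tau> k) s))"
proof (induction k)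
  case 0
  then show ?case by (simp add: simple_integral_def[abs_def])
next
  case (Suc k)
  note t = simple_integrand_times[OF si, of k "Suc k"]
  have k: "k < N" using Suc by simp
  have b1: "0 \<le> min (\<tau> k) s" "min (\<tau> k) s \<le> min (\<tau> (Suc k)) s" "min (\<tau> (Suc k)) s \<le> T"
    using t k s ab by auto
  let ?G = "F (min (\<tau> (Suc k)) s)"
  have IH: "simple_integral W k \<tau> \<xi> s \<in> borel_measurable ?G"
    using measurable_F_mono[OF _ b1] Suc by auto
  have tm: "(\<lambda>\<omega>. \<xi> k \<omega> * (W (min (\<tau> (Suc k)) s) \<omega> - W (min (\<tau> k) s) \<omega>)) \<in> borel_measurable ?G"
  proof (cases "\<tau> k \<le> s")
    case True
    have "\<xi> k \<in> borel_measurable (F (\<tau> k))" using si k by (auto simp: simple_integrand_def)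
    moreover have "0 \<le> \<tau> k" "\<tau> k \<le> min (\<tau> (Suc k)) s" using t k ab True by auto
    ultimately have "\<xi> k \<in> borel_measurable ?G" using b1(3) by (rule measurable_F_mono)
    moreover have "min (\<tau> (Suc k)) s \<in> {0..T}" "min (\<tau> k) s \<in> {0..T}"
      unfolding atLeastAtMost_iff using b1 order_trans[OF b1(1,2)] order_trans[OF b1(2,3)] by blast+
    then have "W (min (\<tau> (Suc k)) s) \<in> borel_measurable ?G" "W (min (\<tau> k) s) \<in> borel_measurable ?G"
      by (auto intro: W_measurable measurable_F_mono[OF W_measurable b1])
    ultimately show ?thesis by measurable
  next
    case False
    then show ?thesis using t k by (simp add: min_def)
  qed
  have "simple_integral W (Suc k) \<tau> \<xi> s =
      (\<lambda>\<omega>. simple_integral W k \<tau> \<xi> s \<omega> + \<xi> k \<omega> * (W (min (\<tau> (Suc k)) s) \<omega> - W (min (\<tau> k) s) \<omega>))"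
    by (auto simp: simple_integral_def)
  then show ?case using IH tm by simp
qed

lemma bounded_measurable_integrable_mult:
  fixes Y Z :: "'a \<Rightarrow> real"
  assumes "Y \<in> borel_measurable \<Omega>" "bounded (Y ` space \<Omega>)" "integrable \<Omega> Z"
  shows "integrable \<Omega> (\<lambda>\<omega>. Y \<omega> * Z \<omega>)"
proof -
  obtain B where B: "\<forall>\<omega>\<in>space \<Omega>. \<bar>Y \<omega>\<bar> \<le> B" using assms(2) by (auto simp: bounded_iff)
  show ?thesis
    by (rule Bochner_Integration.integrable_bound[of _ "\<lambda>\<omega>. B * Z \<omega>"])
       (use assms B in \<open>auto simp: abs_mult intro!: AE_I2 mult_right_mono intro: order_trans abs_ge_self\<close>)
qed

text \<open>
  Induction over the steps of the integrand: the past \<open>simple_integral W k\<close> is measurable at time \<open>\<tau> k\<close>,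
  so that its cross term with the next increment has mean zero. Steps that begin after \<open>s\<close> contribute
  nothing, since both of their end points are cut to \<open>s\<close>.
\<close>

lemma simple_integral_isometry:
  assumes si: "simple_integrand \<Omega> F a b N \<tau> \<xi>" and ab: "0 \<le> a" "b \<le> T" and s: "s \<in> {a..b}"
  shows "k \<le> N \<Longrightarrow> integrable \<Omega> (\<lambda>\<omega>. (simple_integral W k \<tau> \<xi> s \<omega>)\<^sup>2) \<and>
    expectation (\<lambda>\<omega>. (simple_integral W k \<tau> \<xi> s \<omega>)\<^sup>2) =
    expectation (\<lambda>\<omega>. \<Sum>i<k. (\<xi> i \<omega>)\<^sup>2 * (min (\<tau> (Suc i)) s - min (\<tau> i) s)) \<and>
    integrable \<Omega> (\<lambda>\<omega>. \<Sum>i<k. (\<xi> i \<omega>)\<^sup>2 * (min (\<tau> (Suc i)) s - min (\<tau> i) s))"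
proof (induction k)
  case 0
  then show ?case by (simp add: simple_integral_def[abs_def])
next
  case (Suc k)
  note t = simple_integrand_times[OF si, of k "Suc k"]
  have k: "k < N" using Suc by simp
  let ?J = "simple_integral W k \<tau> \<xi> s" and ?D = "\<lambda>\<omega>. W (min (\<tau> (Suc k)) s) \<omega> - W (min (\<tau> k) s) \<omega>"
  have step: "simple_integral W (Suc k) \<tau> \<xi> s = (\<lambda>\<omega>. ?J \<omega> + \<xi> k \<omega> * ?D \<omega>)"
    by (auto simp: simple_integral_def)
  have IH: "integrable \<Omega> (\<lambda>\<omega>. (?J \<omega>)\<^sup>2)" using Suc by simp
  show ?case
  proof (cases "\<tau> k \<le> s")
    case False
    then have D0: "min (\<tau> (Suc k)) s = min (\<tau> k) s" using t k by simp
    show ?thesis using Suc unfolding step sum.lessThan_Suc D0 by simp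
  next
    case True
    then have mk: "min (\<tau> k) s = \<tau> k" by simp
    define b' where "b' = min (\<tau> (Suc k)) s"
    have b1: "0 \<le> \<tau> k" "\<tau> k \<le> b'" "b' \<le> T" using t k s ab True by (auto simp: b'_def)
    have \<xi>m: "\<xi> k \<in> borel_measurable (F (\<tau> k))" and \<xi>b: "bounded (\<xi> k ` space \<Omega>)"
      using si k by (auto simp: simple_integrand_def)
    have tk: "\<tau> k \<in> {0..T}" using b1 by auto
    have Jm: "?J \<in> borel_measurable (F (\<tau> k))"
      using simple_integral_measurable[OF si ab s, of k] k mk by simp
    note Jm' = measurable_F_imp[OF Jm tk] and \<xi>m' = measurable_F_imp[OF \<xi>m tk]
    have J1: "integrable \<Omega> ?J" using square_integrable_imp_integrable[OF Jm' IH] .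
    have J\<xi>: "integrable \<Omega> (\<lambda>\<omega>. \<xi> k \<omega> * ?J \<omega>)"
      using bounded_measurable_integrable_mult[OF \<xi>m' \<xi>b J1] .
    have \<xi>1: "integrable \<Omega> (\<xi> k)" using bounded_measurable_integrable_mult[OF \<xi>m' \<xi>b, of "\<lambda>_. 1"] by simp
    have \<xi>2: "integrable \<Omega> (\<lambda>\<omega>. (\<xi> k \<omega>)\<^sup>2)"
      using bounded_measurable_integrable_mult[OF \<xi>m' \<xi>b \<xi>1] by (simp add: power2_eq_square)
    have m1: "(\<lambda>\<omega>. \<xi> k \<omega> * ?J \<omega>) \<in> borel_measurable (F (\<tau> k))" using \<xi>m Jm by measurable
    have m2: "(\<lambda>\<omega>. (\<xi> k \<omega>)\<^sup>2) \<in> borel_measurable (F (\<tau> k))" using \<xi>m by measurable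
    note cross = brownian_increment(1,2)[OF b1 m1 J\<xi>]
    note sq = brownian_increment(3,4)[OF b1 m2 \<xi>2]
    have eq: "(simple_integral W (Suc k) \<tau> \<xi> s \<omega>)\<^sup>2 = (?J \<omega>)\<^sup>2 +
        (2 * (\<xi> k \<omega> * ?J \<omega> * (W b' \<omega> - W (\<tau> k) \<omega>)) + (\<xi> k \<omega>)\<^sup>2 * (W b' \<omega> - W (\<tau> k) \<omega>)\<^sup>2)" for \<omega>
      unfolding step mk b'_def by (simp add: power2_eq_square algebra_simps)
    show ?thesis
      unfolding eq
      using Suc cross sq IH \<xi>2 k unfolding mk sum.lessThan_Suc b'_def[symmetric]
      by simp
  qed
qed

text \<open>
  Step \<open>k\<close> contributes the increment of \<open>W\<close> from \<open>max (\<tau> k) s\<close> to \<open>\<tau> (Suc k)\<close>, and \<open>v * \<xi> k\<close> is known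
  at the first of these times.
\<close>

lemma simple_integral_martingale:
  assumes si: "simple_integrand \<Omega> F a b N \<tau> \<xi>" and ab: "0 \<le> a" "b \<le> T" and s: "s \<in> {a..b}"
    and v: "v \<in> borel_measurable (F s)" "bounded (v ` space \<Omega>)"
  shows "k \<le> N \<Longrightarrow> integrable \<Omega> (\<lambda>\<omega>. v \<omega> * (simple_integral W k \<tau> \<xi> b \<omega> - simple_integral W k \<tau> \<xi> s \<omega>)) \<and>
    expectation (\<lambda>\<omega>. v \<omega> * (simple_integral W k \<tau> \<xi> b \<omega> - simple_integral W k \<tau> \<xi> s \<omega>)) = 0"
proof (induction k)
  case 0
  then show ?case by (simp add: simple_integral_def[abs_def])
next
  case (Suc k)
  note t = simple_integrand_times[OF si, of k "Suc k"]
  have k: "k < N" using Suc by simp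
  let ?J = "\<lambda>k \<omega>. simple_integral W k \<tau> \<xi> b \<omega> - simple_integral W k \<tau> \<xi> s \<omega>"
  let ?D = "\<lambda>\<omega>. W (min (\<tau> (Suc k)) b) \<omega> - W (min (\<tau> k) b) \<omega> - (W (min (\<tau> (Suc k)) s) \<omega> - W (min (\<tau> k) s) \<omega>)"
  have step: "v \<omega> * ?J (Suc k) \<omega> = v \<omega> * ?J k \<omega> + v \<omega> * \<xi> k \<omega> * ?D \<omega>" for \<omega>
    by (auto simp: simple_integral_def algebra_simps)
  have "integrable \<Omega> (\<lambda>\<omega>. v \<omega> * \<xi> k \<omega> * ?D \<omega>) \<and> expectation (\<lambda>\<omega>. v \<omega> * \<xi> k \<omega> * ?D \<omega>) = 0"
  proof (cases "\<tau> (Suc k) \<le> s")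
    case True
    then have "\<tau> k \<le> s" "\<tau> k \<le> b" "\<tau> (Suc k) \<le> b" using t k s by auto
    then show ?thesis using True by (simp add: min_def)
  next
    case False
    define c where "c = max (\<tau> k) s"
    have D: "?D \<omega> = W (\<tau> (Suc k)) \<omega> - W c \<omega>" for \<omega>
      using False t k s by (auto simp: c_def min_def max_def)
    have c1: "0 \<le> c" "c \<le> \<tau> (Suc k)" "\<tau> (Suc k) \<le> T" and tk: "0 \<le> \<tau> k" "\<tau> k \<le> c" "c \<le> T"
      using t k s ab False by (auto simp: c_def)
    have \<xi>m: "\<xi> k \<in> borel_measurable (F c)" and \<xi>b: "bounded (\<xi> k ` space \<Omega>)"
      using si k measurable_F_mono[OF _ tk] by (auto simp: simple_integrand_def)
    have vm: "v \<in> borel_measurable (F c)"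
      using measurable_F_mono[OF v(1), of c] s ab tk by (auto simp: c_def)
    have cT: "c \<in> {0..T}" using c1 by auto
    have "integrable \<Omega> (\<xi> k)"
      using bounded_measurable_integrable_mult[OF measurable_F_imp[OF \<xi>m cT] \<xi>b, of "\<lambda>_. 1"] by simp
    then have int: "integrable \<Omega> (\<lambda>\<omega>. v \<omega> * \<xi> k \<omega>)"
      by (rule bounded_measurable_integrable_mult[OF measurable_F_imp[OF vm cT] v(2)])
    have "(\<lambda>\<omega>. v \<omega> * \<xi> k \<omega>) \<in> borel_measurable (F c)" using vm \<xi>m by measurable
    then show ?thesis using brownian_increment(1,2)[OF c1 _ int] unfolding D by simp
  qed
  then show ?case using Suc k unfolding step by simp
qed

end

text \<open>
  The integrand is switched off from the step on in which its quadratic variation up to time \<open>S\<close> would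
  exceed \<open>R\<close>. The sum includes step \<open>i\<close> itself, so that the level is never crossed; it is still known at
  time \<open>\<tau> i\<close>, because the lengths of the steps are deterministic.
\<close>

definition truncate_integrand ::
    "real \<Rightarrow> real \<Rightarrow> (nat \<Rightarrow> real) \<Rightarrow> (nat \<Rightarrow> 'a \<Rightarrow> real) \<Rightarrow> nat \<Rightarrow> 'a \<Rightarrow> real" where
  "truncate_integrand S R \<tau> \<xi> i \<omega> =
     (if (\<Sum>j\<le>i. (\<xi> j \<omega>)\<^sup>2 * (min (\<tau> (Suc j)) S - min (\<tau> j) S)) \<le> R then \<xi> i \<omega> else 0)"

text \<open>
  The steps that survive form an initial segment, and the partial sum at the last of them is at most
  \<open>R\<close>.
\<close>

lemma truncated_sum_le:
  assumes "0 \<le> R" "\<And>i. i < n \<Longrightarrow> \<tau> i \<le> \<tau> (Suc i)"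
  shows "(\<Sum>i<n. (truncate_integrand S R \<tau> \<xi> i \<omega>)\<^sup>2 * (min (\<tau> (Suc i)) S - min (\<tau> i) S))
    \<le> min (\<Sum>i<n. (\<xi> i \<omega>)\<^sup>2 * (min (\<tau> (Suc i)) S - min (\<tau> i) S)) R"
  using assms(2)
proof (induction n)
  case (Suc n)
  let ?q = "\<lambda>i. (\<xi> i \<omega>)\<^sup>2 * (min (\<tau> (Suc i)) S - min (\<tau> i) S)"
  have "\<tau> n \<le> \<tau> (Suc n)" using Suc.prems by simp
  then have "0 \<le> ?q n" by (auto intro!: mult_nonneg_nonneg)
  moreover have "(\<Sum>j\<le>n. ?q j) = (\<Sum>j<n. ?q j) + ?q n" by (simp flip: lessThan_Suc_atMost)
  ultimately show ?case using Suc.IH Suc.prems by (auto simp: truncate_integrand_def)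
qed (use assms in simp)

lemma truncate_integrand_eq:
  assumes "(\<Sum>i<n. (\<xi> i \<omega>)\<^sup>2 * (min (\<tau> (Suc i)) S - min (\<tau> i) S)) \<le> R"
    and "\<And>i. i < n \<Longrightarrow> \<tau> i \<le> \<tau> (Suc i)" and i: "i < n"
  shows "truncate_integrand S R \<tau> \<xi> i \<omega> = \<xi> i \<omega>"
proof -
  let ?q = "\<lambda>i. (\<xi> i \<omega>)\<^sup>2 * (min (\<tau> (Suc i)) S - min (\<tau> i) S)"
  have "(\<Sum>j\<le>i. ?q j) \<le> (\<Sum>j<n. ?q j)"
  proof (rule sum_mono2)
    fix j assume "j \<in> {..<n} - {..i}"
    then have "\<tau> j \<le> \<tau> (Suc j)" using assms(2) by simp
    then show "0 \<le> ?q j" by (auto intro!: mult_nonneg_nonneg)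
  qed (use i in auto)
  then show ?thesis using assms(1) by (simp add: truncate_integrand_def)
qed

context filtered_brownian
begin

lemma truncate_simple_integrand:
  assumes si: "simple_integrand \<Omega> F a b N \<tau> \<xi>" and ab: "0 \<le> a" "b \<le> T"
  shows "simple_integrand \<Omega> F a b N \<tau> (truncate_integrand S R \<tau> \<xi>)"
  unfolding simple_integrand_def
proof (intro conjI allI impI)
  show "\<tau> 0 = a" "\<tau> N = b" "\<And>i. i < N \<Longrightarrow> \<tau> i \<le> \<tau> (Suc i)"
    using si by (auto simp: simple_integrand_def)
  fix i assume i: "i < N"
  have \<xi>: "\<xi> j \<in> borel_measurable (F (\<tau> i))" if "j \<le> i" for j
  proof (rule measurable_F_mono)
    show "\<xi> j \<in> borel_measurable (F (\<tau> j))" using si that i by (auto simp: simple_integrand_def)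
    show "0 \<le> \<tau> j" "\<tau> j \<le> \<tau> i" "\<tau> i \<le> T"
      using simple_integrand_times[OF si that] i ab by auto
  qed
  have [measurable]: "\<xi> i \<in> borel_measurable (F (\<tau> i))" using \<xi> by simp
  have [measurable]: "(\<lambda>\<omega>. \<Sum>j\<le>i. (\<xi> j \<omega>)\<^sup>2 * (min (\<tau> (Suc j)) S - min (\<tau> j) S)) \<in> borel_measurable (F (\<tau> i))"
    using \<xi> by (intro borel_measurable_sum borel_measurable_times borel_measurable_power) auto
  show "truncate_integrand S R \<tau> \<xi> i \<in> borel_measurable (F (\<tau> i))"
    unfolding truncate_integrand_def[abs_def] by measurable
  obtain B where B: "\<forall>\<omega>\<in>space \<Omega>. \<bar>\<xi> i \<omega>\<bar> \<le> B"
    using si i by (auto simp: simple_integrand_def bounded_iff)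
  have "norm (truncate_integrand S R \<tau> \<xi> i \<omega>) \<le> \<bar>B\<bar>" if "\<omega> \<in> space \<Omega>" for \<omega>
    using B that by (fastforce simp: truncate_integrand_def)
  then show "bounded (truncate_integrand S R \<tau> \<xi> i ` space \<Omega>)"
    unfolding bounded_iff by blast
qed

text \<open>
  At most one of the intervals \<open>{\<tau> i<..\<tau> (Suc i)}\<close> contains \<open>s\<close>, so the square has no cross terms.
\<close>

lemma simple_process_square:
  assumes mono: "\<And>i. i < n \<Longrightarrow> \<tau> i \<le> \<tau> (Suc i)"
  shows "(simple_process n \<tau> \<xi> s \<omega>)\<^sup>2 = (\<Sum>i<n. (\<xi> i \<omega>)\<^sup>2 * indicator {\<tau> i<..\<tau> (Suc i)} s)"
  using mono
proof (induction n)
  case (Suc n)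
  have IH: "(simple_process n \<tau> \<xi> s \<omega>)\<^sup>2 = (\<Sum>i<n. (\<xi> i \<omega>)\<^sup>2 * indicator {\<tau> i<..\<tau> (Suc i)} s)"
    using Suc by simp
  have step: "simple_process (Suc n) \<tau> \<xi> s \<omega> =
      simple_process n \<tau> \<xi> s \<omega> + \<xi> n \<omega> * indicator {\<tau> n<..\<tau> (Suc n)} s"
    by (simp add: simple_process_def)
  show ?case
  proof (cases "s \<in> {\<tau> n<..\<tau> (Suc n)}")
    case True
    have le: "\<tau> (Suc i) \<le> \<tau> n" if "i < n" for i
    proof -
      have "Suc i \<le> n" using that by simp
      then have "n \<le> n \<longrightarrow> \<tau> (Suc i) \<le> \<tau> n"
      proof (induction rule: dec_induct)
        case (step k)
        then show ?case using Suc.prems[of k] by (metis less_Suc_eq order_trans order_refl)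
      qed simp
      then show ?thesis by simp
    qed
    have "simple_process n \<tau> \<xi> s \<omega> = 0"
      unfolding simple_process_def
    proof (rule sum.neutral, intro ballI)
      fix i assume "i \<in> {..<n}"
      then have "\<tau> (Suc i) < s" using le[of i] True by simp
      then show "\<xi> i \<omega> * indicator {\<tau> i<..\<tau> (Suc i)} s = 0" by simp
    qed
    then show ?thesis using IH True unfolding step by simp
  next
    case False
    then show ?thesis using IH unfolding step by simp
  qed
qed (simp add: simple_process_def)

lemma simple_process_square_integral:
  assumes si: "simple_integrand \<Omega> F a b N \<tau> \<xi>" and S: "S \<in> {a..b}"
  shows "has_bochner_integral lborel (\<lambda>s. indicator {a..S} s *\<^sub>R (simple_process N \<tau> \<xi> s \<omega>)\<^sup>2)
    (\<Sum>i<N. (\<xi> i \<omega>)\<^sup>2 * (min (\<tau> (Suc i)) S - min (\<tau> i) S))"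
proof -
  have mono: "\<And>i. i < N \<Longrightarrow> \<tau> i \<le> \<tau> (Suc i)" using si by (auto simp: simple_integrand_def)
  have eq: "indicator {a..S} s *\<^sub>R (simple_process N \<tau> \<xi> s \<omega>)\<^sup>2 =
      (\<Sum>i<N. (\<xi> i \<omega>)\<^sup>2 * indicator {min (\<tau> i) S<..min (\<tau> (Suc i)) S} s)" for s
  proof -
    have "(simple_process N \<tau> \<xi> s \<omega>)\<^sup>2 = (\<Sum>i<N. (\<xi> i \<omega>)\<^sup>2 * indicator {\<tau> i<..\<tau> (Suc i)} s)"
      using mono by (rule simple_process_square)
    also have "indicator {a..S} s *\<^sub>R \<dots> = (\<Sum>i<N. indicator {a..S} s * ((\<xi> i \<omega>)\<^sup>2 * indicator {\<tau> i<..\<tau> (Suc i)} s))"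
      by (simp only: real_scaleR_def sum_distrib_left)
    also have "\<dots> = (\<Sum>i<N. (\<xi> i \<omega>)\<^sup>2 * indicator {min (\<tau> i) S<..min (\<tau> (Suc i)) S} s)"
    proof (rule sum.cong)
      fix i assume "i \<in> {..<N}"
      then have "a \<le> \<tau> i" using simple_integrand_times[OF si, of i i] by simp
      then show "indicator {a..S} s * ((\<xi> i \<omega>)\<^sup>2 * indicator {\<tau> i<..\<tau> (Suc i)} s) =
          (\<xi> i \<omega>)\<^sup>2 * indicator {min (\<tau> i) S<..min (\<tau> (Suc i)) S} s"
        by (auto simp: indicator_def)
    qed simp
    finally show ?thesis .
  qed
  show ?thesis unfolding eq
  proof (intro has_bochner_integral_sum has_bochner_integral_mult_right)
    fix i assume "i \<in> {..<N}"
    then have "\<tau> i \<le> \<tau> (Suc i)" using mono by simp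
    then have "min (\<tau> i) S \<le> min (\<tau> (Suc i)) S" by linarith
    then show "has_bochner_integral lborel (\<lambda>s. indicator {min (\<tau> i) S<..min (\<tau> (Suc i)) S} s :: real)
        (min (\<tau> (Suc i)) S - min (\<tau> i) S)"
      using has_bochner_integral_real_indicator[of "{min (\<tau> i) S<..min (\<tau> (Suc i)) S}" lborel] by simp
  qed
qed

section \<open>Localization and the martingale property of the Ito integral\<close>

text \<open>
  Clipping the time to \<open>[a,b]\<close> extends the process to the whole line, so that the parametrised integrals
  and Fubini's theorem apply on the full product space.
\<close>

lemma progressively_measurable_joint:
  assumes X: "progressively_measurable F a b X" and ab: "0 \<le> a" "a \<le> b" "b \<le> T"
  shows "(\<lambda>(s, \<omega>). X (max a (min b s)) \<omega>) \<in> borel_measurable (borel \<Otimes>\<^sub>M \<Omega>)"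
proof -
  have "(\<lambda>(s, \<omega>). X s \<omega>) \<in> borel_measurable (restrict_space borel {a..b} \<Otimes>\<^sub>M F b)"
    using X ab by (auto simp: progressively_measurable_def)
  moreover have "(\<lambda>(s, \<omega>). (max a (min b s), \<omega>)) \<in> borel \<Otimes>\<^sub>M \<Omega> \<rightarrow>\<^sub>M restrict_space borel {a..b} \<Otimes>\<^sub>M F b"
  proof -
    have 1: "(\<lambda>s. max a (min b s)) \<in> borel \<rightarrow>\<^sub>M restrict_space borel {a..b}"
      using ab by (intro measurable_restrict_space2) auto
    have 2: "(\<lambda>\<omega>. \<omega>) \<in> \<Omega> \<rightarrow>\<^sub>M F b"
      using subalgebra_F[of b] ab by (auto simp: measurable_def subalgebra_def sets.sets_into_space)
    show ?thesis using 1 2 unfolding case_prod_beta by measurable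
  qed
  ultimately have "(\<lambda>(s, \<omega>). X s \<omega>) \<circ> (\<lambda>(s, \<omega>). (max a (min b s), \<omega>)) \<in> borel_measurable (borel \<Otimes>\<^sub>M \<Omega>)"
    by (rule measurable_comp[rotated])
  then show ?thesis by (simp add: comp_def case_prod_beta)
qed

lemma progressively_measurable_section:
  assumes X: "progressively_measurable F a b X" and s: "s \<in> {a..b}" "0 \<le> a" "b \<le> T"
  shows "X s \<in> borel_measurable (F s)"
proof -
  have "(\<lambda>(s, \<omega>). X s \<omega>) \<in> borel_measurable (restrict_space borel {a..s} \<Otimes>\<^sub>M F s)"
    using X s by (auto simp: progressively_measurable_def)
  from measurable_Pair2[OF this, of s] show ?thesis using s by (simp add: space_restrict_space)
qed

lemma set_integral_measurable:
  fixes g :: "real \<Rightarrow> 'a \<Rightarrow> real"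
  assumes [measurable]: "(\<lambda>(s, \<omega>). g s \<omega>) \<in> borel_measurable (borel \<Otimes>\<^sub>M \<Omega>)"
  shows "(\<lambda>\<omega>. LINT s:{a..b}|lborel. g s \<omega>) \<in> borel_measurable \<Omega>"
  unfolding set_lebesgue_integral_def
proof (rule sigma_finite_measure.borel_measurable_lebesgue_integral)
  have "(\<lambda>(s, \<omega>). g s \<omega>) \<circ> (\<lambda>(\<omega>, s). (s, \<omega>)) \<in> borel_measurable (\<Omega> \<Otimes>\<^sub>M borel)"
    by (rule measurable_comp[of _ _ "borel \<Otimes>\<^sub>M \<Omega>"]) measurable
  then have "(\<lambda>(\<omega>, s). g s \<omega>) \<in> borel_measurable (\<Omega> \<Otimes>\<^sub>M borel)"
    by (simp add: comp_def case_prod_beta)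
  then have [measurable]: "(\<lambda>x. g (snd x) (fst x)) \<in> borel_measurable (\<Omega> \<Otimes>\<^sub>M lborel)"
    by (simp add: case_prod_beta cong: measurable_cong_sets)
  show "(\<lambda>(\<omega>, s). indicat_real {a..b} s *\<^sub>R g s \<omega>) \<in> borel_measurable (\<Omega> \<Otimes>\<^sub>M lborel)"
    unfolding case_prod_beta by measurable
qed (rule lborel.sigma_finite_measure_axioms)


text \<open>
  Let \<open>H\<close> be a simple integrand that approximates \<open>X\<close>. By definition its integrals approach those of \<open>X\<close>
  only in probability, without any control of moments. Truncating \<open>H\<close> at the level \<open>2 * R + 1\<close> supplies
  this control and changes nothing on the event \<open>A \<le> R\<close> as soon as \<open>\<integral>(H - X)\<^sup>2 \<le> 1/4\<close>: there
  \<open>\<integral>H\<^sup>2 \<le> 2 * A + 2 * \<integral>(H - X)\<^sup>2 \<le> 2 * R + 1/2\<close>. The loss of the factor \<open>2\<close> is harmless, because the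
  estimates below hold up to constants. One integrand serves both times \<open>s\<close> and \<open>S\<close>, as the martingale
  property requires.
\<close>

lemma ito_integral_truncated_approximation:
  assumes ito: "ito_integral \<Omega> F W a b X I" and ab: "0 \<le> a" "b \<le> T"
    and s: "s \<in> {a..S}" and S: "S \<le> b" and R: "0 \<le> R" and \<epsilon>: "0 < \<epsilon>"
  defines "A \<equiv> \<lambda>\<omega>. LINT r:{a..S}|lborel. (X r \<omega>)\<^sup>2"
  obtains N \<tau> \<xi> where "simple_integrand \<Omega> F a b N \<tau> \<xi>"
    "\<And>s'. s' \<in> {s,S} \<Longrightarrow> expectation (\<lambda>\<omega>. (simple_integral W N \<tau> \<xi> s' \<omega>)\<^sup>2)
        \<le> 2 * expectation (\<lambda>\<omega>. min (A \<omega>) R) + 2"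
    "\<And>s'. s' \<in> {s,S} \<Longrightarrow>
        prob {\<omega>\<in>space \<Omega>. A \<omega> \<le> R \<and> \<epsilon> < \<bar>simple_integral W N \<tau> \<xi> s' \<omega> - I s' \<omega>\<bar>} \<le> \<epsilon>"
proof -
  have prog: "progressively_measurable F a b X"
    and sq: "AE \<omega> in \<Omega>. set_integrable lborel {a..b} (\<lambda>s. (X s \<omega>)\<^sup>2)"
    and Im: "\<And>s. s \<in> {a..b} \<Longrightarrow> I s \<in> borel_measurable (F s)"
    using ito by (auto simp: ito_integral_def)
  obtain Nn \<tau>n \<xi>n where si: "\<And>n. simple_integrand \<Omega> F a b (Nn n) (\<tau>n n) (\<xi>n n)"
    and c1: "conv_in_prob \<Omega>
          (\<lambda>n \<omega>. LINT s:{a..b}|lborel. (simple_process (Nn n) (\<tau>n n) (\<xi>n n) s \<omega> - X s \<omega>)\<^sup>2) (\<lambda>\<omega>. 0)"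
    and c2: "\<And>s. s \<in> {a..b} \<Longrightarrow> conv_in_prob \<Omega> (\<lambda>n. simple_integral W (Nn n) (\<tau>n n) (\<xi>n n) s) (I s)"
    using ito unfolding ito_integral_def by blast
  have sS: "s \<in> {a..b}" "S \<in> {a..b}" "a \<le> b" using s S by auto
  define D where "D n \<omega> = (LINT s:{a..b}|lborel. (simple_process (Nn n) (\<tau>n n) (\<xi>n n) s \<omega> - X s \<omega>)\<^sup>2)" for n \<omega>
  define B where "B n s' = {\<omega>\<in>space \<Omega>. \<epsilon> < \<bar>simple_integral W (Nn n) (\<tau>n n) (\<xi>n n) s' \<omega> - I s' \<omega>\<bar>}" for n s'
  \<comment> \<open>The second bound keeps \<open>2 * R + 1\<close> times the probability of the exceptional event below \<open>1/2\<close>.\<close>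
  define \<delta> where "\<delta> = min (\<epsilon>/2) (1 / (2 * (2 * R + 1)))"
  have \<delta>: "0 < \<delta>" using \<epsilon> R by (simp add: \<delta>_def)
  have "(\<lambda>n. prob {\<omega>\<in>space \<Omega>. \<bar>D n \<omega> - 0\<bar> > 1/4}) \<longlonglongrightarrow> 0"
    using c1[unfolded conv_in_prob_def, rule_format, of "1/4"] unfolding D_def by simp
  then have e1: "eventually (\<lambda>n. prob {\<omega>\<in>space \<Omega>. \<bar>D n \<omega> - 0\<bar> > 1/4} < \<delta>) sequentially"
    using \<delta> by (rule order_tendstoD)
  have e2: "eventually (\<lambda>n. prob (B n s') < \<delta>) sequentially" if "s' \<in> {a..b}" for s'
    using c2[OF that, unfolded conv_in_prob_def, rule_format, OF \<epsilon>] \<delta> unfolding B_def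
    by (rule order_tendstoD)
  have "eventually (\<lambda>n. prob {\<omega>\<in>space \<Omega>. \<bar>D n \<omega> - 0\<bar> > 1/4} < \<delta> \<and> prob (B n s) < \<delta> \<and> prob (B n S) < \<delta>) sequentially"
    using e1 e2[OF sS(1)] e2[OF sS(2)] by eventually_elim simp
  then obtain n where n: "prob {\<omega>\<in>space \<Omega>. \<bar>D n \<omega> - 0\<bar> > 1/4} < \<delta>" "prob (B n s) < \<delta>" "prob (B n S) < \<delta>"
    by (auto simp: eventually_sequentially)
  define N \<tau> \<xi> where "N = Nn n" and "\<tau> = \<tau>n n" and "\<xi> = \<xi>n n"
  note si = si[of n, folded N_def \<tau>_def \<xi>_def]
  have mono: "\<And>i. i < N \<Longrightarrow> \<tau> i \<le> \<tau> (Suc i)" using si by (auto simp: simple_integrand_def)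
  define \<xi>' where "\<xi>' = truncate_integrand S (2 * R + 1) \<tau> \<xi>"
  have si': "simple_integrand \<Omega> F a b N \<tau> \<xi>'"
    unfolding \<xi>'_def by (rule truncate_simple_integrand[OF si ab])
  define Q where "Q \<omega> = (\<Sum>i<N. (\<xi> i \<omega>)\<^sup>2 * (min (\<tau> (Suc i)) S - min (\<tau> i) S))" for \<omega>
  have R1: "0 \<le> 2 * R + 1" using R by simp
  define X' where "X' s = X (max a (min b s))" for s
  have X'm[measurable]: "(\<lambda>(s, \<omega>). X' s \<omega>) \<in> borel_measurable (borel \<Otimes>\<^sub>M \<Omega>)"
    unfolding X'_def by (rule progressively_measurable_joint[OF prog ab(1) sS(3) ab(2)])
  have \<xi>m: "\<xi> i \<in> borel_measurable \<Omega>" if "i < N" for i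
  proof (rule measurable_F_imp)
    show "\<xi> i \<in> borel_measurable (F (\<tau> i))" using si that by (auto simp: simple_integrand_def)
    show "\<tau> i \<in> {0..T}" using simple_integrand_times[OF si, of i i] that ab by auto
  qed
  have H: "(\<lambda>(s, \<omega>). simple_process N \<tau> \<xi> s \<omega>) \<in> borel_measurable (borel \<Otimes>\<^sub>M \<Omega>)"
    unfolding simple_process_def case_prod_beta
  proof (intro borel_measurable_sum)
    fix i assume "i \<in> {..<N}"
    then have [measurable]: "\<xi> i \<in> borel_measurable \<Omega>" using \<xi>m by simp
    show "(\<lambda>x. \<xi> i (snd x) * indicator {\<tau> i<..\<tau> (Suc i)} (fst x)) \<in> borel_measurable (borel \<Otimes>\<^sub>M \<Omega>)"
      by measurable
  qed
  have HX: "(\<lambda>(s, \<omega>). (simple_process N \<tau> \<xi> s \<omega> - X' s \<omega>)\<^sup>2) \<in> borel_measurable (borel \<Otimes>\<^sub>M \<Omega>)"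
    using H X'm unfolding case_prod_beta by measurable
  have Deq: "D n \<omega> = (LINT s:{a..b}|lborel. (simple_process N \<tau> \<xi> s \<omega> - X' s \<omega>)\<^sup>2)" for \<omega>
    unfolding D_def N_def[symmetric] \<tau>_def[symmetric] \<xi>_def[symmetric]
    by (rule set_lebesgue_integral_cong) (auto simp: X'_def)
  have Dm[measurable]: "D n \<in> borel_measurable \<Omega>"
    unfolding Deq[abs_def] by (rule set_integral_measurable[OF HX])
  have D0: "0 \<le> D n \<omega>" for \<omega>
    unfolding D_def set_lebesgue_integral_def by (intro Bochner_Integration.integral_nonneg) auto
  have Aeq: "A \<omega> = (LINT s:{a..S}|lborel. (X' s \<omega>)\<^sup>2)" for \<omega>
    unfolding A_def by (rule set_lebesgue_integral_cong) (use S in \<open>auto simp: X'_def\<close>)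
  have Am[measurable]: "A \<in> borel_measurable \<Omega>"
  proof -
    have "(\<lambda>(s, \<omega>). (X' s \<omega>)\<^sup>2) \<in> borel_measurable (borel \<Otimes>\<^sub>M \<Omega>)"
      using X'm unfolding case_prod_beta by measurable
    then show ?thesis unfolding Aeq[abs_def] by (rule set_integral_measurable)
  qed
  have A0: "0 \<le> A \<omega>" for \<omega>
    unfolding A_def set_lebesgue_integral_def by (intro Bochner_Integration.integral_nonneg) auto
  have Qm[measurable]: "Q \<in> borel_measurable \<Omega>"
    unfolding Q_def[abs_def] using \<xi>m by (intro borel_measurable_sum borel_measurable_times borel_measurable_power) auto
  \<comment> \<open>\<open>Q\<close> is the integral of \<open>H\<^sup>2\<close> up to \<open>S\<close>, and \<open>D n\<close> that of \<open>(H - X)\<^sup>2\<close> up to \<open>b\<close>.\<close>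
  have QAD: "AE \<omega> in \<Omega>. Q \<omega> \<le> 2 * A \<omega> + 2 * D n \<omega>"
    using sq AE_space
  proof eventually_elim
    fix \<omega> assume sqX: "set_integrable lborel {a..b} (\<lambda>s. (X s \<omega>)\<^sup>2)" and sp: "\<omega> \<in> space \<Omega>"
    let ?h = "\<lambda>s. simple_process N \<tau> \<xi> s \<omega>" and ?x = "\<lambda>s. X' s \<omega>"
    have [measurable]: "?h \<in> borel_measurable borel" "?x \<in> borel_measurable borel"
      using measurable_Pair1[OF H sp] measurable_Pair1[OF X'm sp] by simp_all
    have "set_integrable lborel {a..b} (\<lambda>s. (?x s)\<^sup>2) = set_integrable lborel {a..b} (\<lambda>s. (X s \<omega>)\<^sup>2)"
      by (rule set_integrable_cong) (auto simp: X'_def)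
    then have ix: "integrable lborel (\<lambda>s. indicator {a..b} s * (?x s)\<^sup>2)"
      using sqX by (simp add: set_integrable_def)
    have ih: "integrable lborel (\<lambda>s. indicator {a..b} s * (?h s)\<^sup>2)"
      using simple_process_square_integral[OF si, of b \<omega>] sS by (simp add: has_bochner_integral_iff)
    have sqi: "(u - v)\<^sup>2 \<le> 2 * u\<^sup>2 + 2 * v\<^sup>2" "u\<^sup>2 \<le> 2 * v\<^sup>2 + 2 * (u - v)\<^sup>2" for u v :: real
      using sum_squares_ge_zero[of "u + v" 0] sum_squares_ge_zero[of "u - 2 * v" 0]
      by (simp_all add: power2_eq_square algebra_simps)
    have ihx: "integrable lborel (\<lambda>s. indicator {a..b} s * (?h s - ?x s)\<^sup>2)"
    proof (rule Bochner_Integration.integrable_bound)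
      show "integrable lborel (\<lambda>s. 2 * (indicator {a..b} s * (?h s)\<^sup>2) + 2 * (indicator {a..b} s * (?x s)\<^sup>2))"
        using ix ih by simp
      show "AE s in lborel. norm (indicator {a..b} s * (?h s - ?x s)\<^sup>2)
          \<le> norm (2 * (indicator {a..b} s * (?h s)\<^sup>2) + 2 * (indicator {a..b} s * (?x s)\<^sup>2))"
        using sqi(1) by (auto simp: indicator_def)
    qed measurable
    have sub: "integrable lborel (\<lambda>s. indicator {a..S} s * g s)"
      if "integrable lborel (\<lambda>s. indicator {a..b} s * g s)" for g :: "real \<Rightarrow> real"
    proof -
      have "integrable lborel (\<lambda>s. indicator {a..b} s * g s * indicator {a..S} s)"
        using that by (intro integrable_real_mult_indicator) auto
      moreover have "indicator {a..b} s * g s * indicator {a..S} s = indicator {a..S} s * g s" for s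
        using S by (auto simp: indicator_def)
      ultimately show ?thesis by simp
    qed
    have "Q \<omega> = (\<integral>s. indicator {a..S} s * (?h s)\<^sup>2 \<partial>lborel)"
      using simple_process_square_integral[OF si sS(2), of \<omega>] by (simp add: has_bochner_integral_iff Q_def)
    also have "\<dots> \<le> (\<integral>s. 2 * (indicator {a..S} s * (?x s)\<^sup>2) + 2 * (indicator {a..b} s * (?h s - ?x s)\<^sup>2) \<partial>lborel)"
    proof (rule integral_mono)
      show "indicator {a..S} s * (?h s)\<^sup>2 \<le> 2 * (indicator {a..S} s * (?x s)\<^sup>2) + 2 * (indicator {a..b} s * (?h s - ?x s)\<^sup>2)" for s
        using sqi(2)[of "?h s" "?x s"] S by (auto simp: indicator_def)
    qed (use sub[OF ih] sub[OF ix] ihx in auto)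
    also have "\<dots> = 2 * A \<omega> + 2 * D n \<omega>"
      using sub[OF ix] ihx by (simp add: Aeq Deq set_lebesgue_integral_def)
    finally show "Q \<omega> \<le> 2 * A \<omega> + 2 * D n \<omega>" .
  qed
  define SI SI' where "SI = simple_integral W N \<tau> \<xi>" and "SI' = simple_integral W N \<tau> \<xi>'"
  have SIeq: "SI' s' \<omega> = SI s' \<omega>" if "Q \<omega> \<le> 2 * R + 1" for s' \<omega>
    unfolding SI_def SI'_def simple_integral_def
  proof (rule sum.cong)
    fix i assume "i \<in> {..<N}"
    then have "\<xi>' i \<omega> = \<xi> i \<omega>"
      unfolding \<xi>'_def using that mono by (intro truncate_integrand_eq[of \<xi> \<omega> \<tau> S N]) (auto simp: Q_def)
    then show "\<xi>' i \<omega> * (W (min (\<tau> (Suc i)) s') \<omega> - W (min (\<tau> i) s') \<omega>) =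
       \<xi> i \<omega> * (W (min (\<tau> (Suc i)) s') \<omega> - W (min (\<tau> i) s') \<omega>)" by simp
  qed simp
  have minA_int: "integrable \<Omega> (\<lambda>\<omega>. min (A \<omega>) R)"
    by (rule integrable_const_bound[of _ R]) (use A0 R in \<open>auto simp: min_def\<close>)
  define BD where "BD = {\<omega>\<in>space \<Omega>. \<bar>D n \<omega> - 0\<bar> > 1/4}"
  note n = n[folded BD_def]
  have BDm: "BD \<in> events" unfolding BD_def by measurable
  have second: "expectation (\<lambda>\<omega>. (SI' s' \<omega>)\<^sup>2) \<le> 2 * expectation (\<lambda>\<omega>. min (A \<omega>) R) + 2"
    if s': "s' \<in> {a..S}" for s'
  proof -
    have s'b: "s' \<in> {a..b}" using s' S by auto
    let ?q = "\<lambda>\<omega>. \<Sum>i<N. (\<xi>' i \<omega>)\<^sup>2 * (min (\<tau> (Suc i)) s' - min (\<tau> i) s')"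
    note iso = simple_integral_isometry[OF si' ab s'b order_refl]
    have "expectation (\<lambda>\<omega>. (SI' s' \<omega>)\<^sup>2) = expectation ?q" using iso by (simp add: SI'_def)
    also have "\<dots> \<le> expectation (\<lambda>\<omega>. 2 * min (A \<omega>) R + 3/2 + (2 * R + 1) * indicator BD \<omega>)"
    proof (rule integral_mono_AE)
      show "integrable \<Omega> ?q" using iso by simp
      show "integrable \<Omega> (\<lambda>\<omega>. 2 * min (A \<omega>) R + 3/2 + (2 * R + 1) * indicator BD \<omega>)"
        using minA_int BDm by (auto intro!: integrable_real_mult_indicator)
      show "AE \<omega> in \<Omega>. ?q \<omega> \<le> 2 * min (A \<omega>) R + 3/2 + (2 * R + 1) * indicator BD \<omega>"
        using QAD AE_space
      proof eventually_elim
        fix \<omega> assume Q: "Q \<omega> \<le> 2 * A \<omega> + 2 * D n \<omega>" and sp: "\<omega> \<in> space \<Omega>"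
        have "?q \<omega> \<le> (\<Sum>i<N. (\<xi>' i \<omega>)\<^sup>2 * (min (\<tau> (Suc i)) S - min (\<tau> i) S))"
        proof (intro sum_mono mult_left_mono)
          fix i assume "i \<in> {..<N}"
          then show "min (\<tau> (Suc i)) s' - min (\<tau> i) s' \<le> min (\<tau> (Suc i)) S - min (\<tau> i) S"
            using mono[of i] s' by (auto simp: min_def)
        qed simp
        also have "\<dots> \<le> min (Q \<omega>) (2 * R + 1)"
          unfolding \<xi>'_def Q_def using R1 mono by (rule truncated_sum_le)
        also have "\<dots> \<le> 2 * min (A \<omega>) R + 3/2 + (2 * R + 1) * indicator BD \<omega>"
        proof (cases "D n \<omega> \<le> 1/4")
          case True
          then have "indicat_real BD \<omega> = 0" using D0[of \<omega>] by (auto simp: BD_def indicator_def)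
          then show ?thesis using Q True A0[of \<omega>] by (auto simp: min_def)
        next
          case False
          then have "indicat_real BD \<omega> = 1" using sp by (auto simp: BD_def indicator_def)
          then show ?thesis using A0[of \<omega>] R by (auto simp: min_def)
        qed
        finally show "?q \<omega> \<le> 2 * min (A \<omega>) R + 3/2 + (2 * R + 1) * indicator BD \<omega>" .
      qed
    qed
    also have "\<dots> = 2 * expectation (\<lambda>\<omega>. min (A \<omega>) R) + 3/2 + (2 * R + 1) * prob BD"
    proof -
      have "integrable \<Omega> (indicat_real BD)" using BDm by (simp add: less_top[symmetric])
      then show ?thesis using minA_int BDm by (simp add: prob_space)
    qed
    also have "(2 * R + 1) * prob BD \<le> (2 * R + 1) * (1 / (2 * (2 * R + 1)))"
      using n(1) R by (intro mult_left_mono) (auto simp: \<delta>_def)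
    also have "\<dots> = 1/2" using R by simp
    finally show ?thesis by simp
  qed
  have bad: "prob {\<omega>\<in>space \<Omega>. A \<omega> \<le> R \<and> \<epsilon> < \<bar>SI' s' \<omega> - I s' \<omega>\<bar>} \<le> \<epsilon>"
    if s': "s' \<in> {a..b}" and Bn: "prob (B n s') < \<delta>" for s'
  proof -
    have [measurable]: "I s' \<in> borel_measurable \<Omega>"
      using s' ab by (intro measurable_F_imp[OF Im]) auto
    have "SI s' \<in> borel_measurable (F (min (\<tau> N) s'))"
      unfolding SI_def by (rule simple_integral_measurable[OF si ab s' order_refl])
    then have [measurable]: "SI s' \<in> borel_measurable \<Omega>"
      using simple_integrand_times[OF si order_refl order_refl] s' ab by (intro measurable_F_imp[of "SI s'"]) auto
    have Bm: "B n s' \<in> events"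
      unfolding B_def SI_def[symmetric] N_def[symmetric] \<tau>_def[symmetric] \<xi>_def[symmetric] by measurable
    have "prob {\<omega>\<in>space \<Omega>. A \<omega> \<le> R \<and> \<epsilon> < \<bar>SI' s' \<omega> - I s' \<omega>\<bar>} \<le> prob (BD \<union> B n s')"
    proof (rule finite_measure_mono_AE)
      show "AE \<omega> in \<Omega>. \<omega> \<in> {\<omega>\<in>space \<Omega>. A \<omega> \<le> R \<and> \<epsilon> < \<bar>SI' s' \<omega> - I s' \<omega>\<bar>} \<longrightarrow> \<omega> \<in> BD \<union> B n s'"
        using QAD
      proof eventually_elim
        fix \<omega> assume Q: "Q \<omega> \<le> 2 * A \<omega> + 2 * D n \<omega>"
        have "SI' s' \<omega> = SI s' \<omega>" if "A \<omega> \<le> R" "D n \<omega> \<le> 1/4"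
          using Q that by (intro SIeq) simp
        then show "\<omega> \<in> {\<omega>\<in>space \<Omega>. A \<omega> \<le> R \<and> \<epsilon> < \<bar>SI' s' \<omega> - I s' \<omega>\<bar>} \<longrightarrow> \<omega> \<in> BD \<union> B n s'"
          by (cases "D n \<omega> \<le> 1/4") (auto simp: B_def BD_def SI_def N_def \<tau>_def \<xi>_def)
      qed
    qed (use BDm Bm in simp)
    also have "\<dots> \<le> prob BD + prob (B n s')" using BDm Bm by (rule measure_Un_le)
    also have "\<dots> \<le> \<epsilon>" using n(1) Bn by (simp add: \<delta>_def)
    finally show ?thesis .
  qed
  show thesis
  proof (rule that[OF si'])
    show "expectation (\<lambda>\<omega>. (simple_integral W N \<tau> \<xi>' s' \<omega>)\<^sup>2) \<le> 2 * expectation (\<lambda>\<omega>. min (A \<omega>) R) + 2"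
      if "s' \<in> {s,S}" for s' using second[of s'] that s by (auto simp: SI'_def)
    show "prob {\<omega>\<in>space \<Omega>. A \<omega> \<le> R \<and> \<epsilon> < \<bar>simple_integral W N \<tau> \<xi>' s' \<omega> - I s' \<omega>\<bar>} \<le> \<epsilon>"
      if "s' \<in> {s,S}" for s' using bad[of s'] that sS n by (auto simp: SI'_def)
  qed
qed

lemma ito_quadratic_measurable:
  assumes prog: "progressively_measurable F a b X" and ab: "0 \<le> a" "b \<le> T" and S: "S \<in> {a..b}"
  shows "(\<lambda>\<omega>. LINT r:{a..S}|lborel. (X r \<omega>)\<^sup>2) \<in> borel_measurable \<Omega>"
proof -
  have "(\<lambda>(s, \<omega>). X (max a (min b s)) \<omega>) \<in> borel_measurable (borel \<Otimes>\<^sub>M \<Omega>)"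
    using S by (intro progressively_measurable_joint[OF prog ab(1) _ ab(2)]) auto
  then have "(\<lambda>(s, \<omega>). (X (max a (min b s)) \<omega>)\<^sup>2) \<in> borel_measurable (borel \<Otimes>\<^sub>M \<Omega>)"
    unfolding case_prod_beta by measurable
  then have "(\<lambda>\<omega>. LINT r:{a..S}|lborel. (X (max a (min b r)) \<omega>)\<^sup>2) \<in> borel_measurable \<Omega>"
    by (rule set_integral_measurable)
  moreover have "(LINT r:{a..S}|lborel. (X (max a (min b r)) \<omega>)\<^sup>2) = (LINT r:{a..S}|lborel. (X r \<omega>)\<^sup>2)" for \<omega>
    by (rule set_lebesgue_integral_cong) (use S in auto)
  ultimately show ?thesis by simp
qed

lemma simple_integral_measurable_\<Omega>:
  assumes si: "simple_integrand \<Omega> F a b N \<tau> \<xi>" and ab: "0 \<le> a" "b \<le> T" and s: "s \<in> {a..b}"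
  shows "simple_integral W N \<tau> \<xi> s \<in> borel_measurable \<Omega>"
proof (rule measurable_F_imp[OF simple_integral_measurable[OF si ab s order_refl]])
  have "a \<le> \<tau> N" "\<tau> N \<le> b" using simple_integrand_times[OF si order_refl order_refl] by auto
  then show "min (\<tau> N) s \<in> {0..T}" using s ab by (simp add: min_def)
qed

text \<open>
  This replaces the isometry of the stopped integral. On the event \<open>A \<le> R\<close> the square of the integral is
  at most \<open>2 * J\<^sup>2 + 2\<close>, where \<open>J\<close> is the integral of a truncated simple integrand, except on an event of
  small probability, which is harmless after cutting the square at a level \<open>L\<close>; then \<open>L\<close> tends to
  infinity. The right-hand side is finite before any moment of the integral is known.
\<close>

lemma ito_localized_second_moment:
  assumes ito: "ito_integral \<Omega> F W a b X I" and ab: "0 \<le> a" "b \<le> T"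
    and s: "s \<in> {a..b}" and R: "0 \<le> R"
  defines "A \<equiv> \<lambda>\<omega>. LINT r:{a..s}|lborel. (X r \<omega>)\<^sup>2"
  shows "(\<integral>\<^sup>+\<omega>. indicator {\<omega>. A \<omega> \<le> R} \<omega> * ennreal ((I s \<omega>)\<^sup>2) \<partial>\<Omega>)
    \<le> ennreal (4 * expectation (\<lambda>\<omega>. min (A \<omega>) R) + 7)"
proof -
  have prog: "progressively_measurable F a b X" using ito by (simp add: ito_integral_def)
  have [measurable]: "A \<in> borel_measurable \<Omega>"
    unfolding A_def by (rule ito_quadratic_measurable[OF prog ab s])
  have "I s \<in> borel_measurable (F s)" using ito s by (auto simp: ito_integral_def)
  then have [measurable]: "I s \<in> borel_measurable \<Omega>" by (rule measurable_F_imp) (use s ab in auto)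
  have A0: "0 \<le> A \<omega>" for \<omega>
    unfolding A_def set_lebesgue_integral_def by (intro Bochner_Integration.integral_nonneg) auto
  let ?c = "4 * expectation (\<lambda>\<omega>. min (A \<omega>) R) + 7"
  define f where "f L \<omega> = ennreal (indicator {\<omega>. A \<omega> \<le> R} \<omega> * min ((I s \<omega>)\<^sup>2) (real L))" for L :: nat and \<omega>
  have bound: "(\<integral>\<^sup>+\<omega>. f L \<omega> \<partial>\<Omega>) \<le> ennreal ?c" for L
  proof -
    \<comment> \<open>On the exceptional event, of probability at most \<open>\<epsilon>\<close>, the integrand is at most \<open>L\<close>: this costs at most \<open>1\<close>.\<close>
    define \<epsilon> where "\<epsilon> = 1 / (real L + 1)"
    have \<epsilon>: "0 < \<epsilon>" "\<epsilon> \<le> 1" "real L * \<epsilon> \<le> 1" by (auto simp: \<epsilon>_def field_simps)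
    have ss: "s \<in> {a..s}" using s by auto
    have sb: "s \<le> b" using s by auto
    obtain N \<tau> \<xi> where si: "simple_integrand \<Omega> F a b N \<tau> \<xi>"
      and J2: "expectation (\<lambda>\<omega>. (simple_integral W N \<tau> \<xi> s \<omega>)\<^sup>2) \<le> 2 * expectation (\<lambda>\<omega>. min (A \<omega>) R) + 2"
      and bad: "prob {\<omega>\<in>space \<Omega>. A \<omega> \<le> R \<and> \<epsilon> < \<bar>simple_integral W N \<tau> \<xi> s \<omega> - I s \<omega>\<bar>} \<le> \<epsilon>"
      by (rule ito_integral_truncated_approximation[OF ito ab ss sb R \<epsilon>(1)]) (auto simp: A_def)
    let ?J = "simple_integral W N \<tau> \<xi> s"
    define B where "B = {\<omega>\<in>space \<Omega>. A \<omega> \<le> R \<and> \<epsilon> < \<bar>?J \<omega> - I s \<omega>\<bar>}"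
    have [measurable]: "?J \<in> borel_measurable \<Omega>" by (rule simple_integral_measurable_\<Omega>[OF si ab s])
    have Bm: "B \<in> events" unfolding B_def by measurable
    have iB: "integrable \<Omega> (indicat_real B)" using Bm by (simp add: less_top[symmetric])
    have iJ: "integrable \<Omega> (\<lambda>\<omega>. (?J \<omega>)\<^sup>2)" using simple_integral_isometry[OF si ab s order_refl] by simp
    have "(\<integral>\<^sup>+\<omega>. f L \<omega> \<partial>\<Omega>) \<le> (\<integral>\<^sup>+\<omega>. ennreal (2 * (?J \<omega>)\<^sup>2 + 2 + real L * indicator B \<omega>) \<partial>\<Omega>)"
    proof (rule nn_integral_mono)
      fix \<omega> assume sp: "\<omega> \<in> space \<Omega>"
      show "f L \<omega> \<le> ennreal (2 * (?J \<omega>)\<^sup>2 + 2 + real L * indicator B \<omega>)"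
        unfolding f_def
      proof (rule ennreal_leI)
        have nn: "0 \<le> (?J \<omega>)\<^sup>2" by simp
        consider "\<not> A \<omega> \<le> R" | "\<omega> \<in> B" | "A \<omega> \<le> R" "\<bar>?J \<omega> - I s \<omega>\<bar> \<le> \<epsilon>" "\<omega> \<notin> B"
          unfolding B_def using sp not_le by blast
        then show "indicator {\<omega>. A \<omega> \<le> R} \<omega> * min ((I s \<omega>)\<^sup>2) (real L)
            \<le> 2 * (?J \<omega>)\<^sup>2 + 2 + real L * indicator B \<omega>"
        proof cases
          case 1
          then show ?thesis using nn by simp
        next
          case 2
          have "indicator {\<omega>. A \<omega> \<le> R} \<omega> * min ((I s \<omega>)\<^sup>2) (real L) \<le> real L"
            by (simp add: indicator_def)
          moreover have "real L * indicat_real B \<omega> = real L" using 2 by simp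
          ultimately show ?thesis using nn by linarith
        next
          case 3
          have "\<bar>?J \<omega> - I s \<omega>\<bar>\<^sup>2 \<le> 1\<^sup>2" using 3 \<epsilon> by (intro power_mono) auto
          then have "(?J \<omega> - I s \<omega>)\<^sup>2 \<le> 1" by simp
          moreover have "(I s \<omega>)\<^sup>2 \<le> 2 * (?J \<omega>)\<^sup>2 + 2 * (?J \<omega> - I s \<omega>)\<^sup>2"
            using zero_le_power2[of "I s \<omega> - 2 * ?J \<omega>"] by (simp add: power2_eq_square algebra_simps)
          ultimately show ?thesis using 3 by simp
        qed
      qed
    qed
    also have "\<dots> = ennreal (expectation (\<lambda>\<omega>. 2 * (?J \<omega>)\<^sup>2 + 2 + real L * indicator B \<omega>))"
      using iJ iB by (intro nn_integral_eq_integral) auto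
    also have "expectation (\<lambda>\<omega>. 2 * (?J \<omega>)\<^sup>2 + 2 + real L * indicator B \<omega>) =
        2 * expectation (\<lambda>\<omega>. (?J \<omega>)\<^sup>2) + 2 + real L * prob B"
      using iJ iB Bm by (simp add: prob_space)
    also have "\<dots> \<le> ?c"
    proof -
      have "real L * prob B \<le> real L * \<epsilon>" using bad unfolding B_def by (intro mult_left_mono) auto
      then show ?thesis using J2 \<epsilon> by simp
    qed
    finally show ?thesis by (simp add: ennreal_leI)
  qed
  have "(\<integral>\<^sup>+\<omega>. indicator {\<omega>. A \<omega> \<le> R} \<omega> * ennreal ((I s \<omega>)\<^sup>2) \<partial>\<Omega>) \<le> (\<integral>\<^sup>+\<omega>. (SUP L. f L \<omega>) \<partial>\<Omega>)"
  proof (rule nn_integral_mono)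
    fix \<omega>
    obtain L :: nat where "(I s \<omega>)\<^sup>2 \<le> real L" using real_arch_simple by blast
    then have "indicator {\<omega>. A \<omega> \<le> R} \<omega> * ennreal ((I s \<omega>)\<^sup>2) = f L \<omega>"
      by (auto simp: f_def indicator_def)
    then show "indicator {\<omega>. A \<omega> \<le> R} \<omega> * ennreal ((I s \<omega>)\<^sup>2) \<le> (SUP L. f L \<omega>)"
      by (auto intro: SUP_upper)
  qed
  also have "\<dots> = (SUP L. \<integral>\<^sup>+\<omega>. f L \<omega> \<partial>\<Omega>)"
  proof (rule nn_integral_monotone_convergence_SUP)
    show "incseq f" unfolding incseq_def le_fun_def f_def
      by (auto intro!: ennreal_leI mult_left_mono min.mono)
  qed (simp add: f_def)
  also have "\<dots> \<le> ennreal ?c" using bound by (intro SUP_least)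
  finally show ?thesis .
qed

text \<open>
  Convergence in probability and bounded second moments give convergence in mean, by
  \<open>x \<le> \<epsilon> + \<delta> * x\<^sup>2 + 1 / \<delta>\<close>, in which the last term is needed only if \<open>x > \<epsilon>\<close>. The constants are chosen in
  the order \<open>\<delta>\<close>, \<open>R\<close>, \<open>\<epsilon>\<close>: the second-moment bound \<open>C\<close> is independent of \<open>R\<close>, the event \<open>Q > R\<close> is rare by
  Markov's inequality, and the remaining exceptional event has probability at most \<open>\<epsilon>\<close>.
\<close>

lemma ito_integral_L1_approximation:
  assumes ito: "ito_integral \<Omega> F W a b X I" and ab: "0 \<le> a" "b \<le> T" and s: "s \<in> {a..b}"
    and A: "integrable \<Omega> (\<lambda>\<omega>. LINT r:{a..b}|lborel. (X r \<omega>)\<^sup>2)"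
    and I2: "integrable \<Omega> (\<lambda>\<omega>. (I s \<omega>)\<^sup>2)" "integrable \<Omega> (\<lambda>\<omega>. (I b \<omega>)\<^sup>2)" and \<eta>: "0 < \<eta>"
  obtains N \<tau> \<xi> where "simple_integrand \<Omega> F a b N \<tau> \<xi>"
    "\<And>s'. s' \<in> {s,b} \<Longrightarrow> expectation (\<lambda>\<omega>. \<bar>simple_integral W N \<tau> \<xi> s' \<omega> - I s' \<omega>\<bar>) \<le> \<eta>"
    "\<And>s'. s' \<in> {s,b} \<Longrightarrow> integrable \<Omega> (\<lambda>\<omega>. simple_integral W N \<tau> \<xi> s' \<omega> - I s' \<omega>)"
proof -
  define Q where "Q \<omega> = (LINT r:{a..b}|lborel. (X r \<omega>)\<^sup>2)" for \<omega>
  have Q0: "0 \<le> Q \<omega>" for \<omega>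
    unfolding Q_def set_lebesgue_integral_def by (intro Bochner_Integration.integral_nonneg) auto
  have Qi: "integrable \<Omega> Q" using A by (simp add: Q_def[abs_def])
  then have [measurable]: "Q \<in> borel_measurable \<Omega>" by simp
  define \<alpha> where "\<alpha> = expectation Q"
  have \<alpha>0: "0 \<le> \<alpha>" unfolding \<alpha>_def using Q0 by (intro Bochner_Integration.integral_nonneg) auto
  define C where "C = 4 * \<alpha> + 4 + 2 * expectation (\<lambda>\<omega>. (I s \<omega>)\<^sup>2) + 2 * expectation (\<lambda>\<omega>. (I b \<omega>)\<^sup>2)"
  have I0: "0 \<le> expectation (\<lambda>\<omega>. (I s \<omega>)\<^sup>2)" "0 \<le> expectation (\<lambda>\<omega>. (I b \<omega>)\<^sup>2)" by simp_all
  have C: "0 < C" unfolding C_def using \<alpha>0 I0 by linarith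
  define \<delta> where "\<delta> = \<eta> / (3 * C)"
  have \<delta>: "0 < \<delta>" using \<eta> C by (simp add: \<delta>_def)
  define R where "R = 6 * (\<alpha> + 1) / (\<delta> * \<eta>)"
  have R: "0 < R" using \<alpha>0 \<delta> \<eta> by (simp add: R_def)
  define \<epsilon> where "\<epsilon> = min (\<eta> / 6) (\<eta> * \<delta> / 6)"
  have \<epsilon>: "0 < \<epsilon>" "\<epsilon> \<le> \<eta> / 6" "\<epsilon> \<le> \<eta> * \<delta> / 6" using \<eta> \<delta> by (auto simp: \<epsilon>_def)
  obtain N \<tau> \<xi> where si: "simple_integrand \<Omega> F a b N \<tau> \<xi>"
    and J2: "\<And>s'. s' \<in> {s,b} \<Longrightarrow> expectation (\<lambda>\<omega>. (simple_integral W N \<tau> \<xi> s' \<omega>)\<^sup>2)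
        \<le> 2 * expectation (\<lambda>\<omega>. min (Q \<omega>) R) + 2"
    and bad: "\<And>s'. s' \<in> {s,b} \<Longrightarrow>
        prob {\<omega>\<in>space \<Omega>. Q \<omega> \<le> R \<and> \<epsilon> < \<bar>simple_integral W N \<tau> \<xi> s' \<omega> - I s' \<omega>\<bar>} \<le> \<epsilon>"
  proof (rule ito_integral_truncated_approximation[OF ito ab s order_refl less_imp_le[OF R] \<epsilon>(1)], goal_cases)
    case (1 N \<tau> \<xi>)
    show ?case by (rule 1(1)[OF 1(2)]) (use 1(3,4) in \<open>simp_all only: Q_def\<close>)
  qed
  have minQ: "expectation (\<lambda>\<omega>. min (Q \<omega>) R) \<le> \<alpha>"
    unfolding \<alpha>_def
  proof (rule integral_mono)
    show "integrable \<Omega> (\<lambda>\<omega>. min (Q \<omega>) R)"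
      by (rule integrable_const_bound[of _ R]) (use Q0 R in \<open>auto simp: min_def\<close>)
  qed (use Qi in auto)
  have main: "expectation (\<lambda>\<omega>. \<bar>simple_integral W N \<tau> \<xi> s' \<omega> - I s' \<omega>\<bar>) \<le> \<eta> \<and>
      integrable \<Omega> (\<lambda>\<omega>. simple_integral W N \<tau> \<xi> s' \<omega> - I s' \<omega>)" if s': "s' \<in> {s,b}" for s'
  proof -
    have s'b: "s' \<in> {a..b}" using s s' by auto
    let ?J = "simple_integral W N \<tau> \<xi> s'"
    have "I s' \<in> borel_measurable (F s')" using ito s'b by (auto simp: ito_integral_def)
    then have [measurable]: "I s' \<in> borel_measurable \<Omega>" by (rule measurable_F_imp) (use s'b ab in auto)
    have [measurable]: "?J \<in> borel_measurable \<Omega>" by (rule simple_integral_measurable_\<Omega>[OF si ab s'b])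
    have iJ: "integrable \<Omega> (\<lambda>\<omega>. (?J \<omega>)\<^sup>2)" using simple_integral_isometry[OF si ab s'b order_refl] by simp
    have iI: "integrable \<Omega> (\<lambda>\<omega>. (I s' \<omega>)\<^sup>2)" using I2 s' by auto
    have int1: "integrable \<Omega> (\<lambda>\<omega>. ?J \<omega> - I s' \<omega>)"
      using square_integrable_imp_integrable[OF _ iJ] square_integrable_imp_integrable[OF _ iI] by simp
    define B where "B = {\<omega>\<in>space \<Omega>. Q \<omega> \<le> R \<and> \<epsilon> < \<bar>?J \<omega> - I s' \<omega>\<bar>}"
    have Bm: "B \<in> events" unfolding B_def by measurable
    have iB: "integrable \<Omega> (indicat_real B)" using Bm by (simp add: less_top[symmetric])
    have "expectation (\<lambda>\<omega>. \<bar>?J \<omega> - I s' \<omega>\<bar>) \<le>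
        expectation (\<lambda>\<omega>. \<epsilon> + \<delta> * (2 * (?J \<omega>)\<^sup>2 + 2 * (I s' \<omega>)\<^sup>2) + (indicator B \<omega> + Q \<omega> / R) / \<delta>)"
    proof (rule integral_mono)
      fix \<omega> assume sp: "\<omega> \<in> space \<Omega>"
      define x where "x = \<bar>?J \<omega> - I s' \<omega>\<bar>"
      have x2: "\<delta> * x\<^sup>2 \<le> \<delta> * (2 * (?J \<omega>)\<^sup>2 + 2 * (I s' \<omega>)\<^sup>2)"
        using \<delta> zero_le_power2[of "?J \<omega> + I s' \<omega>"]
        by (intro mult_left_mono) (auto simp: x_def power2_eq_square algebra_simps)
      have xq: "x \<le> \<delta> * x\<^sup>2 + 1 / \<delta>"
      proof -
        have "0 \<le> (\<delta> * x - 1/2)\<^sup>2 + 3/4" by simp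
        also have "\<dots> = \<delta> * (\<delta> * x\<^sup>2 + 1 / \<delta> - x)" using \<delta> by (simp add: power2_eq_square field_simps)
        finally show ?thesis using \<delta> by (simp add: zero_le_mult_iff)
      qed
      show "\<bar>?J \<omega> - I s' \<omega>\<bar> \<le> \<epsilon> + \<delta> * (2 * (?J \<omega>)\<^sup>2 + 2 * (I s' \<omega>)\<^sup>2) + (indicator B \<omega> + Q \<omega> / R) / \<delta>"
      proof (cases "x \<le> \<epsilon>")
        case True
        have "0 \<le> (indicator B \<omega> + Q \<omega> / R) / \<delta>" using Q0[of \<omega>] R \<delta> by (auto intro!: divide_nonneg_nonneg add_nonneg_nonneg)
        moreover have "0 \<le> \<delta> * x\<^sup>2" using \<delta> by simp
        ultimately show ?thesis using True x2 unfolding x_def[symmetric] by linarith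
      next
        case False
        have "1 \<le> indicator B \<omega> + Q \<omega> / R"
        proof (cases "Q \<omega> \<le> R")
          case True
          then have "\<omega> \<in> B" using False sp by (auto simp: B_def x_def)
          then show ?thesis using Q0[of \<omega>] R by simp
        next
          case False
          then have "1 \<le> Q \<omega> / R" using R by simp
          then show ?thesis by (simp add: add_increasing)
        qed
        then have "1 / \<delta> \<le> (indicator B \<omega> + Q \<omega> / R) / \<delta>" using \<delta> by (intro divide_right_mono) auto
        then show ?thesis using xq x2 \<epsilon>(1) unfolding x_def[symmetric] by linarith
      qed
    qed (use int1 iJ iI iB Qi in auto)
    also have "\<dots> = \<epsilon> + \<delta> * (2 * expectation (\<lambda>\<omega>. (?J \<omega>)\<^sup>2) + 2 * expectation (\<lambda>\<omega>. (I s' \<omega>)\<^sup>2)) + (prob B + \<alpha> / R) / \<delta>"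
      using iJ iI iB Qi Bm by (simp add: prob_space \<alpha>_def)
    also have "\<dots> \<le> \<eta> / 6 + \<eta> / 3 + (\<eta> / 6 + \<eta> / 6)"
    proof (intro add_mono)
      have "2 * expectation (\<lambda>\<omega>. (?J \<omega>)\<^sup>2) + 2 * expectation (\<lambda>\<omega>. (I s' \<omega>)\<^sup>2) \<le> C"
      proof -
        have "expectation (\<lambda>\<omega>. (I s' \<omega>)\<^sup>2) \<le> expectation (\<lambda>\<omega>. (I s \<omega>)\<^sup>2) + expectation (\<lambda>\<omega>. (I b \<omega>)\<^sup>2)"
          using s' I0 by auto
        then show ?thesis using J2[OF s'] minQ unfolding C_def by linarith
      qed
      then have "\<delta> * (2 * expectation (\<lambda>\<omega>. (?J \<omega>)\<^sup>2) + 2 * expectation (\<lambda>\<omega>. (I s' \<omega>)\<^sup>2)) \<le> \<delta> * C"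
        using \<delta> by (intro mult_left_mono) auto
      then show "\<delta> * (2 * expectation (\<lambda>\<omega>. (?J \<omega>)\<^sup>2) + 2 * expectation (\<lambda>\<omega>. (I s' \<omega>)\<^sup>2)) \<le> \<eta> / 3"
        using C by (simp add: \<delta>_def)
      have "prob B \<le> \<eta> * \<delta> / 6" using bad[OF s'] \<epsilon>(3) by (simp add: B_def)
      moreover have "\<alpha> / R \<le> \<eta> * \<delta> / 6"
      proof -
        have "\<alpha> \<le> \<eta> * \<delta> / 6 * R" using \<delta> \<eta> by (simp add: R_def)
        then show ?thesis using R by (simp add: pos_divide_le_eq)
      qed
      moreover have "\<eta> * \<delta> / 6 + \<eta> * \<delta> / 6 = (\<eta> / 6 + \<eta> / 6) * \<delta>" by (simp add: algebra_simps)
      ultimately have "prob B + \<alpha> / R \<le> (\<eta> / 6 + \<eta> / 6) * \<delta>" by linarith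
      then show "(prob B + \<alpha> / R) / \<delta> \<le> \<eta> / 6 + \<eta> / 6" using \<delta> by (simp add: pos_divide_le_eq)
    qed (rule \<epsilon>(2))
    finally have "expectation (\<lambda>\<omega>. \<bar>?J \<omega> - I s' \<omega>\<bar>) \<le> \<eta>" using \<eta> by simp
    then show ?thesis using int1 by simp
  qed
  show thesis by (rule that[OF si]) (use main in auto)
qed

text \<open>
  The identity holds for the integrals of simple integrands and survives convergence in mean at the two
  times \<open>s\<close> and \<open>b\<close>, because \<open>v\<close> is bounded.
\<close>

lemma ito_integral_martingale:
  assumes ito: "ito_integral \<Omega> F W a b X I" and ab: "0 \<le> a" "b \<le> T" and s: "s \<in> {a..b}"
    and A: "integrable \<Omega> (\<lambda>\<omega>. LINT r:{a..b}|lborel. (X r \<omega>)\<^sup>2)"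
    and I2: "integrable \<Omega> (\<lambda>\<omega>. (I s \<omega>)\<^sup>2)" "integrable \<Omega> (\<lambda>\<omega>. (I b \<omega>)\<^sup>2)"
    and v: "v \<in> borel_measurable (F s)" "\<And>\<omega>. \<omega> \<in> space \<Omega> \<Longrightarrow> \<bar>v \<omega>\<bar> \<le> B"
  shows "expectation (\<lambda>\<omega>. v \<omega> * I s \<omega>) = expectation (\<lambda>\<omega>. v \<omega> * I b \<omega>)"
proof -
  have vm[measurable]: "v \<in> borel_measurable \<Omega>" using v(1) by (rule measurable_F_imp) (use s ab in auto)
  have vb: "bounded (v ` space \<Omega>)" using v(2) by (auto simp: bounded_iff)
  have Ii: "integrable \<Omega> (I s')" if "s' \<in> {s,b}" for s'
  proof (rule square_integrable_imp_integrable)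
    have "s' \<in> {a..b}" using that s by auto
    then have "I s' \<in> borel_measurable (F s')" using ito by (auto simp: ito_integral_def)
    then show "I s' \<in> borel_measurable \<Omega>" by (rule measurable_F_imp) (use that s ab in auto)
  qed (use that I2 in auto)
  have vI: "integrable \<Omega> (\<lambda>\<omega>. v \<omega> * I s' \<omega>)" if "s' \<in> {s,b}" for s'
    by (rule bounded_measurable_integrable_mult[OF vm vb Ii[OF that]])
  define E where "E = \<bar>expectation (\<lambda>\<omega>. v \<omega> * I s \<omega>) - expectation (\<lambda>\<omega>. v \<omega> * I b \<omega>)\<bar>"
  have "E \<le> 2 * \<bar>B\<bar> * \<eta>" if \<eta>: "0 < \<eta>" for \<eta>
  proof -
    obtain N \<tau> \<xi> where si: "simple_integrand \<Omega> F a b N \<tau> \<xi>"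
      and J1: "\<And>s'. s' \<in> {s,b} \<Longrightarrow> expectation (\<lambda>\<omega>. \<bar>simple_integral W N \<tau> \<xi> s' \<omega> - I s' \<omega>\<bar>) \<le> \<eta>"
      and Ji: "\<And>s'. s' \<in> {s,b} \<Longrightarrow> integrable \<Omega> (\<lambda>\<omega>. simple_integral W N \<tau> \<xi> s' \<omega> - I s' \<omega>)"
      using ito_integral_L1_approximation[OF ito ab s A I2 \<eta>] by metis
    let ?J = "simple_integral W N \<tau> \<xi>"
    have d: "integrable \<Omega> (\<lambda>\<omega>. v \<omega> * (?J s' \<omega> - I s' \<omega>)) \<and>
        \<bar>expectation (\<lambda>\<omega>. v \<omega> * (?J s' \<omega> - I s' \<omega>))\<bar> \<le> \<bar>B\<bar> * \<eta>" if s': "s' \<in> {s,b}" for s'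
    proof
      show i: "integrable \<Omega> (\<lambda>\<omega>. v \<omega> * (?J s' \<omega> - I s' \<omega>))"
        by (rule bounded_measurable_integrable_mult[OF vm vb Ji[OF s']])
      have "\<bar>expectation (\<lambda>\<omega>. v \<omega> * (?J s' \<omega> - I s' \<omega>))\<bar> \<le> expectation (\<lambda>\<omega>. \<bar>v \<omega> * (?J s' \<omega> - I s' \<omega>)\<bar>)"
        by (rule integral_abs_bound)
      also have "\<dots> \<le> expectation (\<lambda>\<omega>. \<bar>B\<bar> * \<bar>?J s' \<omega> - I s' \<omega>\<bar>)"
      proof (rule integral_mono)
        fix \<omega> assume "\<omega> \<in> space \<Omega>"
        then have "\<bar>v \<omega>\<bar> \<le> \<bar>B\<bar>" using v(2)[of \<omega>] by linarith
        then show "\<bar>v \<omega> * (?J s' \<omega> - I s' \<omega>)\<bar> \<le> \<bar>B\<bar> * \<bar>?J s' \<omega> - I s' \<omega>\<bar>"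
          by (simp add: abs_mult mult_right_mono)
      qed (use i Ji[OF s'] in auto)
      also have "\<dots> \<le> \<bar>B\<bar> * \<eta>" using J1[OF s'] by (simp add: mult_left_mono)
      finally show "\<bar>expectation (\<lambda>\<omega>. v \<omega> * (?J s' \<omega> - I s' \<omega>))\<bar> \<le> \<bar>B\<bar> * \<eta>" .
    qed
    have mart: "integrable \<Omega> (\<lambda>\<omega>. v \<omega> * (?J b \<omega> - ?J s \<omega>))"
      "expectation (\<lambda>\<omega>. v \<omega> * (?J b \<omega> - ?J s \<omega>)) = 0"
      using simple_integral_martingale[OF si ab s v(1) vb order_refl] by auto
    have "expectation (\<lambda>\<omega>. v \<omega> * I s \<omega>) - expectation (\<lambda>\<omega>. v \<omega> * I b \<omega>) =
        expectation (\<lambda>\<omega>. v \<omega> * I s \<omega> - v \<omega> * I b \<omega>)"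
      using vI by simp
    also have "\<dots> = expectation (\<lambda>\<omega>. v \<omega> * (?J b \<omega> - I b \<omega>) - v \<omega> * (?J s \<omega> - I s \<omega>) - v \<omega> * (?J b \<omega> - ?J s \<omega>))"
      by (rule Bochner_Integration.integral_cong) (auto simp: algebra_simps)
    also have "\<dots> = expectation (\<lambda>\<omega>. v \<omega> * (?J b \<omega> - I b \<omega>)) - expectation (\<lambda>\<omega>. v \<omega> * (?J s \<omega> - I s \<omega>)) - 0"
      using d[of b] d[of s] mart by (simp del: right_diff_distrib)
    finally show ?thesis using d[of b] d[of s] unfolding E_def by auto
  qed
  have "E \<le> 0"
  proof (rule field_le_epsilon)
    fix e :: real assume e: "0 < e"
    have "E \<le> 2 * \<bar>B\<bar> * (e / (2 * \<bar>B\<bar> + 1))" using e by (intro \<open>\<And>\<eta>. 0 < \<eta> \<Longrightarrow> E \<le> 2 * \<bar>B\<bar> * \<eta>\<close>) auto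
    also have "\<dots> \<le> e" using e by (simp add: field_simps)
    finally show "E \<le> 0 + e" by simp
  qed
  then show ?thesis by (simp add: E_def)
qed

end

section \<open>Gronwall estimates\<close>

lemma bounded_set_integrable:
  fixes u :: "real \<Rightarrow> real"
  assumes "u \<in> borel_measurable borel" "\<And>r. r \<in> {a..b} \<Longrightarrow> \<bar>u r\<bar> \<le> D"
  shows "set_integrable lborel {a..b} u"
  unfolding set_integrable_def
proof (rule Bochner_Integration.integrable_bound)
  have "integrable lborel (indicat_real {a..b})"
    by (intro integrable_real_indicator) (auto simp: emeasure_lborel_Icc_eq)
  then show "integrable lborel (\<lambda>r. D * indicator {a..b} r)" by simp
  show "(\<lambda>r. indicator {a..b} r *\<^sub>R u r) \<in> borel_measurable lborel" using assms(1) by measurable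
  show "AE r in lborel. norm (indicator {a..b} r *\<^sub>R u r) \<le> norm (D * indicator {a..b} r)"
    using assms(2) by (force simp: indicator_def intro: order_trans[OF _ abs_ge_self])
qed

lemma linear_growth_square:
  fixes g x k :: real
  assumes "\<bar>g\<bar> \<le> k * (1 + \<bar>x\<bar>)"
  shows "g\<^sup>2 \<le> 2 * k\<^sup>2 * (1 + x\<^sup>2)"
proof -
  have "\<bar>g\<bar>\<^sup>2 \<le> (k * (1 + \<bar>x\<bar>))\<^sup>2" using assms by (intro power_mono) auto
  also have "\<dots> = k\<^sup>2 * (1 + \<bar>x\<bar>)\<^sup>2" by (simp add: power_mult_distrib)
  also have "\<dots> \<le> k\<^sup>2 * (2 * (1 + x\<^sup>2))"
    using zero_le_power2[of "1 - \<bar>x\<bar>"] by (intro mult_left_mono) (auto simp: power2_eq_square algebra_simps)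
  finally show ?thesis by (simp add: algebra_simps)
qed

lemma nn_integral_exp_interval:
  assumes "0 < \<beta>" "a \<le> s"
  shows "(\<integral>\<^sup>+r. ennreal (exp (\<beta> * (r - a))) * indicator {a..s} r \<partial>lborel) = ennreal ((exp (\<beta> * (s - a)) - 1) / \<beta>)"
proof -
  have "(\<integral>\<^sup>+r. ennreal (exp (\<beta> * (r - a))) * indicator {a..s} r \<partial>lborel) =
      ennreal (exp (\<beta> * (s - a)) / \<beta> - exp (\<beta> * (a - a)) / \<beta>)"
    using assms
    by (intro nn_integral_FTC_Icc) (auto intro!: derivative_eq_intros)
  then show ?thesis by (simp add: diff_divide_distrib)
qed

text \<open>
  Let \<open>S\<close> be the supremum of \<open>h\<close> against the weight \<open>exp (- 2 * C * (s - a))\<close>. The weight halves the integral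
  term, so that \<open>S \<le> c + S / 2\<close>; the bound \<open>B\<close> makes \<open>S\<close> finite and thus gives \<open>S \<le> 2 * c\<close>, in which \<open>B\<close>
  no longer appears.
\<close>

lemma gronwall_nn:
  fixes h :: "real \<Rightarrow> ennreal"
  assumes C: "0 < C" and bdd: "B < \<infinity>" "\<And>s. s \<in> {a..b} \<Longrightarrow> h s \<le> B"
    and ineq: "\<And>s. s \<in> {a..b} \<Longrightarrow> h s \<le> c + ennreal C * (\<integral>\<^sup>+r. h r * indicator {a..s} r \<partial>lborel)"
    and s: "s \<in> {a..b}"
  shows "h s \<le> 2 * c * ennreal (exp (2 * C * (s - a)))"
proof -
  define w where "w s = ennreal (exp (2 * C * (s - a)))" for s
  define S where "S = (SUP s\<in>{a..b}. h s * ennreal (exp (- 2 * C * (s - a))))"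
  have ww: "w s * ennreal (exp (- 2 * C * (s - a))) = 1" for s
    unfolding w_def by (simp add: ennreal_mult[symmetric] exp_minus)
  have hS: "h s \<le> S * w s" if "s \<in> {a..b}" for s
  proof -
    have "h s = (h s * ennreal (exp (- 2 * C * (s - a)))) * w s"
    proof -
      have "h s = h s * (w s * ennreal (exp (- 2 * C * (s - a))))" unfolding ww by simp
      then show ?thesis by (simp only: ac_simps)
    qed
    also have "\<dots> \<le> S * w s" unfolding S_def using that by (intro mult_right_mono SUP_upper) auto
    finally show ?thesis .
  qed
  have "S \<le> B"
    unfolding S_def
  proof (rule SUP_least)
    fix s assume s: "s \<in> {a..b}"
    have "h s * ennreal (exp (- 2 * C * (s - a))) \<le> h s * ennreal 1"
      using s C by (intro mult_left_mono ennreal_leI) auto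
    then show "h s * ennreal (exp (- 2 * C * (s - a))) \<le> B" using bdd(2)[OF s] by simp
  qed
  then have Sfin: "S < \<infinity>" using bdd(1) by simp
  have "S \<le> c + ennreal (1/2) * S"
    unfolding S_def
  proof (rule SUP_least)
    fix s assume s: "s \<in> {a..b}"
    have "h s \<le> c + ennreal C * (\<integral>\<^sup>+r. h r * indicator {a..s} r \<partial>lborel)" by (rule ineq[OF s])
    also have "\<dots> \<le> c + ennreal C * (\<integral>\<^sup>+r. S * (w r * indicator {a..s} r) \<partial>lborel)"
    proof (intro add_left_mono mult_left_mono nn_integral_mono)
      show "h r * indicator {a..s} r \<le> S * (w r * indicator {a..s} r)" for r
        using hS[of r] s by (auto simp: indicator_def)
    qed simp
    also have "(\<integral>\<^sup>+r. S * (w r * indicator {a..s} r) \<partial>lborel) = S * (\<integral>\<^sup>+r. w r * indicator {a..s} r \<partial>lborel)"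
      by (rule nn_integral_cmult) (simp add: w_def)
    also have "(\<integral>\<^sup>+r. w r * indicator {a..s} r \<partial>lborel) = ennreal ((exp (2 * C * (s - a)) - 1) / (2 * C))"
      unfolding w_def using nn_integral_exp_interval[of "2 * C" a s] C s by simp
    also have "c + ennreal C * (S * \<dots>) \<le> c + ennreal (1/2) * S * w s"
    proof (rule add_left_mono)
      define z where "z = (exp (2 * C * (s - a)) - 1) / (2 * C)"
      have z: "0 \<le> z" "C * z \<le> 1/2 * exp (2 * C * (s - a))" using C s by (auto simp: z_def field_simps)
      have "ennreal C * (S * ennreal z) = S * ennreal (C * z)"
        using C z(1) by (simp add: ennreal_mult mult.left_commute)
      also have "\<dots> \<le> S * ennreal (1/2 * exp (2 * C * (s - a)))"
        using z(2) by (intro mult_left_mono ennreal_leI) auto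
      also have "\<dots> = S * (ennreal (1/2) * w s)" unfolding w_def by (subst ennreal_mult) auto
      also have "\<dots> = ennreal (1/2) * S * w s" by (simp only: ac_simps)
      finally show "ennreal C * (S * ennreal ((exp (2 * C * (s - a)) - 1) / (2 * C))) \<le> ennreal (1/2) * S * w s"
        unfolding z_def .
    qed
    finally have "h s * ennreal (exp (- 2 * C * (s - a))) \<le> (c + ennreal (1/2) * S * w s) * ennreal (exp (- 2 * C * (s - a)))"
      by (rule mult_right_mono) simp
    also have "\<dots> = c * ennreal (exp (- 2 * C * (s - a))) + ennreal (1/2) * S * (w s * ennreal (exp (- 2 * C * (s - a))))"
      by (simp only: distrib_right mult.assoc)
    also have "\<dots> \<le> c * ennreal 1 + ennreal (1/2) * S * 1"
      unfolding ww using s C by (intro add_mono mult_left_mono ennreal_leI order_refl) auto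
    finally show "h s * ennreal (exp (- 2 * C * (s - a))) \<le> c + ennreal (1/2) * (SUP s\<in>{a..b}. h s * ennreal (exp (- 2 * C * (s - a))))"
      unfolding S_def by simp
  qed
  have "S \<le> 2 * c"
  proof (cases "c = \<infinity>")
    case True
    then show ?thesis by (simp add: ennreal_mult_top)
  next
    case False
    then obtain c' where c': "c = ennreal c'" "0 \<le> c'" by (cases c) auto
    obtain S' where S': "S = ennreal S'" "0 \<le> S'" using Sfin by (cases S) auto
    have "ennreal S' \<le> ennreal (c' + 1/2 * S')"
      using \<open>S \<le> c + ennreal (1/2) * S\<close> c' S' by (simp only: ennreal_mult ennreal_plus)
    then have "S' \<le> 2 * c'" using c' S' by (subst (asm) ennreal_le_iff) auto
    then have "ennreal S' \<le> ennreal (2 * c')" by (rule ennreal_leI)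
    then show ?thesis using c' S' by (simp add: ennreal_mult)
  qed
  have "h s \<le> S * w s" by (rule hS[OF s])
  also have "\<dots> \<le> 2 * c * w s" using \<open>S \<le> 2 * c\<close> by (rule mult_right_mono) simp
  finally show ?thesis unfolding w_def .
qed

text \<open>
  The variance of \<open>u\<close> over the interval is nonnegative.
\<close>

lemma set_integral_power2_le:
  fixes u :: "real \<Rightarrow> real"
  assumes ab: "a \<le> b" and u: "set_integrable lborel {a..b} u" and u2: "set_integrable lborel {a..b} (\<lambda>r. (u r)\<^sup>2)"
  shows "(LINT r:{a..b}|lborel. u r)\<^sup>2 \<le> (b - a) * (LINT r:{a..b}|lborel. (u r)\<^sup>2)"
proof (cases "a = b")
  case True
  have "(LINT r:{a..b}|lborel. v r) = 0" for v :: "real \<Rightarrow> real"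
    unfolding set_lebesgue_integral_def True
  proof (rule integral_eq_zero_AE)
    show "AE r in lborel. indicator {b..b} r *\<^sub>R v r = 0"
      using AE_lborel_singleton[of b] by eventually_elim simp
  qed
  then show ?thesis by simp
next
  case False
  then have l: "0 < b - a" using ab by simp
  define m where "m = (LINT r:{a..b}|lborel. u r) / (b - a)"
  have c: "set_integrable lborel {a..b} (\<lambda>r. m\<^sup>2)"
    by (rule bounded_set_integrable[of _ _ _ "\<bar>m\<^sup>2\<bar>"]) auto
  have "0 \<le> (LINT r:{a..b}|lborel. (u r - m)\<^sup>2)"
    unfolding set_lebesgue_integral_def by (intro Bochner_Integration.integral_nonneg) auto
  also have "\<dots> = (LINT r:{a..b}|lborel. (u r)\<^sup>2 - 2 * m * u r + m\<^sup>2)"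
    by (rule set_lebesgue_integral_cong) (auto simp: power2_eq_square algebra_simps)
  also have "\<dots> = (LINT r:{a..b}|lborel. (u r)\<^sup>2) - 2 * m * (LINT r:{a..b}|lborel. u r) + m\<^sup>2 * (b - a)"
    using u u2 c ab by (simp add: set_integral_add set_integral_diff set_integral_mult_right set_lebesgue_integral_def[of _ _ "\<lambda>_. m\<^sup>2"])
  also have "\<dots> = (LINT r:{a..b}|lborel. (u r)\<^sup>2) - (LINT r:{a..b}|lborel. u r)\<^sup>2 / (b - a)"
  proof -
    have "- 2 * (i / l) * i + (i / l)\<^sup>2 * l = - (i\<^sup>2 / l)" if "0 < l" for i l :: real
      using that by (simp add: power2_eq_square field_simps)
    from this[OF l, of "LINT r:{a..b}|lborel. u r"] show ?thesis by (simp add: m_def)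
  qed
  finally show ?thesis using l by (simp add: pos_divide_le_eq mult.commute)
qed

text \<open>
  The increasing continuous function \<open>A\<close> takes the value \<open>min (A s) R\<close> at some time \<open>r0\<close>, and up to \<open>r0\<close> the
  indicator equals \<open>1\<close>.
\<close>

lemma min_integral_le_stopped_integral:
  fixes \<phi> :: "real \<Rightarrow> real"
  assumes \<phi>: "set_integrable lborel {t..s} \<phi>" "\<And>r. 0 \<le> \<phi> r" and ts: "t \<le> s" and R: "0 \<le> R"
  defines "A \<equiv> \<lambda>r. LINT q:{t..r}|lborel. \<phi> q"
  shows "ennreal (min (A s) R) \<le> (\<integral>\<^sup>+r. indicator {r. A r \<le> R} r * ennreal (\<phi> r) * indicator {t..s} r \<partial>lborel)"
proof -
  have int: "set_integrable lborel {t..r} \<phi>" if "r \<le> s" for r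
    using \<phi>(1) by (rule set_integrable_subset) (use that in auto)
  have Ann: "ennreal (A r) = (\<integral>\<^sup>+q. ennreal (\<phi> q) * indicator {t..r} q \<partial>lborel)" if "r \<le> s" for r
  proof -
    have "(\<integral>\<^sup>+q. ennreal (\<phi> q) * indicator {t..r} q \<partial>lborel) = (\<integral>\<^sup>+q. ennreal (indicator {t..r} q *\<^sub>R \<phi> q) \<partial>lborel)"
      by (intro nn_integral_cong) (auto simp: indicator_def)
    also have "\<dots> = ennreal (A r)" unfolding A_def set_lebesgue_integral_def
      using int[OF that] \<phi>(2) by (intro nn_integral_eq_integral) (auto simp: set_integrable_def)
    finally show ?thesis by simp
  qed
  have mono: "A r \<le> A r'" if "r \<le> r'" "r' \<le> s" for r r'
    unfolding A_def set_lebesgue_integral_def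
  proof (rule integral_mono)
    show "indicator {t..r} x *\<^sub>R \<phi> x \<le> indicator {t..r'} x *\<^sub>R \<phi> x" for x
      using that \<phi>(2)[of x] by (auto simp: indicator_def)
  qed (use int that in \<open>auto simp: set_integrable_def\<close>)
  have cont: "continuous_on {t..s} A"
  proof -
    have "A r = integral {t..r} \<phi>" if "r \<in> {t..s}" for r
      unfolding A_def using set_borel_integral_eq_integral(2)[OF int] that by auto
    moreover have "continuous_on {t..s} (\<lambda>r. integral {t..r} \<phi>)"
      using set_borel_integral_eq_integral(1)[OF \<phi>(1)] by (rule indefinite_integral_continuous_1)
    ultimately show ?thesis by (metis (no_types, lifting) continuous_on_cong)
  qed
  have At: "A t = 0"
    unfolding A_def set_lebesgue_integral_def
  proof (rule integral_eq_zero_AE)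
    show "AE r in lborel. indicator {t..t} r *\<^sub>R \<phi> r = 0"
      using AE_lborel_singleton[of t] by eventually_elim simp
  qed
  obtain r0 where r0: "r0 \<in> {t..s}" "min (A s) R = A r0"
  proof (cases "A s \<le> R")
    case True
    then show ?thesis using that[of s] ts by auto
  next
    case False
    then obtain r0 where "t \<le> r0" "r0 \<le> s" "A r0 = R"
      using IVT'[of A t R s] At R ts cont by auto
    then show ?thesis using that[of r0] False by auto
  qed
  have "ennreal (min (A s) R) = (\<integral>\<^sup>+q. ennreal (\<phi> q) * indicator {t..r0} q \<partial>lborel)"
    using Ann[of r0] r0 by simp
  also have "\<dots> \<le> (\<integral>\<^sup>+r. indicator {r. A r \<le> R} r * ennreal (\<phi> r) * indicator {t..s} r \<partial>lborel)"
  proof (rule nn_integral_mono)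
    fix q
    have "A q \<le> R" if "q \<le> r0" using mono[OF that] r0 by auto
    then show "ennreal (\<phi> q) * indicator {t..r0} q \<le> indicator {r. A r \<le> R} q * ennreal (\<phi> q) * indicator {t..s} q"
      using r0 by (auto simp: indicator_def)
  qed
  finally show ?thesis .
qed

text \<open>
  The Gronwall factor $e^{2CL}$ for $C = 6k^2L + 1$.
\<close>

definition growth_factor :: "real \<Rightarrow> real \<Rightarrow> real" where
  "growth_factor k L = exp (2 * (6 * k\<^sup>2 * L + 1) * L)"

text \<open>
  The constant of the pathwise bound below. It depends on the growth constant, the starting point and the
  length of the time interval only, so that the bound can be integrated over all paths.
\<close>

definition growth_const :: "real \<Rightarrow> real \<Rightarrow> real \<Rightarrow> real" where
  "growth_const k p L = (let a = 3 * p\<^sup>2 + 6 * k\<^sup>2 * L\<^sup>2; C = 6 * k\<^sup>2 * L + 1 in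
     a + C * (2 * (a * L) * growth_factor k L) + 3 + C * (6 * growth_factor k L))"

lemma growth_const_nonneg: "0 \<le> L \<Longrightarrow> 0 \<le> growth_const k p L"
  by (simp add: growth_const_def growth_factor_def Let_def)

text \<open>
  The path \<open>x = p + \<integral>g + y\<close> with \<open>\<bar>g\<bar> \<le> k * (1 + \<bar>x\<bar>)\<close> is controlled by \<open>y\<close>: the Cauchy-Schwarz inequality
  turns the identity into \<open>x\<^sup>2 \<le> a + 3 * y\<^sup>2 + C * \<integral>x\<^sup>2\<close>, and Gronwall's inequality for the running integral
  \<open>G\<close> of \<open>x\<^sup>2\<close> removes the last term. The bound \<open>B\<close> on the path only makes \<open>G\<close> finite.
\<close>

lemma pathwise_square_bound:
  fixes x g y :: "real \<Rightarrow> real" and k p t T B s0 :: real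
  assumes k: "0 \<le> k" and tT: "t \<le> T"
    and xm[measurable]: "x \<in> borel_measurable borel" and gm[measurable]: "g \<in> borel_measurable borel"
    and ym[measurable]: "y \<in> borel_measurable borel"
    and xB: "\<And>r. r \<in> {t..T} \<Longrightarrow> \<bar>x r\<bar> \<le> B" and g: "\<And>r. r \<in> {t..T} \<Longrightarrow> \<bar>g r\<bar> \<le> k * (1 + \<bar>x r\<bar>)"
    and y: "\<And>s. s \<in> {t..T} \<Longrightarrow> y s = x s - p - (LINT r:{t..s}|lborel. g r)" and s0: "s0 \<in> {t..T}"
  shows "ennreal ((x s0)\<^sup>2) \<le> ennreal (growth_const k p (T - t)) *
    (1 + ennreal ((y s0)\<^sup>2) + (\<integral>\<^sup>+r. ennreal ((y r)\<^sup>2) * indicator {t..s0} r \<partial>lborel))"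
proof -
  define L where "L = T - t"
  define a where "a = 3 * p\<^sup>2 + 6 * k\<^sup>2 * L\<^sup>2"
  define C where "C = 6 * k\<^sup>2 * L + 1"
  define E where "E = exp (2 * C * L)"
  have L: "0 \<le> L" using tT by (simp add: L_def)
  have a: "0 \<le> a" and C: "0 < C" and E: "0 \<le> E" using L by (auto simp: a_def C_def E_def intro!: add_nonneg_pos)
  have c_def: "growth_const k p L = a + C * (2 * (a * L) * E) + 3 + C * (6 * E)"
    by (simp add: growth_const_def growth_factor_def Let_def a_def C_def E_def)
  have bint: "set_integrable lborel {t..s} u" if "u \<in> borel_measurable borel" "s \<le> T"
      "\<And>r. r \<in> {t..T} \<Longrightarrow> \<bar>u r\<bar> \<le> D" for u :: "real \<Rightarrow> real" and D s
    using that by (intro bounded_set_integrable[of u t s D]) auto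
  have gB: "\<bar>g r\<bar> \<le> k * (1 + B)" if "r \<in> {t..T}" for r
    using g[OF that] xB[OF that] k by (meson add_left_mono mult_left_mono order_trans)
  have g2: "(g r)\<^sup>2 \<le> 2 * k\<^sup>2 * (1 + (x r)\<^sup>2)" if "r \<in> {t..T}" for r
    by (rule linear_growth_square[OF g[OF that]])
  have x2B: "\<bar>(x r)\<^sup>2\<bar> \<le> B\<^sup>2" if "r \<in> {t..T}" for r
    using power_mono[OF xB[OF that], of 2] by simp
  have ix2: "set_integrable lborel {t..s} (\<lambda>r. (x r)\<^sup>2)" if "s \<le> T" for s
    by (rule bint[OF _ that x2B]) auto
  have ig: "set_integrable lborel {t..s} g" if "s \<le> T" for s
    by (rule bint[OF _ that gB]) auto
  have ig2: "set_integrable lborel {t..s} (\<lambda>r. (g r)\<^sup>2)" if "s \<le> T" for s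
  proof (rule bint[OF _ that])
    show "\<bar>(g r)\<^sup>2\<bar> \<le> (k * (1 + B))\<^sup>2" if "r \<in> {t..T}" for r
      using power_mono[OF gB[OF that], of 2] by simp
  qed auto
  define G H where "G s = (\<integral>\<^sup>+r. ennreal ((x r)\<^sup>2) * indicator {t..s} r \<partial>lborel)"
    and "H s = (\<integral>\<^sup>+r. ennreal ((y r)\<^sup>2) * indicator {t..s} r \<partial>lborel)" for s
  have Geq: "G s = ennreal (LINT r:{t..s}|lborel. (x r)\<^sup>2)" if "s \<le> T" for s
  proof -
    have "G s = (\<integral>\<^sup>+r. ennreal (indicator {t..s} r *\<^sub>R (x r)\<^sup>2) \<partial>lborel)"
      unfolding G_def by (intro nn_integral_cong) (auto simp: indicator_def)
    then show ?thesis unfolding set_lebesgue_integral_def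
      using ix2[OF that] by (subst (asm) nn_integral_eq_integral) (auto simp: set_integrable_def)
  qed
  have len: "(\<integral>\<^sup>+r. ennreal d * indicator {t..s} r \<partial>lborel) \<le> ennreal (d * L)" if "s \<in> {t..T}" "0 \<le> d" for d s
  proof -
    have "(\<integral>\<^sup>+r. ennreal d * indicator {t..s} r \<partial>lborel) = ennreal (d * (s - t))"
      using that by (subst nn_integral_cmult_indicator) (auto simp: ennreal_mult)
    also have "\<dots> \<le> ennreal (d * L)" using that by (intro ennreal_leI mult_left_mono) (auto simp: L_def)
    finally show ?thesis .
  qed
  have step: "ennreal ((x s)\<^sup>2) \<le> ennreal a + 3 * ennreal ((y s)\<^sup>2) + ennreal C * G s" if s: "s \<in> {t..T}" for s
  proof -
    have ts: "t \<le> s" "s \<le> T" using s by auto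
    let ?g = "LINT r:{t..s}|lborel. g r" and ?x2 = "LINT r:{t..s}|lborel. (x r)\<^sup>2"
    have "?g\<^sup>2 \<le> (s - t) * (LINT r:{t..s}|lborel. (g r)\<^sup>2)"
      by (rule set_integral_power2_le[OF ts(1) ig[OF ts(2)] ig2[OF ts(2)]])
    also have "\<dots> \<le> L * (LINT r:{t..s}|lborel. 2 * k\<^sup>2 * (1 + (x r)\<^sup>2))"
    proof (rule mult_mono)
      show "(LINT r:{t..s}|lborel. (g r)\<^sup>2) \<le> (LINT r:{t..s}|lborel. 2 * k\<^sup>2 * (1 + (x r)\<^sup>2))"
      proof (rule set_integral_mono[OF ig2[OF ts(2)]])
        show "set_integrable lborel {t..s} (\<lambda>r. 2 * k\<^sup>2 * (1 + (x r)\<^sup>2))"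
          by (rule bint[OF _ ts(2), of _ "2 * k\<^sup>2 * (1 + B\<^sup>2)"])
             (use x2B in \<open>auto simp: abs_mult intro!: mult_left_mono\<close>)
      qed (use g2 ts in auto)
      show "0 \<le> (LINT r:{t..s}|lborel. (g r)\<^sup>2)"
        unfolding set_lebesgue_integral_def by (intro Bochner_Integration.integral_nonneg) auto
    qed (use s L in \<open>auto simp: L_def\<close>)
    also have "(LINT r:{t..s}|lborel. 2 * k\<^sup>2 * (1 + (x r)\<^sup>2)) = 2 * k\<^sup>2 * ((s - t) + ?x2)"
    proof -
      have "set_integrable lborel {t..s} (\<lambda>r. 1::real)" by (rule bint[OF _ ts(2), of _ 1]) auto
      moreover have "(LINT r:{t..s}|lborel. (1::real)) = s - t"
        using ts by (simp add: set_lebesgue_integral_def)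
      ultimately show ?thesis using ix2[OF ts(2)] by (simp add: set_integral_add)
    qed
    also have "L * (2 * k\<^sup>2 * ((s - t) + ?x2)) \<le> L * (2 * k\<^sup>2 * (L + ?x2))"
      using L s by (intro mult_left_mono) (auto simp: L_def)
    finally have gi: "?g\<^sup>2 \<le> L * (2 * k\<^sup>2 * (L + ?x2))" .
    have "(x s)\<^sup>2 = (p + y s + ?g)\<^sup>2" using y[OF s] by simp
    also have "\<dots> \<le> 3 * p\<^sup>2 + 3 * (y s)\<^sup>2 + 3 * ?g\<^sup>2"
      using sum_squares_ge_zero[of "p - y s" "y s - ?g"] zero_le_power2[of "p - ?g"]
      by (simp add: power2_eq_square algebra_simps)
    also have "\<dots> \<le> a + 3 * (y s)\<^sup>2 + C * ?x2"
    proof -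
      have "0 \<le> ?x2" unfolding set_lebesgue_integral_def by (intro Bochner_Integration.integral_nonneg) auto
      then show ?thesis using gi by (simp add: a_def C_def power2_eq_square algebra_simps)
    qed
    finally have "ennreal ((x s)\<^sup>2) \<le> ennreal (a + 3 * (y s)\<^sup>2 + C * ?x2)" by (rule ennreal_leI)
    moreover have "0 \<le> ?x2" unfolding set_lebesgue_integral_def by (intro Bochner_Integration.integral_nonneg) auto
    ultimately show ?thesis unfolding Geq[OF ts(2)] using a C by (simp add: ennreal_mult ennreal_plus)
  qed
  have Gm[measurable]: "G \<in> borel_measurable borel"
  proof -
    have "(\<lambda>(s, r). ennreal ((x r)\<^sup>2) * indicator {t..s} r) = (\<lambda>(s, r). if t \<le> r \<and> r \<le> s then ennreal ((x r)\<^sup>2) else 0)"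
      by (auto simp: indicator_def)
    then have "(\<lambda>(s, r). ennreal ((x r)\<^sup>2) * indicator {t..s} r) \<in> borel_measurable (borel \<Otimes>\<^sub>M lborel)"
      by simp
    then show ?thesis unfolding G_def[abs_def] by (rule lborel.borel_measurable_nn_integral)
  qed
  have G: "G s0 \<le> 2 * (ennreal (a * L) + 3 * H s0) * ennreal (exp (2 * C * (s0 - t)))"
  proof (rule gronwall_nn[OF C, of "ennreal (B\<^sup>2 * L)" t s0 G])
    show "s0 \<in> {t..s0}" using s0 by simp
    fix s assume "s \<in> {t..s0}"
    then have s: "s \<in> {t..T}" "s \<le> s0" using s0 by auto
    have "G s \<le> (\<integral>\<^sup>+r. ennreal (B\<^sup>2) * indicator {t..s} r \<partial>lborel)"
      unfolding G_def
    proof (rule nn_integral_mono)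
      show "ennreal ((x r)\<^sup>2) * indicator {t..s} r \<le> ennreal (B\<^sup>2) * indicator {t..s} r" for r
        using x2B[of r] s(1) by (auto simp: indicator_def intro!: ennreal_leI)
    qed
    also have "\<dots> \<le> ennreal (B\<^sup>2 * L)" by (rule len[OF s(1)]) simp
    finally show "G s \<le> ennreal (B\<^sup>2 * L)" .
    have "G s \<le> (\<integral>\<^sup>+r. ennreal a * indicator {t..s} r + 3 * (ennreal ((y r)\<^sup>2) * indicator {t..s} r) + ennreal C * (G r * indicator {t..s} r) \<partial>lborel)"
      unfolding G_def[of s]
    proof (rule nn_integral_mono)
      show "ennreal ((x r)\<^sup>2) * indicator {t..s} r \<le>
         ennreal a * indicator {t..s} r + 3 * (ennreal ((y r)\<^sup>2) * indicator {t..s} r) + ennreal C * (G r * indicator {t..s} r)" for r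
        using step[of r] s(1) by (auto simp: indicator_def)
    qed
    also have "\<dots> = (\<integral>\<^sup>+r. ennreal a * indicator {t..s} r \<partial>lborel) + 3 * H s
        + ennreal C * (\<integral>\<^sup>+r. G r * indicator {t..s} r \<partial>lborel)"
      unfolding H_def by (simp add: nn_integral_add nn_integral_cmult)
    also have "\<dots> \<le> ennreal (a * L) + 3 * H s0 + ennreal C * (\<integral>\<^sup>+r. G r * indicator {t..s} r \<partial>lborel)"
    proof (intro add_mono mult_left_mono order_refl)
      show "H s \<le> H s0" unfolding H_def using s(2) by (intro nn_integral_mono) (auto simp: indicator_def)
    qed (use len[OF s(1) a] in auto)
    finally show "G s \<le> ennreal (a * L) + 3 * H s0 + ennreal C * (\<integral>\<^sup>+r. G r * indicator {t..s} r \<partial>lborel)" .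
  qed simp
  also have "\<dots> \<le> 2 * (ennreal (a * L) + 3 * H s0) * ennreal E"
    unfolding E_def using s0 C by (intro mult_left_mono ennreal_leI) (auto simp: L_def)
  finally have G': "ennreal C * G s0 \<le> ennreal C * (2 * (ennreal (a * L) + 3 * H s0) * ennreal E)"
    by (rule mult_left_mono) simp
  let ?Y = "ennreal ((y s0)\<^sup>2)"
  have "ennreal ((x s0)\<^sup>2) \<le> ennreal a + 3 * ?Y + ennreal C * (2 * (ennreal (a * L) + 3 * H s0) * ennreal E)"
    using step[OF s0] G' by (meson add_left_mono order_trans)
  also have "\<dots> = (ennreal a + ennreal C * (2 * ennreal (a * L) * ennreal E)) + 3 * ?Y + (ennreal C * (6 * ennreal E)) * H s0"
    by (simp add: algebra_simps)
  also have "\<dots> = ennreal (a + C * (2 * (a * L) * E)) + ennreal 3 * ?Y + ennreal (C * (6 * E)) * H s0"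
    using a C E L by (simp add: ennreal_mult ennreal_plus)
  also have "\<dots> \<le> ennreal (growth_const k p L) * 1 + ennreal (growth_const k p L) * ?Y + ennreal (growth_const k p L) * H s0"
    unfolding c_def using a C E L by (intro add_mono mult_right_mono) (auto intro!: ennreal_leI)
  finally show ?thesis unfolding H_def L_def by (simp add: distrib_left)
qed

section \<open>Second moments of the price process\<close>

locale sde_solution = filtered_brownian \<Omega> F W T
  for \<Omega> :: "'a measure" and F :: "real \<Rightarrow> 'a measure" and W :: "real \<Rightarrow> 'a \<Rightarrow> real" and T :: real +
  fixes f \<sigma> :: "real \<Rightarrow> real \<Rightarrow> real" and k t p :: real and X :: "real \<Rightarrow> 'a \<Rightarrow> real"
  assumes t: "0 \<le> t" "t \<le> T" and k: "0 \<le> k"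
    and f_cont: "continuous_on ({0..T} \<times> UNIV) (\<lambda>(s, p). f s p)"
    and \<sigma>_cont: "continuous_on ({0..T} \<times> UNIV) (\<lambda>(s, p). \<sigma> s p)"
    and f_growth: "\<And>s x. s \<in> {0..T} \<Longrightarrow> \<bar>f s x\<bar> \<le> k * (1 + \<bar>x\<bar>)"
    and \<sigma>_growth: "\<And>s x. s \<in> {0..T} \<Longrightarrow> \<bar>\<sigma> s x\<bar> \<le> k * (1 + \<bar>x\<bar>)"
    and sol: "strong_solution \<Omega> F W f \<sigma> T t p X"
begin

definition clip :: "real \<Rightarrow> real" where "clip s = max t (min T s)"

text \<open>
  Time is clipped to \<open>[t,T]\<close> in this and the following processes, so that they are jointly measurable on
  the whole line.
\<close>

definition price :: "real \<Rightarrow> 'a \<Rightarrow> real" where "price s = X (clip s)"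

definition drift :: "real \<Rightarrow> 'a \<Rightarrow> real" where "drift s \<omega> = f (clip s) (price s \<omega>)"

definition vol :: "real \<Rightarrow> 'a \<Rightarrow> real" where "vol s \<omega> = \<sigma> (clip s) (price s \<omega>)"

text \<open>
  A jointly measurable version of the stochastic integral in the equation: the price minus its start and
  its accumulated drift.
\<close>

definition noise :: "real \<Rightarrow> 'a \<Rightarrow> real" where
  "noise s \<omega> = price s \<omega> - p - (LINT r:{t..s}|lborel. drift r \<omega>)"

definition quad_var :: "real \<Rightarrow> 'a \<Rightarrow> real" where
  "quad_var s \<omega> = (LINT r:{t..s}|lborel. (vol r \<omega>)\<^sup>2)"

lemma clip_in: "clip s \<in> {0..T}" "clip s \<in> {t..T}" using t by (auto simp: clip_def)

lemma clip_eq: "s \<in> {t..T} \<Longrightarrow> clip s = s" by (auto simp: clip_def)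

lemma progressive_X: "progressively_measurable F t T X" using sol by (simp add: strong_solution_def)

lemma price_joint [measurable]: "(\<lambda>x. price (fst x) (snd x)) \<in> borel_measurable (borel \<Otimes>\<^sub>M \<Omega>)"
  using progressively_measurable_joint[OF progressive_X t order_refl]
  unfolding price_def clip_def case_prod_beta .

lemma coefficient_joint:
  assumes "continuous_on ({0..T} \<times> UNIV) (\<lambda>(s, p). c s p :: real)"
  shows "(\<lambda>x. c (clip (fst x)) (price (fst x) (snd x))) \<in> borel_measurable (borel \<Otimes>\<^sub>M \<Omega>)"
proof -
  have "continuous_on UNIV (\<lambda>z. (\<lambda>(s, p). c s p) (clip (fst z), snd z))"
  proof (rule continuous_on_compose2[OF assms])
    show "continuous_on UNIV (\<lambda>z. (clip (fst z), snd z))"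
      unfolding clip_def by (intro continuous_intros)
    show "(\<lambda>z. (clip (fst z), snd z)) ` UNIV \<subseteq> {0..T} \<times> UNIV" using clip_in(1) by auto
  qed
  then have "(\<lambda>z. c (clip (fst z)) (snd z)) \<in> borel_measurable (borel :: (real \<times> real) measure)"
    by (intro borel_measurable_continuous_onI) simp
  then have [measurable]: "(\<lambda>z. c (clip (fst z)) (snd z)) \<in> borel_measurable (borel \<Otimes>\<^sub>M borel :: (real \<times> real) measure)"
    by (simp add: borel_prod)
  have "(\<lambda>z. c (clip (fst z)) (snd z)) \<circ> (\<lambda>x. (fst x, price (fst x) (snd x))) \<in> borel_measurable (borel \<Otimes>\<^sub>M \<Omega>)"
    by (rule measurable_comp[of _ _ "borel \<Otimes>\<^sub>M borel"]) measurable
  then show ?thesis by (simp add: comp_def)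
qed

lemma drift_joint [measurable]: "(\<lambda>x. drift (fst x) (snd x)) \<in> borel_measurable (borel \<Otimes>\<^sub>M \<Omega>)"
  unfolding drift_def by (rule coefficient_joint[OF f_cont])

lemma vol_joint [measurable]: "(\<lambda>x. vol (fst x) (snd x)) \<in> borel_measurable (borel \<Otimes>\<^sub>M \<Omega>)"
  unfolding vol_def by (rule coefficient_joint[OF \<sigma>_cont])

lemma running_integral_joint:
  fixes g :: "real \<Rightarrow> 'a \<Rightarrow> real"
  assumes g: "(\<lambda>x. g (fst x) (snd x)) \<in> borel_measurable (borel \<Otimes>\<^sub>M \<Omega>)"
  shows "(\<lambda>x. LINT r:{t..fst x}|lborel. g r (snd x)) \<in> borel_measurable (borel \<Otimes>\<^sub>M \<Omega>)"
  unfolding set_lebesgue_integral_def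
proof (rule lborel.borel_measurable_lebesgue_integral)
  have "(\<lambda>x. g (fst x) (snd x)) \<circ> (\<lambda>y. (snd y, snd (fst y))) \<in> borel_measurable ((borel \<Otimes>\<^sub>M \<Omega>) \<Otimes>\<^sub>M lborel)"
    by (rule measurable_comp[OF _ g]) measurable
  then have [measurable]: "(\<lambda>y. g (snd y) (snd (fst y))) \<in> borel_measurable ((borel \<Otimes>\<^sub>M \<Omega>) \<Otimes>\<^sub>M lborel)"
    by (simp add: comp_def)
  have "(\<lambda>(x, r). indicat_real {t..fst x} r *\<^sub>R g r (snd x)) =
      (\<lambda>y. if t \<le> snd y \<and> snd y \<le> fst (fst y) then g (snd y) (snd (fst y)) else 0)"
    by (auto simp: indicator_def)
  then show "(\<lambda>(x, r). indicat_real {t..fst x} r *\<^sub>R g r (snd x)) \<in> borel_measurable ((borel \<Otimes>\<^sub>M \<Omega>) \<Otimes>\<^sub>M lborel)"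
    by simp
qed

lemma noise_joint [measurable]: "(\<lambda>x. noise (fst x) (snd x)) \<in> borel_measurable (borel \<Otimes>\<^sub>M \<Omega>)"
  unfolding noise_def using running_integral_joint[OF drift_joint] by measurable

lemma quad_var_joint [measurable]: "(\<lambda>x. quad_var (fst x) (snd x)) \<in> borel_measurable (borel \<Otimes>\<^sub>M \<Omega>)"
  unfolding quad_var_def by (rule running_integral_joint) measurable

lemma joint_section:
  assumes "(\<lambda>x. g (fst x) (snd x)) \<in> borel_measurable (borel \<Otimes>\<^sub>M \<Omega>)"
  shows "g s \<in> borel_measurable \<Omega>" "\<omega> \<in> space \<Omega> \<Longrightarrow> (\<lambda>s. g s \<omega>) \<in> borel_measurable borel"
  using measurable_Pair2[OF assms, of s] measurable_Pair1[OF assms, of \<omega>] by auto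

lemmas price_section [measurable] = joint_section(1)[of price, OF price_joint]
lemmas noise_section [measurable] = joint_section(1)[of noise, OF noise_joint]
lemmas quad_var_section [measurable] = joint_section(1)[of quad_var, OF quad_var_joint]
lemmas drift_section [measurable] = joint_section(1)[of drift, OF drift_joint]
lemmas vol_section [measurable] = joint_section(1)[of vol, OF vol_joint]

lemma price_bounded_AE: "AE \<omega> in \<Omega>. \<exists>B. \<forall>r. \<bar>price r \<omega>\<bar> \<le> B"
proof -
  have "AE \<omega> in \<Omega>. continuous_on {t..T} (\<lambda>s. X s \<omega>)" using sol by (simp add: strong_solution_def)
  then show ?thesis
  proof eventually_elim
    case (elim \<omega>)
    then have "bounded ((\<lambda>s. X s \<omega>) ` {t..T})" by (intro compact_imp_bounded compact_continuous_image) auto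
    then obtain B where "\<forall>s\<in>{t..T}. \<bar>X s \<omega>\<bar> \<le> B" by (auto simp: bounded_iff)
    then show ?case unfolding price_def using clip_in(2) by blast
  qed
qed

lemma drift_bound: "\<bar>drift r \<omega>\<bar> \<le> k * (1 + \<bar>price r \<omega>\<bar>)"
  unfolding drift_def using f_growth[OF clip_in(1)] .

lemma vol_bound: "(vol r \<omega>)\<^sup>2 \<le> 2 * k\<^sup>2 * (1 + (price r \<omega>)\<^sup>2)"
  unfolding vol_def by (rule linear_growth_square[OF \<sigma>_growth[OF clip_in(1)]])

lemma vol_square_integrable_AE: "AE \<omega> in \<Omega>. \<forall>s. set_integrable lborel {t..s} (\<lambda>r. (vol r \<omega>)\<^sup>2)"
  using price_bounded_AE AE_space
proof eventually_elim
  fix \<omega> assume "\<exists>B. \<forall>r. \<bar>price r \<omega>\<bar> \<le> B" and sp: "\<omega> \<in> space \<Omega>"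
  then obtain B where B: "\<And>r. \<bar>price r \<omega>\<bar> \<le> B" by blast
  have [measurable]: "(\<lambda>r. vol r \<omega>) \<in> borel_measurable borel" using joint_section(2)[OF vol_joint sp] .
  have b: "\<bar>(vol r \<omega>)\<^sup>2\<bar> \<le> 2 * k\<^sup>2 * (1 + B\<^sup>2)" for r
  proof -
    have "(price r \<omega>)\<^sup>2 \<le> B\<^sup>2" using power_mono[OF B[of r], of 2] by simp
    then have "2 * k\<^sup>2 * (1 + (price r \<omega>)\<^sup>2) \<le> 2 * k\<^sup>2 * (1 + B\<^sup>2)" by (intro mult_left_mono) auto
    then show ?thesis using vol_bound[of r \<omega>] by simp
  qed
  show "\<forall>s. set_integrable lborel {t..s} (\<lambda>r. (vol r \<omega>)\<^sup>2)"
    by (intro allI bounded_set_integrable[OF _ b]) measurable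
qed

lemma quad_var_mono_AE: "AE \<omega> in \<Omega>. \<forall>q r. q \<le> r \<longrightarrow> quad_var q \<omega> \<le> quad_var r \<omega>"
  using vol_square_integrable_AE
proof eventually_elim
  case (elim \<omega>)
  show ?case
  proof (intro allI impI)
    fix q r :: real assume "q \<le> r"
    then have "indicator {t..q} x *\<^sub>R (vol x \<omega>)\<^sup>2 \<le> indicator {t..r} x *\<^sub>R (vol x \<omega>)\<^sup>2" for x
      by (auto simp: indicator_def)
    then show "quad_var q \<omega> \<le> quad_var r \<omega>" unfolding quad_var_def set_lebesgue_integral_def
      using elim by (intro integral_mono) (auto simp: set_integrable_def)
  qed
qed

lemma quad_var_nonneg: "0 \<le> quad_var s \<omega>"
  unfolding quad_var_def set_lebesgue_integral_def by (intro Bochner_Integration.integral_nonneg) auto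

lemma noise_is_ito_integral:
  obtains I where "ito_integral \<Omega> F W t T (\<lambda>s \<omega>. \<sigma> s (X s \<omega>)) I"
    "AE \<omega> in \<Omega>. \<forall>s\<in>{t..T}. noise s \<omega> = I s \<omega>"
    "\<forall>s\<in>{t..T}. \<forall>\<omega>. (LINT r:{t..s}|lborel. (\<sigma> r (X r \<omega>))\<^sup>2) = quad_var s \<omega>"
proof -
  obtain I where I: "ito_integral \<Omega> F W t T (\<lambda>s \<omega>. \<sigma> s (X s \<omega>)) I"
      "AE \<omega> in \<Omega>. \<forall>s\<in>{t..T}. X s \<omega> = p + (LINT \<tau>:{t..s}|lborel. f \<tau> (X \<tau> \<omega>)) + I s \<omega>"
    using sol by (auto simp: strong_solution_def)
  show thesis
  proof (rule that[OF I(1)])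
    show "AE \<omega> in \<Omega>. \<forall>s\<in>{t..T}. noise s \<omega> = I s \<omega>"
      using I(2)
    proof eventually_elim
      case (elim \<omega>)
      show ?case
      proof
        fix s assume s: "s \<in> {t..T}"
        have "(LINT r:{t..s}|lborel. drift r \<omega>) = (LINT r:{t..s}|lborel. f r (X r \<omega>))"
          by (rule set_lebesgue_integral_cong) (use s in \<open>auto simp: drift_def price_def clip_eq\<close>)
        then show "noise s \<omega> = I s \<omega>" using elim s by (simp add: noise_def price_def clip_eq)
      qed
    qed
    show "\<forall>s\<in>{t..T}. \<forall>\<omega>. (LINT r:{t..s}|lborel. (\<sigma> r (X r \<omega>))\<^sup>2) = quad_var s \<omega>"
      unfolding quad_var_def
      by (intro ballI allI set_lebesgue_integral_cong) (auto simp: vol_def price_def clip_eq)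
  qed
qed

lemma noise_localized:
  assumes s: "s \<in> {t..T}" and R: "0 \<le> R"
  shows "(\<integral>\<^sup>+\<omega>. indicator {\<omega>. quad_var s \<omega> \<le> R} \<omega> * ennreal ((noise s \<omega>)\<^sup>2) \<partial>\<Omega>)
    \<le> 4 * (\<integral>\<^sup>+\<omega>. ennreal (min (quad_var s \<omega>) R) \<partial>\<Omega>) + 7"
proof -
  obtain I where I: "ito_integral \<Omega> F W t T (\<lambda>s \<omega>. \<sigma> s (X s \<omega>)) I"
    and Y: "AE \<omega> in \<Omega>. \<forall>s\<in>{t..T}. noise s \<omega> = I s \<omega>"
    and q: "\<forall>s\<in>{t..T}. \<forall>\<omega>. (LINT r:{t..s}|lborel. (\<sigma> r (X r \<omega>))\<^sup>2) = quad_var s \<omega>"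
    using noise_is_ito_integral by blast
  have "(\<integral>\<^sup>+\<omega>. indicator {\<omega>. quad_var s \<omega> \<le> R} \<omega> * ennreal ((noise s \<omega>)\<^sup>2) \<partial>\<Omega>) =
      (\<integral>\<^sup>+\<omega>. indicator {\<omega>. quad_var s \<omega> \<le> R} \<omega> * ennreal ((I s \<omega>)\<^sup>2) \<partial>\<Omega>)"
    by (rule nn_integral_cong_AE) (use Y s in auto)
  also have "\<dots> \<le> ennreal (4 * expectation (\<lambda>\<omega>. min (quad_var s \<omega>) R) + 7)"
    using ito_localized_second_moment[OF I t(1) order_refl s R] using q s by simp
  also have "\<dots> = 4 * ennreal (expectation (\<lambda>\<omega>. min (quad_var s \<omega>) R)) + 7"
  proof -
    have "0 \<le> expectation (\<lambda>\<omega>. min (quad_var s \<omega>) R)"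
      using quad_var_nonneg R by (intro Bochner_Integration.integral_nonneg) auto
    then show ?thesis by (simp add: ennreal_plus ennreal_mult)
  qed
  also have "ennreal (expectation (\<lambda>\<omega>. min (quad_var s \<omega>) R)) = (\<integral>\<^sup>+\<omega>. ennreal (min (quad_var s \<omega>) R) \<partial>\<Omega>)"
  proof (rule nn_integral_eq_integral[symmetric])
    show "integrable \<Omega> (\<lambda>\<omega>. min (quad_var s \<omega>) R)"
      by (rule integrable_const_bound[of _ R]) (use quad_var_nonneg R in \<open>auto simp: min_def\<close>)
  qed (use quad_var_nonneg R in auto)
  finally show ?thesis .
qed

text \<open>
  Localizing by the quadratic variation, not by the size of the path, matches the truncation of the
  integrands and yields an event that decreases with time.
\<close>

definition localized :: "real \<Rightarrow> real \<Rightarrow> 'a \<Rightarrow> ennreal" where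
  "localized R s \<omega> = indicator {\<omega>. quad_var s \<omega> \<le> R} \<omega> * ennreal ((noise s \<omega>)\<^sup>2)"

lemma localized_joint: "(\<lambda>x. localized R (fst x) (snd x)) \<in> borel_measurable (borel \<Otimes>\<^sub>M \<Omega>)"
proof -
  have "(\<lambda>x. localized R (fst x) (snd x)) =
      (\<lambda>x. if quad_var (fst x) (snd x) \<le> R then ennreal ((noise (fst x) (snd x))\<^sup>2) else 0)"
    by (auto simp: localized_def indicator_def)
  then show ?thesis by simp
qed

lemma localized_measurable [measurable]: "localized R s \<in> borel_measurable \<Omega>"
  using measurable_Pair2[OF localized_joint, of s R] by simp

lemma price_square_le_AE:
  "AE \<omega> in \<Omega>. \<forall>s\<in>{t..T}. ennreal ((price s \<omega>)\<^sup>2) \<le> ennreal (growth_const k p (T - t)) *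
    (1 + ennreal ((noise s \<omega>)\<^sup>2) + (\<integral>\<^sup>+r. ennreal ((noise r \<omega>)\<^sup>2) * indicator {t..s} r \<partial>lborel))"
  using price_bounded_AE AE_space
proof (eventually_elim, intro ballI)
  fix \<omega> s assume B: "\<exists>B. \<forall>r. \<bar>price r \<omega>\<bar> \<le> B" and sp: "\<omega> \<in> space \<Omega>" and s: "s \<in> {t..T}"
  from B obtain B where B: "\<And>r. \<bar>price r \<omega>\<bar> \<le> B" by blast
  show "ennreal ((price s \<omega>)\<^sup>2) \<le> ennreal (growth_const k p (T - t)) *
      (1 + ennreal ((noise s \<omega>)\<^sup>2) + (\<integral>\<^sup>+r. ennreal ((noise r \<omega>)\<^sup>2) * indicator {t..s} r \<partial>lborel))"
    by (rule pathwise_square_bound[OF k t(2) joint_section(2)[OF price_joint sp]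
          joint_section(2)[OF drift_joint sp] joint_section(2)[OF noise_joint sp] B drift_bound _ s])
       (simp add: noise_def)
qed

text \<open>
  This closes the circle of estimates: the volatility is bounded by the price, the price by the noise, and
  the noise by its quadratic variation. Since the quadratic variation increases, \<open>quad_var r \<le> R\<close> implies
  \<open>quad_var q \<le> R\<close> for all \<open>q \<le> r\<close>, so that the running integral of the noise inside the pathwise bound is
  localized as well.
\<close>

lemma quad_var_le_localized:
  obtains K where "0 \<le> K"
    "\<And>s R. s \<in> {t..T} \<Longrightarrow> 0 \<le> R \<Longrightarrow>
      AE \<omega> in \<Omega>. ennreal (min (quad_var s \<omega>) R) \<le> ennreal K * (1 + (\<integral>\<^sup>+r. localized R r \<omega> * indicator {t..s} r \<partial>lborel))"
proof -
  define c where "c = growth_const k p (T - t)"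
  have c: "0 \<le> c" unfolding c_def using t by (intro growth_const_nonneg) simp
  note P = price_square_le_AE[folded c_def]
  define L where "L = T - t"
  have L: "0 \<le> L" using t by (simp add: L_def)
  define A where "A = 2 * k\<^sup>2 * (1 + c)"
  have A: "0 \<le> A" using c by (simp add: A_def)
  show thesis
  proof (rule that[of "A * (1 + L)"])
    show "0 \<le> A * (1 + L)" using A L by simp
    fix s R :: real assume s: "s \<in> {t..T}" and R: "0 \<le> R"
    show "AE \<omega> in \<Omega>. ennreal (min (quad_var s \<omega>) R) \<le> ennreal (A * (1 + L)) * (1 + (\<integral>\<^sup>+r. localized R r \<omega> * indicator {t..s} r \<partial>lborel))"
      using P vol_square_integrable_AE quad_var_mono_AE AE_space
    proof eventually_elim
      fix \<omega>
      assume P: "\<forall>s\<in>{t..T}. ennreal ((price s \<omega>)\<^sup>2) \<le> ennreal c *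
          (1 + ennreal ((noise s \<omega>)\<^sup>2) + (\<integral>\<^sup>+r. ennreal ((noise r \<omega>)\<^sup>2) * indicator {t..s} r \<partial>lborel))"
        and int: "\<forall>s. set_integrable lborel {t..s} (\<lambda>r. (vol r \<omega>)\<^sup>2)"
        and mono: "\<forall>q r. q \<le> r \<longrightarrow> quad_var q \<omega> \<le> quad_var r \<omega>" and sp: "\<omega> \<in> space \<Omega>"
      define Z where "Z = (\<integral>\<^sup>+r. localized R r \<omega> * indicator {t..s} r \<partial>lborel)"
      have lm[measurable]: "(\<lambda>r. localized R r \<omega>) \<in> borel_measurable borel"
        using measurable_Pair1[OF localized_joint sp] by simp
      have key: "indicator {r. quad_var r \<omega> \<le> R} r * ennreal ((vol r \<omega>)\<^sup>2) \<le> ennreal A * (1 + localized R r \<omega> + Z)"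
        if r: "r \<in> {t..s}" for r
      proof (cases "quad_var r \<omega> \<le> R")
        case True
        have rT: "r \<in> {t..T}" using r s by auto
        have H: "(\<integral>\<^sup>+q. ennreal ((noise q \<omega>)\<^sup>2) * indicator {t..r} q \<partial>lborel) \<le> Z"
          unfolding Z_def
        proof (rule nn_integral_mono)
          fix q
          have "quad_var q \<omega> \<le> R" if "q \<le> r" using mono that True order_trans by blast
          then show "ennreal ((noise q \<omega>)\<^sup>2) * indicator {t..r} q \<le> localized R q \<omega> * indicator {t..s} q"
            using r by (auto simp: localized_def indicator_def)
        qed
        have loc: "localized R r \<omega> = ennreal ((noise r \<omega>)\<^sup>2)" using True by (simp add: localized_def)
        have "ennreal ((vol r \<omega>)\<^sup>2) \<le> ennreal (2 * k\<^sup>2 * (1 + (price r \<omega>)\<^sup>2))"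
          by (intro ennreal_leI vol_bound)
        also have "\<dots> = ennreal (2 * k\<^sup>2) * (1 + ennreal ((price r \<omega>)\<^sup>2))"
          by (simp add: ennreal_mult ennreal_plus)
        also have "\<dots> \<le> ennreal (2 * k\<^sup>2) * (1 + ennreal c * (1 + localized R r \<omega> + Z))"
        proof (intro mult_left_mono add_left_mono)
          have "ennreal ((price r \<omega>)\<^sup>2) \<le> ennreal c * (1 + ennreal ((noise r \<omega>)\<^sup>2) +
              (\<integral>\<^sup>+q. ennreal ((noise q \<omega>)\<^sup>2) * indicator {t..r} q \<partial>lborel))" using P rT by blast
          also have "\<dots> \<le> ennreal c * (1 + localized R r \<omega> + Z)"
            unfolding loc using H by (intro mult_left_mono add_left_mono) auto
          finally show "ennreal ((price r \<omega>)\<^sup>2) \<le> ennreal c * (1 + localized R r \<omega> + Z)" .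
        qed simp
        also have "\<dots> \<le> ennreal (2 * k\<^sup>2) * ((1 + ennreal c) * (1 + localized R r \<omega> + Z))"
        proof (rule mult_left_mono)
          have "1 \<le> 1 + localized R r \<omega> + Z" by (simp add: add.assoc)
          then show "1 + ennreal c * (1 + localized R r \<omega> + Z) \<le> (1 + ennreal c) * (1 + localized R r \<omega> + Z)"
            by (simp add: distrib_right add_right_mono)
        qed simp
        also have "\<dots> = ennreal A * (1 + localized R r \<omega> + Z)"
          unfolding A_def using c by (simp add: ennreal_mult ennreal_plus mult.assoc)
        finally show ?thesis using True by simp
      qed simp
      have "ennreal (min (quad_var s \<omega>) R) \<le>
          (\<integral>\<^sup>+r. indicator {r. quad_var r \<omega> \<le> R} r * ennreal ((vol r \<omega>)\<^sup>2) * indicator {t..s} r \<partial>lborel)"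
        using min_integral_le_stopped_integral[of t s "\<lambda>r. (vol r \<omega>)\<^sup>2" R] int s R by (simp add: quad_var_def)
      also have "\<dots> \<le> (\<integral>\<^sup>+r. ennreal A * ((1 + Z) * indicator {t..s} r + localized R r \<omega> * indicator {t..s} r) \<partial>lborel)"
      proof (rule nn_integral_mono)
        show "indicator {r. quad_var r \<omega> \<le> R} r * ennreal ((vol r \<omega>)\<^sup>2) * indicator {t..s} r
            \<le> ennreal A * ((1 + Z) * indicator {t..s} r + localized R r \<omega> * indicator {t..s} r)" for r
          using key[of r] by (auto simp: indicator_def ac_simps)
      qed
      also have "\<dots> = ennreal A * ((1 + Z) * ennreal (s - t) + Z)"
        unfolding Z_def[symmetric] using s
        by (simp add: nn_integral_cmult nn_integral_add nn_integral_cmult_indicator Z_def[symmetric])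
      also have "\<dots> \<le> ennreal A * ((1 + Z) * ennreal L + (1 + Z))"
        using s by (intro mult_left_mono add_mono ennreal_leI) (auto simp: L_def add_increasing)
      also have "\<dots> = ennreal (A * (1 + L)) * (1 + Z)"
        using A L by (simp add: ennreal_mult ennreal_plus distrib_left distrib_right ac_simps)
      finally show "ennreal (min (quad_var s \<omega>) R) \<le> ennreal (A * (1 + L)) * (1 + (\<integral>\<^sup>+r. localized R r \<omega> * indicator {t..s} r \<partial>lborel))"
        unfolding Z_def .
    qed
  qed
qed

lemma running_nn_integral_measurable:
  assumes g: "(\<lambda>x. g (fst x) (snd x)) \<in> borel_measurable (borel \<Otimes>\<^sub>M \<Omega>)"
  shows "(\<lambda>\<omega>. \<integral>\<^sup>+r. (g r \<omega> :: ennreal) * indicator {a..b::real} r \<partial>lborel) \<in> borel_measurable \<Omega>"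
proof (rule lborel.borel_measurable_nn_integral)
  have "(\<lambda>x. g (fst x) (snd x)) \<circ> (\<lambda>y. (snd y, fst y)) \<in> borel_measurable (\<Omega> \<Otimes>\<^sub>M lborel)"
    by (rule measurable_comp[OF _ g]) measurable
  then have [measurable]: "(\<lambda>y. g (snd y) (fst y)) \<in> borel_measurable (\<Omega> \<Otimes>\<^sub>M lborel)"
    by (simp add: comp_def)
  show "(\<lambda>(\<omega>, r). g r \<omega> * indicator {a..b} r) \<in> borel_measurable (\<Omega> \<Otimes>\<^sub>M lborel)"
    unfolding case_prod_beta by measurable
qed

lemma tonelli_running:
  assumes "(\<lambda>x. g (fst x) (snd x)) \<in> borel_measurable (borel \<Otimes>\<^sub>M \<Omega>)"
  shows "(\<integral>\<^sup>+\<omega>. (\<integral>\<^sup>+r. g r \<omega> * indicator {a..b} r \<partial>lborel) \<partial>\<Omega>) = (\<integral>\<^sup>+r. (\<integral>\<^sup>+\<omega>. g r \<omega> \<partial>\<Omega>) * indicator {a..b::real} r \<partial>lborel)"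
proof -
  interpret P: pair_sigma_finite lborel \<Omega> ..
  have [measurable]: "(\<lambda>x. g (fst x) (snd x)) \<in> borel_measurable (lborel \<Otimes>\<^sub>M \<Omega>)"
    using assms by (simp cong: measurable_cong_sets)
  have "(\<lambda>(r, \<omega>). g r \<omega> * indicator {a..b} r) \<in> borel_measurable (lborel \<Otimes>\<^sub>M \<Omega>)"
    unfolding case_prod_beta by measurable
  from P.Fubini'[OF this] show ?thesis
    using measurable_Pair2[OF assms] by (simp add: nn_integral_multc)
qed

text \<open>
  For each \<open>R\<close> the second moment \<open>h\<close> of the localized noise satisfies an integral inequality whose
  constants are independent of \<open>R\<close>. It is bounded by \<open>4 * R + 7\<close>, which justifies Gronwall's inequality but
  does not enter its conclusion; then \<open>R\<close> tends to infinity.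
\<close>

theorem noise_second_moment:
  obtains M where "0 \<le> M" "\<And>s. s \<in> {t..T} \<Longrightarrow> (\<integral>\<^sup>+\<omega>. ennreal ((noise s \<omega>)\<^sup>2) \<partial>\<Omega>) \<le> ennreal M"
proof -
  obtain K where K: "0 \<le> K" and Q: "\<And>s R. s \<in> {t..T} \<Longrightarrow> 0 \<le> R \<Longrightarrow>
      AE \<omega> in \<Omega>. ennreal (min (quad_var s \<omega>) R) \<le> ennreal K * (1 + (\<integral>\<^sup>+r. localized R r \<omega> * indicator {t..s} r \<partial>lborel))"
    by (rule quad_var_le_localized) blast
  define C where "C = 4 * K + 1"
  have C: "0 < C" using K by (simp add: C_def)
  define M where "M = 2 * (4 * K + 7) * exp (2 * C * (T - t))"
  have bound: "(\<integral>\<^sup>+\<omega>. localized R s \<omega> \<partial>\<Omega>) \<le> ennreal M" if s: "s \<in> {t..T}" and R: "0 \<le> R" for s R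
  proof -
    let ?h = "\<lambda>s. \<integral>\<^sup>+\<omega>. localized R s \<omega> \<partial>\<Omega>"
    have "?h s \<le> 2 * ennreal (4 * K + 7) * ennreal (exp (2 * C * (s - t)))"
    proof (rule gronwall_nn[OF C, of "ennreal (4 * R + 7)" t T])
      fix s assume s: "s \<in> {t..T}"
      have "?h s \<le> 4 * (\<integral>\<^sup>+\<omega>. ennreal (min (quad_var s \<omega>) R) \<partial>\<Omega>) + 7"
        unfolding localized_def by (rule noise_localized[OF s R])
      also have "\<dots> \<le> 4 * (\<integral>\<^sup>+\<omega>. ennreal R \<partial>\<Omega>) + 7"
        by (intro add_right_mono mult_left_mono nn_integral_mono ennreal_leI) auto
      also have "\<dots> = ennreal (4 * R + 7)" using R by (simp add: emeasure_space_1 ennreal_plus ennreal_mult)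
      finally show "?h s \<le> ennreal (4 * R + 7)" .
      have "?h s \<le> 4 * (\<integral>\<^sup>+\<omega>. ennreal (min (quad_var s \<omega>) R) \<partial>\<Omega>) + 7"
        unfolding localized_def by (rule noise_localized[OF s R])
      also have "(\<integral>\<^sup>+\<omega>. ennreal (min (quad_var s \<omega>) R) \<partial>\<Omega>) \<le>
          (\<integral>\<^sup>+\<omega>. ennreal K * (1 + (\<integral>\<^sup>+r. localized R r \<omega> * indicator {t..s} r \<partial>lborel)) \<partial>\<Omega>)"
        by (rule nn_integral_mono_AE[OF Q[OF s R]])
      also have "\<dots> = ennreal K * (1 + (\<integral>\<^sup>+r. ?h r * indicator {t..s} r \<partial>lborel))"
      proof -
        note [measurable] = running_nn_integral_measurable[OF localized_joint]
        show ?thesis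
          by (simp add: nn_integral_cmult nn_integral_add emeasure_space_1 tonelli_running[OF localized_joint])
      qed
      also have "4 * (ennreal K * (1 + (\<integral>\<^sup>+r. ?h r * indicator {t..s} r \<partial>lborel))) + 7 =
          ennreal (4 * K + 7) + ennreal (4 * K) * (\<integral>\<^sup>+r. ?h r * indicator {t..s} r \<partial>lborel)"
        using K by (simp add: ennreal_plus ennreal_mult distrib_left ac_simps)
      also have "\<dots> \<le> ennreal (4 * K + 7) + ennreal C * (\<integral>\<^sup>+r. ?h r * indicator {t..s} r \<partial>lborel)"
        by (intro add_left_mono mult_right_mono ennreal_leI) (auto simp: C_def)
      finally show "?h s \<le> ennreal (4 * K + 7) + ennreal C * (\<integral>\<^sup>+r. ?h r * indicator {t..s} r \<partial>lborel)"
        by (simp add: add_right_mono mult_left_mono)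
    qed (use s in auto)
    also have "\<dots> \<le> 2 * ennreal (4 * K + 7) * ennreal (exp (2 * C * (T - t)))"
      using s C by (intro mult_left_mono ennreal_leI) auto
    also have "\<dots> = ennreal M" using K by (simp add: M_def ennreal_mult)
    finally show ?thesis .
  qed
  show thesis
  proof (rule that[of M])
    show "0 \<le> M" using K by (simp add: M_def)
    fix s assume s: "s \<in> {t..T}"
    have "(\<integral>\<^sup>+\<omega>. ennreal ((noise s \<omega>)\<^sup>2) \<partial>\<Omega>) \<le> (\<integral>\<^sup>+\<omega>. (SUP n. localized (real n) s \<omega>) \<partial>\<Omega>)"
    proof (rule nn_integral_mono)
      fix \<omega>
      obtain n :: nat where "quad_var s \<omega> \<le> real n" using real_arch_simple by blast
      then have "ennreal ((noise s \<omega>)\<^sup>2) = localized (real n) s \<omega>" by (simp add: localized_def)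
      then show "ennreal ((noise s \<omega>)\<^sup>2) \<le> (SUP n. localized (real n) s \<omega>)" by (auto intro: SUP_upper)
    qed
    also have "\<dots> = (SUP n. \<integral>\<^sup>+\<omega>. localized (real n) s \<omega> \<partial>\<Omega>)"
    proof (rule nn_integral_monotone_convergence_SUP)
      show "incseq (\<lambda>n. localized (real n) s)"
        unfolding incseq_def le_fun_def localized_def by (auto simp: indicator_def)
    qed simp
    also have "\<dots> \<le> ennreal M" using bound[OF s] by (intro SUP_least) auto
    finally show "(\<integral>\<^sup>+\<omega>. ennreal ((noise s \<omega>)\<^sup>2) \<partial>\<Omega>) \<le> ennreal M" .
  qed
qed

lemma price_second_moment:
  obtains M where "0 \<le> M" "\<And>s. s \<in> {t..T} \<Longrightarrow> (\<integral>\<^sup>+\<omega>. ennreal ((price s \<omega>)\<^sup>2) \<partial>\<Omega>) \<le> ennreal M"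
proof -
  obtain M where M: "0 \<le> M" and Y: "\<And>s. s \<in> {t..T} \<Longrightarrow> (\<integral>\<^sup>+\<omega>. ennreal ((noise s \<omega>)\<^sup>2) \<partial>\<Omega>) \<le> ennreal M"
    by (rule noise_second_moment) blast
  define c where "c = growth_const k p (T - t)"
  have c: "0 \<le> c" unfolding c_def using t by (intro growth_const_nonneg) simp
  note P = price_square_le_AE[folded c_def]
  have nm: "(\<lambda>x. ennreal ((noise (fst x) (snd x))\<^sup>2)) \<in> borel_measurable (borel \<Otimes>\<^sub>M \<Omega>)" by measurable
  show thesis
  proof (rule that[of "c * (1 + M + M * (T - t))"])
    show "0 \<le> c * (1 + M + M * (T - t))" using c M t by simp
    fix s assume s: "s \<in> {t..T}"
    note [measurable] = running_nn_integral_measurable[of "\<lambda>r \<omega>. ennreal ((noise r \<omega>)\<^sup>2)", OF nm]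
    have "(\<integral>\<^sup>+\<omega>. ennreal ((price s \<omega>)\<^sup>2) \<partial>\<Omega>) \<le> (\<integral>\<^sup>+\<omega>. ennreal c *
      (1 + ennreal ((noise s \<omega>)\<^sup>2) + (\<integral>\<^sup>+r. ennreal ((noise r \<omega>)\<^sup>2) * indicator {t..s} r \<partial>lborel)) \<partial>\<Omega>)"
      by (rule nn_integral_mono_AE) (use P s in auto)
    also have "\<dots> = ennreal c * (1 + (\<integral>\<^sup>+\<omega>. ennreal ((noise s \<omega>)\<^sup>2) \<partial>\<Omega>) +
        (\<integral>\<^sup>+r. (\<integral>\<^sup>+\<omega>. ennreal ((noise r \<omega>)\<^sup>2) \<partial>\<Omega>) * indicator {t..s} r \<partial>lborel))"
      by (simp add: nn_integral_cmult nn_integral_add emeasure_space_1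
          tonelli_running[of "\<lambda>r \<omega>. ennreal ((noise r \<omega>)\<^sup>2)", OF nm])
    also have "\<dots> \<le> ennreal c * (1 + ennreal M + ennreal (M * (T - t)))"
    proof (intro mult_left_mono add_mono order_refl)
      show "(\<integral>\<^sup>+\<omega>. ennreal ((noise s \<omega>)\<^sup>2) \<partial>\<Omega>) \<le> ennreal M" by (rule Y[OF s])
      have "(\<integral>\<^sup>+r. (\<integral>\<^sup>+\<omega>. ennreal ((noise r \<omega>)\<^sup>2) \<partial>\<Omega>) * indicator {t..s} r \<partial>lborel)
          \<le> (\<integral>\<^sup>+r. ennreal M * indicator {t..T} r \<partial>lborel)"
      proof (rule nn_integral_mono)
        show "(\<integral>\<^sup>+\<omega>. ennreal ((noise r \<omega>)\<^sup>2) \<partial>\<Omega>) * indicator {t..s} r \<le> ennreal M * indicator {t..T} r" for r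
          using Y[of r] s by (auto simp: indicator_def)
      qed
      also have "\<dots> = ennreal (M * (T - t))"
        using t M by (simp add: nn_integral_cmult_indicator ennreal_mult)
      finally show "(\<integral>\<^sup>+r. (\<integral>\<^sup>+\<omega>. ennreal ((noise r \<omega>)\<^sup>2) \<partial>\<Omega>) * indicator {t..s} r \<partial>lborel) \<le> ennreal (M * (T - t))" .
    qed simp
    also have "\<dots> = ennreal (c * (1 + M + M * (T - t)))"
      using c M t by (simp add: ennreal_mult ennreal_plus)
    finally show "(\<integral>\<^sup>+\<omega>. ennreal ((price s \<omega>)\<^sup>2) \<partial>\<Omega>) \<le> ennreal (c * (1 + M + M * (T - t)))" .
  qed
qed

lemma second_moment_linear_growth:
  assumes c: "\<And>\<omega>. \<bar>c \<omega>\<bar> \<le> k * (1 + \<bar>price s \<omega>\<bar>)" and M: "0 \<le> M"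
    and P: "(\<integral>\<^sup>+\<omega>. ennreal ((price s \<omega>)\<^sup>2) \<partial>\<Omega>) \<le> ennreal M"
  shows "(\<integral>\<^sup>+\<omega>. ennreal ((c \<omega>)\<^sup>2) \<partial>\<Omega>) \<le> ennreal (2 * k\<^sup>2 * (1 + M))"
proof -
  have "(\<integral>\<^sup>+\<omega>. ennreal ((c \<omega>)\<^sup>2) \<partial>\<Omega>) \<le> (\<integral>\<^sup>+\<omega>. ennreal (2 * k\<^sup>2) * (1 + ennreal ((price s \<omega>)\<^sup>2)) \<partial>\<Omega>)"
  proof (rule nn_integral_mono)
    fix \<omega>
    have "ennreal ((c \<omega>)\<^sup>2) \<le> ennreal (2 * k\<^sup>2 * (1 + (price s \<omega>)\<^sup>2))"
      by (intro ennreal_leI linear_growth_square c)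
    then show "ennreal ((c \<omega>)\<^sup>2) \<le> ennreal (2 * k\<^sup>2) * (1 + ennreal ((price s \<omega>)\<^sup>2))"
      by (simp add: ennreal_mult ennreal_plus)
  qed
  also have "\<dots> = ennreal (2 * k\<^sup>2) * (1 + (\<integral>\<^sup>+\<omega>. ennreal ((price s \<omega>)\<^sup>2) \<partial>\<Omega>))"
    by (simp add: nn_integral_cmult nn_integral_add emeasure_space_1)
  also have "\<dots> \<le> ennreal (2 * k\<^sup>2) * (1 + ennreal M)"
    using P by (intro mult_left_mono add_left_mono) auto
  also have "\<dots> = ennreal (2 * k\<^sup>2 * (1 + M))" using M by (simp add: ennreal_mult ennreal_plus)
  finally show ?thesis .
qed

lemma quad_var_integrable: "integrable \<Omega> (quad_var T)"
proof -
  obtain M where M: "0 \<le> M" and P: "\<And>s. s \<in> {t..T} \<Longrightarrow> (\<integral>\<^sup>+\<omega>. ennreal ((price s \<omega>)\<^sup>2) \<partial>\<Omega>) \<le> ennreal M"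
    by (rule price_second_moment) blast
  have vm: "(\<lambda>x. ennreal ((vol (fst x) (snd x))\<^sup>2)) \<in> borel_measurable (borel \<Otimes>\<^sub>M \<Omega>)" by measurable
  have "(\<integral>\<^sup>+\<omega>. ennreal (quad_var T \<omega>) \<partial>\<Omega>) = (\<integral>\<^sup>+\<omega>. (\<integral>\<^sup>+r. ennreal ((vol r \<omega>)\<^sup>2) * indicator {t..T} r \<partial>lborel) \<partial>\<Omega>)"
  proof (rule nn_integral_cong_AE, use vol_square_integrable_AE in eventually_elim)
    fix \<omega> assume int: "\<forall>s. set_integrable lborel {t..s} (\<lambda>r. (vol r \<omega>)\<^sup>2)"
    have "(\<integral>\<^sup>+r. ennreal ((vol r \<omega>)\<^sup>2) * indicator {t..T} r \<partial>lborel) = (\<integral>\<^sup>+r. ennreal (indicator {t..T} r *\<^sub>R (vol r \<omega>)\<^sup>2) \<partial>lborel)"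
      by (intro nn_integral_cong) (auto simp: indicator_def)
    also have "\<dots> = ennreal (quad_var T \<omega>)" unfolding quad_var_def set_lebesgue_integral_def
      using int by (intro nn_integral_eq_integral) (auto simp: set_integrable_def)
    finally show "ennreal (quad_var T \<omega>) = (\<integral>\<^sup>+r. ennreal ((vol r \<omega>)\<^sup>2) * indicator {t..T} r \<partial>lborel)" by simp
  qed
  also have "\<dots> = (\<integral>\<^sup>+r. (\<integral>\<^sup>+\<omega>. ennreal ((vol r \<omega>)\<^sup>2) \<partial>\<Omega>) * indicator {t..T} r \<partial>lborel)"
    by (rule tonelli_running[of "\<lambda>r \<omega>. ennreal ((vol r \<omega>)\<^sup>2)", OF vm])
  also have "\<dots> \<le> (\<integral>\<^sup>+r. ennreal (2 * k\<^sup>2 * (1 + M)) * indicator {t..T} r \<partial>lborel)"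
  proof (rule nn_integral_mono)
    fix r
    have "(\<integral>\<^sup>+\<omega>. ennreal ((vol r \<omega>)\<^sup>2) \<partial>\<Omega>) \<le> ennreal (2 * k\<^sup>2 * (1 + M))" if "r \<in> {t..T}"
      by (rule second_moment_linear_growth[OF _ M P[OF that]])
         (auto simp: vol_def intro: \<sigma>_growth[OF clip_in(1)])
    then show "(\<integral>\<^sup>+\<omega>. ennreal ((vol r \<omega>)\<^sup>2) \<partial>\<Omega>) * indicator {t..T} r \<le> ennreal (2 * k\<^sup>2 * (1 + M)) * indicator {t..T} r"
      by (auto simp: indicator_def)
  qed
  also have "\<dots> < \<infinity>" using t by (simp add: nn_integral_cmult_indicator ennreal_mult_less_top)
  finally show ?thesis
    using quad_var_nonneg by (intro integrableI_nonneg) auto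
qed

lemma noise_square_integrable: "s \<in> {t..T} \<Longrightarrow> integrable \<Omega> (\<lambda>\<omega>. (noise s \<omega>)\<^sup>2)"
proof -
  assume s: "s \<in> {t..T}"
  obtain M where "0 \<le> M" and Y: "\<And>s. s \<in> {t..T} \<Longrightarrow> (\<integral>\<^sup>+\<omega>. ennreal ((noise s \<omega>)\<^sup>2) \<partial>\<Omega>) \<le> ennreal M"
    by (rule noise_second_moment) blast
  then show ?thesis using Y[OF s] by (intro integrableI_nonneg) (auto intro: le_less_trans)
qed

lemma noise_integrable: "s \<in> {t..T} \<Longrightarrow> integrable \<Omega> (noise s)"
  by (rule square_integrable_imp_integrable[OF noise_section noise_square_integrable])

text \<open>
  The noise agrees with an Ito integral almost surely, which is enough inside expectations; the moment
  bounds supply the integrability that the martingale property requires.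
\<close>

theorem noise_martingale:
  assumes s: "s \<in> {t..T}" and v: "v \<in> borel_measurable (F s)" "\<And>\<omega>. \<omega> \<in> space \<Omega> \<Longrightarrow> \<bar>v \<omega>\<bar> \<le> B"
  shows "expectation (\<lambda>\<omega>. v \<omega> * noise s \<omega>) = expectation (\<lambda>\<omega>. v \<omega> * noise T \<omega>)"
proof -
  obtain I where I: "ito_integral \<Omega> F W t T (\<lambda>s \<omega>. \<sigma> s (X s \<omega>)) I"
    and Y: "AE \<omega> in \<Omega>. \<forall>s\<in>{t..T}. noise s \<omega> = I s \<omega>"
    and q: "\<forall>s\<in>{t..T}. \<forall>\<omega>. (LINT r:{t..s}|lborel. (\<sigma> r (X r \<omega>))\<^sup>2) = quad_var s \<omega>"
    using noise_is_ito_integral by blast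
  have T: "T \<in> {t..T}" using t by simp
  have vm[measurable]: "v \<in> borel_measurable \<Omega>" using v(1) by (rule measurable_F_imp) (use s t in auto)
  have Im[measurable]: "I s' \<in> borel_measurable \<Omega>" if "s' \<in> {t..T}" for s'
  proof (rule measurable_F_imp)
    show "I s' \<in> borel_measurable (F s')" using I that by (auto simp: ito_integral_def)
  qed (use that t in auto)
  have eq: "AE \<omega> in \<Omega>. noise s' \<omega> = I s' \<omega>" if "s' \<in> {t..T}" for s'
    using Y by eventually_elim (use that in blast)
  have I2: "integrable \<Omega> (\<lambda>\<omega>. (I s' \<omega>)\<^sup>2)" if "s' \<in> {t..T}" for s'
  proof -
    have "integrable \<Omega> (\<lambda>\<omega>. (noise s' \<omega>)\<^sup>2) = integrable \<Omega> (\<lambda>\<omega>. (I s' \<omega>)\<^sup>2)"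
      using Im[OF that] eq[OF that] by (intro integrable_cong_AE) auto
    then show ?thesis using noise_square_integrable[OF that] by simp
  qed
  have Econg: "expectation (\<lambda>\<omega>. v \<omega> * noise s' \<omega>) = expectation (\<lambda>\<omega>. v \<omega> * I s' \<omega>)" if "s' \<in> {t..T}" for s'
    using Im[OF that] eq[OF that] by (intro integral_cong_AE) auto
  have "expectation (\<lambda>\<omega>. v \<omega> * I s \<omega>) = expectation (\<lambda>\<omega>. v \<omega> * I T \<omega>)"
  proof (rule ito_integral_martingale[OF I t(1) order_refl s _ I2[OF s] I2[OF T] v])
    show "integrable \<Omega> (\<lambda>\<omega>. LINT r:{t..T}|lborel. (\<sigma> r (X r \<omega>))\<^sup>2)"
      using quad_var_integrable q T by simp
  qed
  then show ?thesis using Econg[OF s] Econg[OF T] by simp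
qed

lemma product_integrable:
  assumes u: "(\<lambda>x. u (fst x) (snd x)) \<in> borel_measurable (borel \<Otimes>\<^sub>M \<Omega>)"
    "\<And>s \<omega>. \<omega> \<in> space \<Omega> \<Longrightarrow> \<bar>u s \<omega>\<bar> \<le> D * indicator {t..T} s" "0 \<le> D"
    and g: "(\<lambda>x. g (fst x) (snd x)) \<in> borel_measurable (borel \<Otimes>\<^sub>M \<Omega>)"
    "\<And>s. s \<in> {t..T} \<Longrightarrow> (\<integral>\<^sup>+\<omega>. ennreal ((g s \<omega>)\<^sup>2) \<partial>\<Omega>) \<le> ennreal M"
  shows "integrable (lborel \<Otimes>\<^sub>M \<Omega>) (\<lambda>x. u (fst x) (snd x) * g (fst x) (snd x) :: real)"
  unfolding integrable_iff_bounded
proof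
  have [measurable]: "(\<lambda>x. u (fst x) (snd x)) \<in> borel_measurable (lborel \<Otimes>\<^sub>M \<Omega>)"
    "(\<lambda>x. g (fst x) (snd x)) \<in> borel_measurable (lborel \<Otimes>\<^sub>M \<Omega>)"
    using u(1) g(1) by (simp_all cong: measurable_cong_sets)
  show "(\<lambda>x. u (fst x) (snd x) * g (fst x) (snd x)) \<in> borel_measurable (lborel \<Otimes>\<^sub>M \<Omega>)" by measurable
  have "(\<integral>\<^sup>+x. ennreal (norm (u (fst x) (snd x) * g (fst x) (snd x))) \<partial>(lborel \<Otimes>\<^sub>M \<Omega>)) =
      (\<integral>\<^sup>+s. \<integral>\<^sup>+\<omega>. ennreal (norm (u s \<omega> * g s \<omega>)) \<partial>\<Omega> \<partial>lborel)"
    by (subst nn_integral_fst[symmetric]) simp_all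
  also have "\<dots> \<le> (\<integral>\<^sup>+s. ennreal D * (1 + ennreal M) * indicator {t..T} s \<partial>lborel)"
  proof (rule nn_integral_mono)
    fix s
    have [measurable]: "g s \<in> borel_measurable \<Omega>" using joint_section(1)[OF g(1)] .
    have "(\<integral>\<^sup>+\<omega>. ennreal (norm (u s \<omega> * g s \<omega>)) \<partial>\<Omega>) \<le> (\<integral>\<^sup>+\<omega>. ennreal (D * indicator {t..T} s) * (1 + ennreal ((g s \<omega>)\<^sup>2)) \<partial>\<Omega>)"
    proof (rule nn_integral_mono)
      fix \<omega> assume sp: "\<omega> \<in> space \<Omega>"
      have "\<bar>g s \<omega>\<bar> \<le> 1 + (g s \<omega>)\<^sup>2"
      proof -
        have "0 \<le> (\<bar>g s \<omega>\<bar> - 1/2)\<^sup>2" by simp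
        then show ?thesis by (simp add: power2_eq_square algebra_simps)
      qed
      then have "\<bar>u s \<omega>\<bar> * \<bar>g s \<omega>\<bar> \<le> (D * indicator {t..T} s) * (1 + (g s \<omega>)\<^sup>2)"
        using u(2)[OF sp, of s] u(3) by (intro mult_mono) auto
      then have "ennreal (norm (u s \<omega> * g s \<omega>)) \<le> ennreal ((D * indicator {t..T} s) * (1 + (g s \<omega>)\<^sup>2))"
        by (intro ennreal_leI) (simp add: abs_mult)
      then show "ennreal (norm (u s \<omega> * g s \<omega>)) \<le> ennreal (D * indicator {t..T} s) * (1 + ennreal ((g s \<omega>)\<^sup>2))"
        using u(3) by (simp add: ennreal_mult ennreal_plus)
    qed
    also have "\<dots> = ennreal (D * indicator {t..T} s) * (1 + (\<integral>\<^sup>+\<omega>. ennreal ((g s \<omega>)\<^sup>2) \<partial>\<Omega>))"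
      by (simp add: nn_integral_cmult nn_integral_add emeasure_space_1)
    also have "\<dots> \<le> ennreal D * (1 + ennreal M) * indicator {t..T} s"
    proof (cases "s \<in> {t..T}")
      case True
      then show ?thesis using g(2)[OF True] by (auto intro!: mult_left_mono add_left_mono)
    qed simp
    finally show "(\<integral>\<^sup>+\<omega>. ennreal (norm (u s \<omega> * g s \<omega>)) \<partial>\<Omega>) \<le> ennreal D * (1 + ennreal M) * indicator {t..T} s" .
  qed
  also have "\<dots> < \<infinity>" using t by (simp add: nn_integral_cmult_indicator ennreal_mult_less_top)
  finally show "(\<integral>\<^sup>+x. ennreal (norm (u (fst x) (snd x) * g (fst x) (snd x))) \<partial>(lborel \<Otimes>\<^sub>M \<Omega>)) < \<infinity>" .
qed

end

section \<open>The payoff as a functional of the control\<close>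

lemma progressively_measurable_const: "progressively_measurable F a b (\<lambda>s \<omega>. c)"
  by (simp add: progressively_measurable_def)

lemma progressively_measurable_linear:
  assumes "progressively_measurable F a b u" "progressively_measurable F a b v"
  shows "progressively_measurable F a b (\<lambda>s \<omega>. \<alpha> * u s \<omega> + \<beta> * v s \<omega>)"
  unfolding progressively_measurable_def case_prod_beta
proof
  fix s assume "s \<in> {a..b}"
  then have [measurable]: "(\<lambda>x. u (fst x) (snd x)) \<in> borel_measurable (restrict_space borel {a..s} \<Otimes>\<^sub>M F s)"
    "(\<lambda>x. v (fst x) (snd x)) \<in> borel_measurable (restrict_space borel {a..s} \<Otimes>\<^sub>M F s)"
    using assms unfolding progressively_measurable_def case_prod_beta by auto
  show "(\<lambda>x. \<alpha> * u (fst x) (snd x) + \<beta> * v (fst x) (snd x)) \<in> borel_measurable (restrict_space borel {a..s} \<Otimes>\<^sub>M F s)"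
    by measurable
qed

context sde_solution
begin

definition payoff :: "(real \<Rightarrow> real) \<Rightarrow> real \<Rightarrow> (real \<Rightarrow> 'a \<Rightarrow> real) \<Rightarrow> real" where
  "payoff w \<kappa> u = expectation (\<lambda>\<omega>. LINT s:{t..T}|lborel. w s * (X s \<omega> - \<kappa>) * u s \<omega>)"

definition weighted :: "(real \<Rightarrow> real) \<Rightarrow> (real \<Rightarrow> 'a \<Rightarrow> real) \<Rightarrow> real \<Rightarrow> 'a \<Rightarrow> real" where
  "weighted w u s \<omega> = indicator {t..T} s * w s * u (clip s) \<omega>"

definition bounded_control :: "real \<Rightarrow> (real \<Rightarrow> 'a \<Rightarrow> real) \<Rightarrow> bool" where
  "bounded_control D u \<longleftrightarrow> progressively_measurable F t T u \<and> 0 \<le> D \<and>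
     (\<forall>s\<in>{t..T}. \<forall>\<omega>\<in>space \<Omega>. \<bar>u s \<omega>\<bar> \<le> D)"

definition total_drift :: "'a \<Rightarrow> real" where
  "total_drift \<omega> = (\<integral>r. indicator {t..T} r * \<bar>drift r \<omega>\<bar> \<partial>lborel)"

text \<open>
  After the noise at time \<open>s\<close> has been replaced by its terminal value, \<open>P s - \<kappa>\<close> is bounded by a random
  variable that does not depend on \<open>s\<close>; this is its expectation.
\<close>

definition payoff_slope :: "real \<Rightarrow> real" where
  "payoff_slope \<kappa> = expectation (\<lambda>\<omega>. \<bar>p - \<kappa>\<bar> + total_drift \<omega> + \<bar>noise T \<omega>\<bar>)"

lemma control_joint:
  "bounded_control D u \<Longrightarrow> (\<lambda>x. u (clip (fst x)) (snd x)) \<in> borel_measurable (borel \<Otimes>\<^sub>M \<Omega>)"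
  using progressively_measurable_joint[OF _ t order_refl, of u]
  unfolding bounded_control_def clip_def case_prod_beta by blast

lemma control_path_integrable:
  assumes u: "bounded_control D u" and sp: "\<omega> \<in> space \<Omega>"
  shows "set_integrable lborel {t..T} (\<lambda>s. u s \<omega>)"
proof -
  have "(\<lambda>s. u (clip s) \<omega>) \<in> borel_measurable borel"
    using measurable_Pair1[OF control_joint[OF u] sp] by simp
  moreover have "\<bar>u (clip s) \<omega>\<bar> \<le> D" for s using u sp clip_in(2) by (auto simp: bounded_control_def)
  ultimately have "set_integrable lborel {t..T} (\<lambda>s. u (clip s) \<omega>)" by (intro bounded_set_integrable)
  also have "?this \<longleftrightarrow> set_integrable lborel {t..T} (\<lambda>s. u s \<omega>)"
    by (rule set_integrable_cong) (auto simp: clip_eq)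
  finally show ?thesis .
qed

lemma bounded_control_linear:
  assumes "bounded_control D u" "bounded_control D v"
  shows "bounded_control (\<bar>\<alpha>\<bar> * D + \<bar>\<beta>\<bar> * D) (\<lambda>s \<omega>. \<alpha> * u s \<omega> + \<beta> * v s \<omega>)"
  unfolding bounded_control_def
proof (intro conjI ballI)
  show "progressively_measurable F t T (\<lambda>s \<omega>. \<alpha> * u s \<omega> + \<beta> * v s \<omega>)"
    using assms by (intro progressively_measurable_linear) (auto simp: bounded_control_def)
  show "0 \<le> \<bar>\<alpha>\<bar> * D + \<bar>\<beta>\<bar> * D" using assms by (simp add: bounded_control_def)
  fix s \<omega> assume "s \<in> {t..T}" "\<omega> \<in> space \<Omega>"
  then have "\<bar>\<alpha>\<bar> * \<bar>u s \<omega>\<bar> \<le> \<bar>\<alpha>\<bar> * D" "\<bar>\<beta>\<bar> * \<bar>v s \<omega>\<bar> \<le> \<bar>\<beta>\<bar> * D"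
    using assms by (auto simp: bounded_control_def intro!: mult_left_mono)
  then show "\<bar>\<alpha> * u s \<omega> + \<beta> * v s \<omega>\<bar> \<le> \<bar>\<alpha>\<bar> * D + \<bar>\<beta>\<bar> * D"
    using abs_triangle_ineq[of "\<alpha> * u s \<omega>" "\<beta> * v s \<omega>"] by (simp add: abs_mult)
qed

lemma total_drift:
  shows "integrable \<Omega> total_drift" "0 \<le> total_drift \<omega>"
    "AE \<omega> in \<Omega>. \<forall>s\<in>{t..T}. \<bar>price s \<omega> - p - noise s \<omega>\<bar> \<le> total_drift \<omega>"
proof -
  interpret P: pair_sigma_finite lborel \<Omega> ..
  obtain M where M: "0 \<le> M" "\<And>s. s \<in> {t..T} \<Longrightarrow> (\<integral>\<^sup>+\<omega>. ennreal ((price s \<omega>)\<^sup>2) \<partial>\<Omega>) \<le> ennreal M"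
    by (rule price_second_moment) blast
  have D2: "(\<integral>\<^sup>+\<omega>. ennreal (\<bar>drift s \<omega>\<bar>\<^sup>2) \<partial>\<Omega>) \<le> ennreal (2 * k\<^sup>2 * (1 + M))" if s: "s \<in> {t..T}" for s
    by (rule second_moment_linear_growth[OF _ M(1) M(2)[OF s]]) (simp add: drift_bound)
  have int: "integrable (lborel \<Otimes>\<^sub>M \<Omega>) (\<lambda>x. indicator {t..T} (fst x) * \<bar>drift (fst x) (snd x)\<bar>)"
    by (rule product_integrable[where D = 1 and u = "\<lambda>s _. indicator {t..T} s" and g = "\<lambda>s \<omega>. \<bar>drift s \<omega>\<bar>", OF _ _ _ _ D2]) auto
  show "integrable \<Omega> total_drift"
    unfolding total_drift_def[abs_def]
    by (rule P.integrable_snd[of "\<lambda>r \<omega>. indicator {t..T} r * \<bar>drift r \<omega>\<bar>", unfolded case_prod_beta, OF int])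
  show "0 \<le> total_drift \<omega>" unfolding total_drift_def by (intro Bochner_Integration.integral_nonneg) auto
  show "AE \<omega> in \<Omega>. \<forall>s\<in>{t..T}. \<bar>price s \<omega> - p - noise s \<omega>\<bar> \<le> total_drift \<omega>"
    using price_bounded_AE AE_space
  proof eventually_elim
    fix \<omega> assume "\<exists>B. \<forall>r. \<bar>price r \<omega>\<bar> \<le> B" and sp: "\<omega> \<in> space \<Omega>"
    then obtain B where B: "\<And>r. \<bar>price r \<omega>\<bar> \<le> B" by blast
    have [measurable]: "(\<lambda>r. drift r \<omega>) \<in> borel_measurable borel" using joint_section(2)[OF drift_joint sp] .
    have "\<bar>\<bar>drift r \<omega>\<bar>\<bar> \<le> k * (1 + B)" for r
      using drift_bound[of r \<omega>] mult_left_mono[OF add_left_mono[OF B[of r], of 1] k] by simp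
    then have "set_integrable lborel {t..T} (\<lambda>r. \<bar>drift r \<omega>\<bar>)"
      by (intro bounded_set_integrable) measurable
    then have i: "integrable lborel (\<lambda>r. indicator {t..T} r * \<bar>drift r \<omega>\<bar>)" by (simp add: set_integrable_def)
    show "\<forall>s\<in>{t..T}. \<bar>price s \<omega> - p - noise s \<omega>\<bar> \<le> total_drift \<omega>"
    proof
      fix s assume s: "s \<in> {t..T}"
      have "\<bar>price s \<omega> - p - noise s \<omega>\<bar> = \<bar>\<integral>r. indicator {t..s} r * drift r \<omega> \<partial>lborel\<bar>"
        by (simp add: noise_def set_lebesgue_integral_def)
      also have "\<dots> \<le> (\<integral>r. \<bar>indicator {t..s} r * drift r \<omega>\<bar> \<partial>lborel)" by (rule integral_abs_bound)
      also have "\<dots> \<le> total_drift \<omega>" unfolding total_drift_def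
        by (rule integral_mono'[OF i]) (use s in \<open>auto simp: indicator_def\<close>)
      finally show "\<bar>price s \<omega> - p - noise s \<omega>\<bar> \<le> total_drift \<omega>" .
    qed
  qed
qed

lemma payoff_slope_nonneg: "0 \<le> payoff_slope \<kappa>"
  unfolding payoff_slope_def using total_drift(2) by (intro Bochner_Integration.integral_nonneg) auto

context
  fixes w :: "real \<Rightarrow> real" and \<kappa> :: real
  assumes w_measurable [measurable]: "w \<in> borel_measurable borel"
    and w_bound: "\<And>s. s \<in> {t..T} \<Longrightarrow> \<bar>w s\<bar> \<le> 1"
begin

lemma weighted_joint:
  assumes "bounded_control D u"
  shows "(\<lambda>x. weighted w u (fst x) (snd x)) \<in> borel_measurable (borel \<Otimes>\<^sub>M \<Omega>)"
proof -
  note [measurable] = control_joint[OF assms]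
  show ?thesis unfolding weighted_def by measurable
qed

lemma weighted_bound:
  assumes u: "bounded_control D u" and sp: "\<omega> \<in> space \<Omega>"
  shows "\<bar>weighted w u s \<omega>\<bar> \<le> indicator {t..T} s * \<bar>u s \<omega>\<bar>" "\<bar>weighted w u s \<omega>\<bar> \<le> D * indicator {t..T} s"
proof -
  have "\<bar>w s\<bar> * \<bar>u s \<omega>\<bar> \<le> 1 * \<bar>u s \<omega>\<bar>" if "s \<in> {t..T}" using w_bound[OF that] by (intro mult_right_mono) auto
  then show 1: "\<bar>weighted w u s \<omega>\<bar> \<le> indicator {t..T} s * \<bar>u s \<omega>\<bar>"
    by (auto simp: weighted_def indicator_def clip_eq abs_mult)
  have "indicator {t..T} s * \<bar>u s \<omega>\<bar> \<le> D * indicator {t..T} s"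
    using u sp by (auto simp: bounded_control_def indicator_def)
  with 1 show "\<bar>weighted w u s \<omega>\<bar> \<le> D * indicator {t..T} s" by linarith
qed

text \<open>
  On the product of time and probability space all terms are integrable, so that linearity in the control
  and Fubini's theorem become immediate.
\<close>

lemma payoff_product:
  assumes u: "bounded_control D u"
  shows "integrable (lborel \<Otimes>\<^sub>M \<Omega>) (\<lambda>x. weighted w u (fst x) (snd x) * (price (fst x) (snd x) - \<kappa>))"
    and "payoff w \<kappa> u = (\<integral>x. weighted w u (fst x) (snd x) * (price (fst x) (snd x) - \<kappa>) \<partial>(lborel \<Otimes>\<^sub>M \<Omega>))"
proof -
  interpret P: pair_sigma_finite lborel \<Omega> ..
  have D: "0 \<le> D" using u by (simp add: bounded_control_def)
  obtain M where M: "0 \<le> M" "\<And>s. s \<in> {t..T} \<Longrightarrow> (\<integral>\<^sup>+\<omega>. ennreal ((price s \<omega>)\<^sup>2) \<partial>\<Omega>) \<le> ennreal M"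
    by (rule price_second_moment) blast
  have i1: "integrable (lborel \<Otimes>\<^sub>M \<Omega>) (\<lambda>x. weighted w u (fst x) (snd x) * price (fst x) (snd x))"
    by (rule product_integrable[OF weighted_joint[OF u] weighted_bound(2)[OF u] D price_joint M(2)])
  have i2: "integrable (lborel \<Otimes>\<^sub>M \<Omega>) (\<lambda>x. weighted w u (fst x) (snd x) * \<kappa>)"
    by (rule product_integrable[OF weighted_joint[OF u] weighted_bound(2)[OF u] D, where g = "\<lambda>_ _. \<kappa>" and M = "\<kappa>\<^sup>2"])
       (auto simp: emeasure_space_1)
  show int: "integrable (lborel \<Otimes>\<^sub>M \<Omega>) (\<lambda>x. weighted w u (fst x) (snd x) * (price (fst x) (snd x) - \<kappa>))"
    using Bochner_Integration.integrable_diff[OF i1 i2] by (simp add: right_diff_distrib)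
  have "payoff w \<kappa> u = (\<integral>\<omega>. (\<integral>s. weighted w u s \<omega> * (price s \<omega> - \<kappa>) \<partial>lborel) \<partial>\<Omega>)"
    unfolding payoff_def set_lebesgue_integral_def
    by (intro Bochner_Integration.integral_cong refl)
       (auto simp: weighted_def price_def indicator_def clip_eq)
  also have "\<dots> = (\<integral>x. weighted w u (fst x) (snd x) * (price (fst x) (snd x) - \<kappa>) \<partial>(lborel \<Otimes>\<^sub>M \<Omega>))"
    by (rule P.integral_snd[of "\<lambda>s \<omega>. weighted w u s \<omega> * (price s \<omega> - \<kappa>)", unfolded case_prod_beta, OF int])
  finally show "payoff w \<kappa> u = (\<integral>x. weighted w u (fst x) (snd x) * (price (fst x) (snd x) - \<kappa>) \<partial>(lborel \<Otimes>\<^sub>M \<Omega>))" .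
qed

lemma payoff_linear:
  assumes u: "bounded_control D u" and v: "bounded_control D v"
  shows "payoff w \<kappa> (\<lambda>s \<omega>. \<alpha> * u s \<omega> + \<beta> * v s \<omega>) = \<alpha> * payoff w \<kappa> u + \<beta> * payoff w \<kappa> v"
proof -
  have "payoff w \<kappa> (\<lambda>s \<omega>. \<alpha> * u s \<omega> + \<beta> * v s \<omega>) =
      (\<integral>x. \<alpha> * (weighted w u (fst x) (snd x) * (price (fst x) (snd x) - \<kappa>)) +
           \<beta> * (weighted w v (fst x) (snd x) * (price (fst x) (snd x) - \<kappa>)) \<partial>(lborel \<Otimes>\<^sub>M \<Omega>))"
    unfolding payoff_product(2)[OF bounded_control_linear[OF u v]]
    by (intro Bochner_Integration.integral_cong refl) (simp add: weighted_def algebra_simps)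
  also have "\<dots> = \<alpha> * payoff w \<kappa> u + \<beta> * payoff w \<kappa> v"
    using payoff_product[OF u] payoff_product[OF v] by simp
  finally show ?thesis .
qed

text \<open>
  At each time \<open>s\<close> the value of the control is known, so the martingale property replaces the noise at time
  \<open>s\<close> by its terminal value.
\<close>

lemma weighted_noise_terminal:
  assumes u: "bounded_control D u"
  shows "integrable (lborel \<Otimes>\<^sub>M \<Omega>) (\<lambda>x. weighted w u (fst x) (snd x) * noise (fst x) (snd x))"
    and "integrable (lborel \<Otimes>\<^sub>M \<Omega>) (\<lambda>x. weighted w u (fst x) (snd x) * noise T (snd x))"
    and "(\<integral>x. weighted w u (fst x) (snd x) * noise (fst x) (snd x) \<partial>(lborel \<Otimes>\<^sub>M \<Omega>)) =
      (\<integral>x. weighted w u (fst x) (snd x) * noise T (snd x) \<partial>(lborel \<Otimes>\<^sub>M \<Omega>))"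
proof -
  interpret P: pair_sigma_finite lborel \<Omega> ..
  have D: "0 \<le> D" using u by (simp add: bounded_control_def)
  obtain M where M: "0 \<le> M" "\<And>s. s \<in> {t..T} \<Longrightarrow> (\<integral>\<^sup>+\<omega>. ennreal ((noise s \<omega>)\<^sup>2) \<partial>\<Omega>) \<le> ennreal M"
    by (rule noise_second_moment) blast
  show i1: "integrable (lborel \<Otimes>\<^sub>M \<Omega>) (\<lambda>x. weighted w u (fst x) (snd x) * noise (fst x) (snd x))"
    by (rule product_integrable[OF weighted_joint[OF u] weighted_bound(2)[OF u] D noise_joint M(2)])
  have TT: "T \<in> {t..T}" using t by simp
  have nT: "(\<lambda>x. noise T (snd x)) \<in> borel_measurable (borel \<Otimes>\<^sub>M \<Omega>)" by measurable
  show i2: "integrable (lborel \<Otimes>\<^sub>M \<Omega>) (\<lambda>x. weighted w u (fst x) (snd x) * noise T (snd x))"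
    using product_integrable[OF weighted_joint[OF u] weighted_bound(2)[OF u] D, of "\<lambda>_. noise T" M] nT M(2)[OF TT] by simp
  have "(\<integral>x. weighted w u (fst x) (snd x) * noise (fst x) (snd x) \<partial>(lborel \<Otimes>\<^sub>M \<Omega>)) =
      (\<integral>s. (\<integral>\<omega>. weighted w u s \<omega> * noise s \<omega> \<partial>\<Omega>) \<partial>lborel)"
    using P.integral_fst'[OF i1] by simp
  also have "\<dots> = (\<integral>s. (\<integral>\<omega>. weighted w u s \<omega> * noise T \<omega> \<partial>\<Omega>) \<partial>lborel)"
  proof (rule Bochner_Integration.integral_cong[OF refl])
    fix s
    show "(\<integral>\<omega>. weighted w u s \<omega> * noise s \<omega> \<partial>\<Omega>) = (\<integral>\<omega>. weighted w u s \<omega> * noise T \<omega> \<partial>\<Omega>)"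
    proof (cases "s \<in> {t..T}")
      case True
      have "u s \<in> borel_measurable (F s)"
        using u True t by (intro progressively_measurable_section[of t T]) (auto simp: bounded_control_def)
      then have "weighted w u s \<in> borel_measurable (F s)"
        unfolding weighted_def[abs_def] using True by (simp add: clip_eq)
      then show ?thesis using weighted_bound(2)[OF u] by (rule noise_martingale[OF True])
    qed (simp add: weighted_def)
  qed
  also have "\<dots> = (\<integral>x. weighted w u (fst x) (snd x) * noise T (snd x) \<partial>(lborel \<Otimes>\<^sub>M \<Omega>))"
    using P.integral_fst'[OF i2] by simp
  finally show "(\<integral>x. weighted w u (fst x) (snd x) * noise (fst x) (snd x) \<partial>(lborel \<Otimes>\<^sub>M \<Omega>)) =
      (\<integral>x. weighted w u (fst x) (snd x) * noise T (snd x) \<partial>(lborel \<Otimes>\<^sub>M \<Omega>))" .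
qed

text \<open>
  The payoff of a nonnegative control is at most proportional to the total amount \<open>h\<close> that it may exercise.
  Write \<open>P s = p + \<integral>drift + noise s\<close>. Inside the expectation \<open>noise s\<close> may be replaced by \<open>noise T\<close>, and then
  the factor of \<open>u s\<close> is dominated by \<open>\<bar>p - \<kappa>\<bar> + total_drift + \<bar>noise T\<bar>\<close> uniformly in \<open>s\<close>. The martingale
  property thus does the work of a maximal inequality.
\<close>

theorem payoff_bound:
  assumes u: "bounded_control D u" and u0: "\<And>s \<omega>. s \<in> {t..T} \<Longrightarrow> \<omega> \<in> space \<Omega> \<Longrightarrow> 0 \<le> u s \<omega>"
    and h: "AE \<omega> in \<Omega>. (LINT s:{t..T}|lborel. u s \<omega>) \<le> h"
  shows "\<bar>payoff w \<kappa> u\<bar> \<le> payoff_slope \<kappa> * h"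
proof -
  interpret P: pair_sigma_finite lborel \<Omega> ..
  have nT: "integrable \<Omega> (noise T)" using t by (intro noise_integrable) simp
  define G where "G \<omega> = \<bar>p - \<kappa>\<bar> + total_drift \<omega> + \<bar>noise T \<omega>\<bar>" for \<omega>
  have G0: "0 \<le> G \<omega>" for \<omega> using total_drift(2)[of \<omega>] by (simp add: G_def)
  have Gi: "integrable \<Omega> G" unfolding G_def[abs_def] using total_drift(1) nT by simp
  note pp = payoff_product[OF u] and wn = weighted_noise_terminal[OF u]
  let ?w = "weighted w u"
  define q where "q s \<omega> = ?w s \<omega> * (price s \<omega> - \<kappa> - noise s \<omega> + noise T \<omega>)" for s \<omega>
  have qeq: "q (fst x) (snd x) = ?w (fst x) (snd x) * (price (fst x) (snd x) - \<kappa>)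
      - ?w (fst x) (snd x) * noise (fst x) (snd x) + ?w (fst x) (snd x) * noise T (snd x)" for x
    by (simp add: q_def algebra_simps)
  have qi: "integrable (lborel \<Otimes>\<^sub>M \<Omega>) (\<lambda>x. q (fst x) (snd x))"
    unfolding qeq using pp(1) wn(1,2) by simp
  have "payoff w \<kappa> u = (\<integral>x. q (fst x) (snd x) \<partial>(lborel \<Otimes>\<^sub>M \<Omega>))"
    unfolding qeq pp(2) using pp(1) wn by simp
  also have "\<dots> = (\<integral>\<omega>. (\<integral>s. q s \<omega> \<partial>lborel) \<partial>\<Omega>)"
    by (rule P.integral_snd[of q, unfolded case_prod_beta, OF qi, symmetric])
  finally have "\<bar>payoff w \<kappa> u\<bar> \<le> (\<integral>\<omega>. \<bar>\<integral>s. q s \<omega> \<partial>lborel\<bar> \<partial>\<Omega>)" by simp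
  also have "\<dots> \<le> (\<integral>\<omega>. G \<omega> * h \<partial>\<Omega>)"
  proof (rule integral_mono_AE)
    show "integrable \<Omega> (\<lambda>\<omega>. \<bar>\<integral>s. q s \<omega> \<partial>lborel\<bar>)"
      by (rule integrable_abs[OF P.integrable_snd[of q, unfolded case_prod_beta, OF qi]])
    show "integrable \<Omega> (\<lambda>\<omega>. G \<omega> * h)" using Gi by simp
    show "AE \<omega> in \<Omega>. \<bar>\<integral>s. q s \<omega> \<partial>lborel\<bar> \<le> G \<omega> * h"
      using total_drift(3) h AE_space
    proof eventually_elim
      fix \<omega> assume dr: "\<forall>s\<in>{t..T}. \<bar>price s \<omega> - p - noise s \<omega>\<bar> \<le> total_drift \<omega>"
        and h: "(LINT s:{t..T}|lborel. u s \<omega>) \<le> h" and sp: "\<omega> \<in> space \<Omega>"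
      have ui: "integrable lborel (\<lambda>s. indicator {t..T} s * u s \<omega>)"
        using control_path_integrable[OF u sp] by (simp add: set_integrable_def)
      have "\<bar>\<integral>s. q s \<omega> \<partial>lborel\<bar> \<le> (\<integral>s. \<bar>q s \<omega>\<bar> \<partial>lborel)" by (rule integral_abs_bound)
      also have "\<dots> \<le> (\<integral>s. G \<omega> * (indicator {t..T} s * u s \<omega>) \<partial>lborel)"
      proof (rule integral_mono')
        show "integrable lborel (\<lambda>s. G \<omega> * (indicator {t..T} s * u s \<omega>))" using ui by simp
        fix s
        show "0 \<le> G \<omega> * (indicator {t..T} s * u s \<omega>)"
          using G0[of \<omega>] u0[OF _ sp, of s] by (auto simp: indicator_def)
        show "\<bar>q s \<omega>\<bar> \<le> G \<omega> * (indicator {t..T} s * u s \<omega>)"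
        proof (cases "s \<in> {t..T}")
          case True
          have a: "\<bar>?w s \<omega>\<bar> \<le> u s \<omega>" using weighted_bound(1)[OF u sp, of s] u0[OF True sp] True by simp
          have b: "\<bar>price s \<omega> - \<kappa> - noise s \<omega> + noise T \<omega>\<bar> \<le> G \<omega>"
          proof -
            have "\<bar>price s \<omega> - p - noise s \<omega>\<bar> \<le> total_drift \<omega>" using dr True by blast
            then show ?thesis unfolding G_def by linarith
          qed
          have "\<bar>q s \<omega>\<bar> \<le> u s \<omega> * G \<omega>" unfolding q_def abs_mult
            using a b u0[OF True sp] by (intro mult_mono) auto
          then show ?thesis using True by (simp add: mult.commute)
        qed (simp add: q_def weighted_def)
      qed
      also have "\<dots> = G \<omega> * (LINT s:{t..T}|lborel. u s \<omega>)" by (simp add: set_lebesgue_integral_def)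
      also have "\<dots> \<le> G \<omega> * h" using h G0[of \<omega>] by (rule mult_left_mono)
      finally show "\<bar>\<integral>s. q s \<omega> \<partial>lborel\<bar> \<le> G \<omega> * h" .
    qed
  qed
  also have "\<dots> = expectation G * h" using Gi by simp
  finally show ?thesis unfolding payoff_slope_def G_def .
qed

end

end

section \<open>The value as a function of the exercised amount\<close>

text \<open>
  The slopes of a concave function decrease, so that they lie between the slopes at the two end points.
\<close>

lemma concave_lipschitz_if_endpoint_slopes:
  fixes v :: "real \<Rightarrow> real"
  assumes v: "concave_on {a..b} v" and C: "0 \<le> C"
    and left: "\<And>z. z \<in> {a..b} \<Longrightarrow> v z \<le> v a + C * (z - a)"
    and right: "\<And>z. z \<in> {a..b} \<Longrightarrow> v z \<le> v b + C * (b - z)"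
  shows "C-lipschitz_on {a..b} v"
proof (rule lipschitz_onI)
  have main: "\<bar>v y - v x\<bar> \<le> C * (y - x)" if xy: "a \<le> x" "x < y" "y \<le> b" for x y
  proof -
    have comb: "\<And>p q s. p \<in> {a..b} \<Longrightarrow> q \<in> {a..b} \<Longrightarrow> p \<le> s \<Longrightarrow> s \<le> q \<Longrightarrow> p < q \<Longrightarrow>
        (q - s) * v p + (s - p) * v q \<le> (q - p) * v s"
    proof -
      fix p q s assume pq: "p \<in> {a..b}" "q \<in> {a..b}" "p \<le> s" "s \<le> q" "p < q"
      define \<theta> where "\<theta> = (s - p) / (q - p)"
      have \<theta>: "0 \<le> \<theta>" "\<theta> \<le> 1" "\<theta> * (q - p) = s - p" using pq by (auto simp: \<theta>_def)
      have "(1 - \<theta>) *\<^sub>R p + \<theta> *\<^sub>R q = s" using \<theta>(3) by (simp add: algebra_simps)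
      then have "(1 - \<theta>) * v p + \<theta> * v q \<le> v s" using concave_onD[OF v \<theta>(1,2) pq(1,2)] by simp
      then have "(q - p) * ((1 - \<theta>) * v p + \<theta> * v q) \<le> (q - p) * v s" using pq by (intro mult_left_mono) auto
      moreover have "(q - p) * ((1 - \<theta>) * v p + \<theta> * v q) = ((q - p) - \<theta> * (q - p)) * v p + \<theta> * (q - p) * v q"
        by (simp add: algebra_simps)
      ultimately show "(q - s) * v p + (s - p) * v q \<le> (q - p) * v s" unfolding \<theta>(3) by simp
    qed
    have "v y - v x \<le> C * (y - x)"
    proof -
      have "(y - x) * v a + (x - a) * v y \<le> (y - a) * v x" using xy by (intro comb) auto
      moreover have "(y - x) * v y \<le> (y - x) * (v a + C * (y - a))" using left[of y] xy by (intro mult_left_mono) auto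
      ultimately have "(y - a) * (v y - v x) \<le> (y - a) * (C * (y - x))" by (simp add: algebra_simps)
      then show ?thesis using xy by simp
    qed
    moreover have "v x - v y \<le> C * (y - x)"
    proof -
      have "(b - y) * v x + (y - x) * v b \<le> (b - x) * v y" using xy by (intro comb) auto
      moreover have "(y - x) * v x \<le> (y - x) * (v b + C * (b - x))" using right[of x] xy by (intro mult_left_mono) auto
      ultimately have "(b - x) * (v x - v y) \<le> (b - x) * (C * (y - x))" by (simp add: algebra_simps)
      then show ?thesis using xy by simp
    qed
    ultimately show ?thesis by linarith
  qed
  fix x y assume "x \<in> {a..b}" "y \<in> {a..b}"
  then show "dist (v x) (v y) \<le> C * dist x y"
    using main[of x y] main[of y x] by (cases x y rule: linorder_cases) (auto simp: dist_real_def)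
qed (rule C)

lemma mult_SUP_le:
  fixes f :: "'b \<Rightarrow> real"
  assumes "0 \<le> \<alpha>" "A \<noteq> {}" "\<And>u. u \<in> A \<Longrightarrow> \<alpha> * f u \<le> c"
  shows "\<alpha> * (SUP u\<in>A. f u) \<le> c"
proof (cases "\<alpha> = 0")
  case True
  then show ?thesis using assms by auto
next
  case False
  then have \<alpha>: "0 < \<alpha>" using assms(1) by simp
  have "(SUP u\<in>A. f u) \<le> c / \<alpha>"
    using assms(2,3) \<alpha> by (intro cSUP_least) (auto simp: pos_le_divide_eq mult.commute)
  then show ?thesis using \<alpha> by (simp add: pos_le_divide_eq mult.commute)
qed

context sde_solution
begin

context
  fixes w :: "real \<Rightarrow> real" and \<kappa> ubar m M :: real
  assumes w_measurable: "w \<in> borel_measurable borel"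
    and w_bound: "\<And>s. s \<in> {t..T} \<Longrightarrow> \<bar>w s\<bar> \<le> 1"
    and ubar: "0 < ubar" and mM: "m < M"
begin

abbreviation adm :: "real \<Rightarrow> (real \<Rightarrow> 'a \<Rightarrow> real) set" where
  "adm z \<equiv> admissible_controls \<Omega> F T ubar m M t z"

abbreviation total :: "(real \<Rightarrow> 'a \<Rightarrow> real) \<Rightarrow> 'a \<Rightarrow> real" where
  "total u \<omega> \<equiv> (LINT s:{t..T}|lborel. u s \<omega>)"

definition val :: "real \<Rightarrow> real" where "val z = (SUP u\<in>adm z. payoff w \<kappa> u)"

lemma admD:
  assumes "u \<in> adm z"
  shows "bounded_control ubar u" "s \<in> {t..T} \<Longrightarrow> \<omega> \<in> space \<Omega> \<Longrightarrow> 0 \<le> u s \<omega> \<and> u s \<omega> \<le> ubar"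
    "AE \<omega> in \<Omega>. m \<le> z + total u \<omega> \<and> z + total u \<omega> \<le> M"
  using assms ubar by (auto simp: admissible_controls_def controls_def bounded_control_def Z_process_def)

lemma admI:
  assumes "progressively_measurable F t T u"
    "\<And>s \<omega>. s \<in> {t..T} \<Longrightarrow> \<omega> \<in> space \<Omega> \<Longrightarrow> 0 \<le> u s \<omega> \<and> u s \<omega> \<le> ubar"
    "AE \<omega> in \<Omega>. m \<le> z + total u \<omega> \<and> z + total u \<omega> \<le> M"
  shows "u \<in> adm z"
  using assms by (auto simp: admissible_controls_def controls_def Z_process_def)

lemma total_const: "total (\<lambda>_ _. c) \<omega> = c * (T - t)"
  using t by (simp add: set_lebesgue_integral_def)

lemma total_linear:
  assumes "bounded_control D u" "bounded_control D v" "\<omega> \<in> space \<Omega>"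
  shows "total (\<lambda>s \<omega>. \<alpha> * u s \<omega> + \<beta> * v s \<omega>) \<omega> = \<alpha> * total u \<omega> + \<beta> * total v \<omega>"
  using control_path_integrable[OF assms(1,3)] control_path_integrable[OF assms(2,3)]
  by (simp add: set_integral_add)

lemma total_bounds:
  assumes u: "u \<in> adm z" and sp: "\<omega> \<in> space \<Omega>"
  shows "0 \<le> total u \<omega>" "total u \<omega> \<le> ubar * (T - t)"
proof -
  have ui: "set_integrable lborel {t..T} (\<lambda>s. u s \<omega>)" by (rule control_path_integrable[OF admD(1)[OF u] sp])
  have ci: "set_integrable lborel {t..T} (\<lambda>s. c)" for c :: real
    by (rule bounded_set_integrable[of _ _ _ "\<bar>c\<bar>"]) auto
  have "total (\<lambda>_ _. 0) \<omega> \<le> total u \<omega>"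
    by (rule set_integral_mono[OF ci ui]) (use admD(2)[OF u _ sp] in auto)
  then show "0 \<le> total u \<omega>" by (simp add: total_const)
  have "total u \<omega> \<le> total (\<lambda>_ _. ubar) \<omega>"
    by (rule set_integral_mono[OF ui ci]) (use admD(2)[OF u _ sp] in auto)
  then show "total u \<omega> \<le> ubar * (T - t)" by (simp add: total_const)
qed

lemma const_adm:
  assumes "0 \<le> c" "c \<le> ubar" "m \<le> z + c * (T - t)" "z + c * (T - t) \<le> M"
  shows "(\<lambda>_ _. c) \<in> adm z"
  by (rule admI) (use assms in \<open>auto simp: total_const progressively_measurable_const\<close>)

text \<open>
  If \<open>z < m\<close>, the missing amount \<open>m - z\<close> can be delivered at a constant rate; otherwise no exercise is
  needed.
\<close>

lemma adm_nonempty: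
  assumes z: "z \<in> {m - ubar * (T - t)..M}"
  shows "adm z \<noteq> {}"
proof (cases "m \<le> z")
  case True
  then have "(\<lambda>_ _. 0) \<in> adm z" using z ubar by (intro const_adm) auto
  then show ?thesis by blast
next
  case False
  then have "0 < ubar * (T - t)" using z by auto
  then have tT: "0 < T - t" using ubar by (simp add: zero_less_mult_iff)
  have fill: "z + (m - z) / (T - t) * (T - t) = m" using tT by simp
  have "(\<lambda>_ _. (m - z) / (T - t)) \<in> adm z"
  proof (rule const_adm)
    show "0 \<le> (m - z) / (T - t)" using False tT by simp
    show "(m - z) / (T - t) \<le> ubar" using z tT by (simp add: pos_divide_le_eq)
  qed (use fill mM in simp_all)
  then show ?thesis by blast
qed

lemma payoff_le_val:
  assumes "u \<in> adm z" shows "payoff w \<kappa> u \<le> val z"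
proof -
  let ?C = "payoff_slope \<kappa>"
  have "\<bar>payoff w \<kappa> u\<bar> \<le> ?C * (ubar * (T - t))" if u: "u \<in> adm z" for u
    using admD(1,2)[OF u] total_bounds(2)[OF u]
    by (intro payoff_bound[OF w_measurable w_bound, of ubar]) auto
  then have "bdd_above (payoff w \<kappa> ` adm z)"
    by (intro bdd_aboveI2[of _ _ "?C * (ubar * (T - t))"]) (auto simp: abs_le_iff)
  then show ?thesis unfolding val_def using assms by (intro cSUP_upper)
qed

lemma val_le:
  assumes "z \<in> {m - ubar * (T - t)..M}" "\<And>u. u \<in> adm z \<Longrightarrow> payoff w \<kappa> u \<le> c"
  shows "val z \<le> c"
  unfolding val_def using assms adm_nonempty by (intro cSUP_least) auto

text \<open>
  The payoff is linear in the control, and a mixture of controls that are admissible for \<open>x\<close> and \<open>y\<close> is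
  admissible for the corresponding mixture of \<open>x\<close> and \<open>y\<close>.
\<close>

lemma val_concave: "concave_on {m - ubar * (T - t)..M} val"
  unfolding concave_on_iff
proof (intro conjI ballI allI impI)
  show "convex {m - ubar * (T - t)..M}" by simp
  fix x y \<alpha> \<beta> :: real
  assume x: "x \<in> {m - ubar * (T - t)..M}" and y: "y \<in> {m - ubar * (T - t)..M}"
    and \<alpha>: "0 \<le> \<alpha>" and \<beta>: "0 \<le> \<beta>" and s: "\<alpha> + \<beta> = 1"
  let ?z = "\<alpha> *\<^sub>R x + \<beta> *\<^sub>R y"
  have comb: "\<alpha> * a + \<beta> * b \<le> c" if "a \<le> c" "b \<le> c" for a b c :: real
    using convex_bound_le[OF that \<alpha> \<beta> s] .
  have comb': "c \<le> \<alpha> * a + \<beta> * b" if "c \<le> a" "c \<le> b" for a b c :: real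
    using comb[of "-a" "-c" "-b"] that by simp
  have mix: "(\<lambda>s \<omega>. \<alpha> * u s \<omega> + \<beta> * v s \<omega>) \<in> adm ?z" if u: "u \<in> adm x" and v: "v \<in> adm y" for u v
  proof (rule admI)
    show "progressively_measurable F t T (\<lambda>s \<omega>. \<alpha> * u s \<omega> + \<beta> * v s \<omega>)"
      using admD(1)[OF u] admD(1)[OF v] by (intro progressively_measurable_linear) (auto simp: bounded_control_def)
    show "0 \<le> \<alpha> * u s \<omega> + \<beta> * v s \<omega> \<and> \<alpha> * u s \<omega> + \<beta> * v s \<omega> \<le> ubar"
      if "s \<in> {t..T}" "\<omega> \<in> space \<Omega>" for s \<omega>
      using admD(2)[OF u that] admD(2)[OF v that] by (auto intro: comb comb')
    show "AE \<omega> in \<Omega>. m \<le> ?z + total (\<lambda>s \<omega>. \<alpha> * u s \<omega> + \<beta> * v s \<omega>) \<omega> \<and>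
        ?z + total (\<lambda>s \<omega>. \<alpha> * u s \<omega> + \<beta> * v s \<omega>) \<omega> \<le> M"
      using admD(3)[OF u] admD(3)[OF v] AE_space
    proof eventually_elim
      fix \<omega> assume a: "m \<le> x + total u \<omega> \<and> x + total u \<omega> \<le> M" "m \<le> y + total v \<omega> \<and> y + total v \<omega> \<le> M"
        and sp: "\<omega> \<in> space \<Omega>"
      have "?z + total (\<lambda>s \<omega>. \<alpha> * u s \<omega> + \<beta> * v s \<omega>) \<omega> = \<alpha> * (x + total u \<omega>) + \<beta> * (y + total v \<omega>)"
        unfolding total_linear[OF admD(1)[OF u] admD(1)[OF v] sp] by (simp add: algebra_simps)
      then show "m \<le> ?z + total (\<lambda>s \<omega>. \<alpha> * u s \<omega> + \<beta> * v s \<omega>) \<omega> \<and>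
          ?z + total (\<lambda>s \<omega>. \<alpha> * u s \<omega> + \<beta> * v s \<omega>) \<omega> \<le> M"
        using a by (auto intro: comb comb')
    qed
  qed
  have pair: "\<alpha> * payoff w \<kappa> u + \<beta> * payoff w \<kappa> v \<le> val ?z" if u: "u \<in> adm x" and v: "v \<in> adm y" for u v
    using payoff_le_val[OF mix[OF u v]] payoff_linear[OF w_measurable w_bound admD(1)[OF u] admD(1)[OF v]] by simp
  have "\<beta> * val y \<le> val ?z - \<alpha> * payoff w \<kappa> u" if u: "u \<in> adm x" for u
    unfolding val_def[of y]
    using pair[OF u] by (intro mult_SUP_le \<beta> adm_nonempty[OF y]) (simp add: algebra_simps)
  then have "\<alpha> * val x \<le> val ?z - \<beta> * val y"
    unfolding val_def[of x] by (intro mult_SUP_le \<alpha> adm_nonempty[OF x]) (simp add: algebra_simps)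
  then show "\<alpha> * val x + \<beta> * val y \<le> val ?z" by simp
qed

text \<open>
  A control delivers at most \<open>ubar * (T - t)\<close>, so that in this interval the upper constraint \<open>M\<close> holds
  automatically; the lower constraint becomes weaker as \<open>z\<close> grows. Hence the set of admissible controls
  grows with \<open>z\<close>.
\<close>

lemma val_mono: "mono_on {m - (T - t) * ubar..M - (T - t) * ubar} val"
proof (rule mono_onI)
  fix z z' assume z: "z \<in> {m - (T - t) * ubar..M - (T - t) * ubar}" "z' \<in> {m - (T - t) * ubar..M - (T - t) * ubar}" "z \<le> z'"
  have "0 \<le> ubar * (T - t)" using ubar t by simp
  then have zD: "z \<in> {m - ubar * (T - t)..M}" using z by (auto simp: mult.commute)
  show "val z \<le> val z'"
  proof (rule val_le[OF zD])
    fix u assume u: "u \<in> adm z"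
    have "u \<in> adm z'"
    proof (rule admI[OF _ admD(2)[OF u]])
      show "AE \<omega> in \<Omega>. m \<le> z' + total u \<omega> \<and> z' + total u \<omega> \<le> M"
        using admD(3)[OF u] AE_space
      proof eventually_elim
        fix \<omega> assume "m \<le> z + total u \<omega> \<and> z + total u \<omega> \<le> M" "\<omega> \<in> space \<Omega>"
        then show "m \<le> z' + total u \<omega> \<and> z' + total u \<omega> \<le> M"
          using total_bounds[OF u] z by (auto simp: mult.commute intro: order_trans) fastforce
      qed
    qed (use admD(1)[OF u] in \<open>auto simp: bounded_control_def\<close>)
    then show "payoff w \<kappa> u \<le> val z'" by (rule payoff_le_val)
  qed
qed

text \<open>
  Controls are nonnegative, so that the lower constraint \<open>m\<close> holds automatically for \<open>z \<ge> m\<close>; the upper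
  constraint becomes stronger as \<open>z\<close> grows.
\<close>

lemma val_antimono: "antimono_on {m..M} val"
proof (rule monotone_onI)
  fix z z' assume z: "z \<in> {m..M}" "z' \<in> {m..M}" "z \<le> z'"
  have "0 \<le> ubar * (T - t)" using ubar t by simp
  then have zD: "z' \<in> {m - ubar * (T - t)..M}" using z by auto
  show "val z \<ge> val z'"
  proof (rule val_le[OF zD])
    fix u assume u: "u \<in> adm z'"
    have "u \<in> adm z"
    proof (rule admI[OF _ admD(2)[OF u]])
      show "AE \<omega> in \<Omega>. m \<le> z + total u \<omega> \<and> z + total u \<omega> \<le> M"
        using admD(3)[OF u] AE_space
      proof eventually_elim
        fix \<omega> assume a: "m \<le> z' + total u \<omega> \<and> z' + total u \<omega> \<le> M" "\<omega> \<in> space \<Omega>"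
        then have "0 \<le> total u \<omega>" using total_bounds[OF u] by simp
        then show "m \<le> z + total u \<omega> \<and> z + total u \<omega> \<le> M" using a z by auto
      qed
    qed (use admD(1)[OF u] in \<open>auto simp: bounded_control_def\<close>)
    then show "payoff w \<kappa> u \<le> val z" by (rule payoff_le_val)
  qed
qed

text \<open>
  By concavity only the slopes at the two end points matter. At the left end point full exercise is
  admissible, and a control that is admissible for \<open>z\<close> falls short of it by at most \<open>z - (m - ubar * (T - t))\<close>;
  at \<open>M\<close> doing nothing is admissible, and a control that is admissible for \<open>z\<close> exercises at most \<open>M - z\<close>. In
  both cases the difference of the payoffs is controlled by \<open>payoff_bound\<close>.
\<close>

lemma val_lipschitz: "\<exists>L. L-lipschitz_on {m - ubar * (T - t)..M} val"
proof -
  let ?a = "m - ubar * (T - t)"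
  let ?C = "payoff_slope \<kappa>"
  have cap: "0 \<le> ubar * (T - t)" using ubar t by simp
  have "?C-lipschitz_on {?a..M} val"
  proof (rule concave_lipschitz_if_endpoint_slopes[OF val_concave payoff_slope_nonneg])
    fix z assume z: "z \<in> {?a..M}"
    show "val z \<le> val ?a + ?C * (z - ?a)"
    proof (rule val_le[OF z])
      fix u assume u: "u \<in> adm z"
      have full: "(\<lambda>_ _. ubar) \<in> adm ?a" using ubar cap mM by (intro const_adm) auto
      \<comment> \<open>The amount that \<open>u\<close> leaves unused.\<close>
      define v where "v = (\<lambda>s \<omega>. (-1) * u s \<omega> + 1 * ubar)"
      have pv: "payoff w \<kappa> v = payoff w \<kappa> (\<lambda>_ _. ubar) - payoff w \<kappa> u"
        unfolding v_def using payoff_linear[OF w_measurable w_bound admD(1)[OF u] admD(1)[OF full], of \<kappa> "-1" 1] by simp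
      have "\<bar>payoff w \<kappa> v\<bar> \<le> ?C * (z - ?a)"
      proof (rule payoff_bound[OF w_measurable w_bound])
        show "bounded_control (\<bar>-1\<bar> * ubar + \<bar>1\<bar> * ubar) v"
          unfolding v_def by (rule bounded_control_linear[OF admD(1)[OF u] admD(1)[OF full]])
        show "0 \<le> v s \<omega>" if "s \<in> {t..T}" "\<omega> \<in> space \<Omega>" for s \<omega>
          using admD(2)[OF u that] by (simp add: v_def)
        show "AE \<omega> in \<Omega>. total v \<omega> \<le> z - ?a"
          using admD(3)[OF u] AE_space
        proof eventually_elim
          fix \<omega> assume a: "m \<le> z + total u \<omega> \<and> z + total u \<omega> \<le> M" and sp: "\<omega> \<in> space \<Omega>"
          have "total v \<omega> = ubar * (T - t) - total u \<omega>"
            unfolding v_def total_linear[OF admD(1)[OF u] admD(1)[OF full] sp, of "-1" 1] by (simp add: total_const)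
          then show "total v \<omega> \<le> z - ?a" using a by simp
        qed
      qed
      then show "payoff w \<kappa> u \<le> val ?a + ?C * (z - ?a)"
        using pv payoff_le_val[OF full] by linarith
    qed
    show "val z \<le> val M + ?C * (M - z)"
    proof (rule val_le[OF z])
      fix u assume u: "u \<in> adm z"
      have none: "(\<lambda>_ _. 0) \<in> adm M" using ubar mM by (intro const_adm) auto
      have "payoff w \<kappa> (\<lambda>_ _. 0) = 0" by (simp add: payoff_def set_lebesgue_integral_def)
      then have "0 \<le> val M" using payoff_le_val[OF none] by simp
      moreover have "\<bar>payoff w \<kappa> u\<bar> \<le> ?C * (M - z)"
      proof (rule payoff_bound[OF w_measurable w_bound admD(1)[OF u]])
        show "AE \<omega> in \<Omega>. total u \<omega> \<le> M - z"
          using admD(3)[OF u] by eventually_elim simp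
      qed (use admD(2)[OF u] in auto)
      ultimately show "payoff w \<kappa> u \<le> val M + ?C * (M - z)" by linarith
    qed
  qed
  then show ?thesis by blast
qed

lemma val_plateau:
  assumes "m \<le> M - (T - t) * ubar"
  shows "val constant_on {m..M - (T - t) * ubar} \<and>
    (\<forall>z\<in>{m..M - (T - t) * ubar}. \<forall>z'\<in>{m - ubar * (T - t)..M}. val z' \<le> val z)"
proof -
  define e where "e = M - (T - t) * ubar"
  have cap: "0 \<le> (T - t) * ubar" using ubar t by simp
  have e: "m \<le> e" "e \<le> M" "m - (T - t) * ubar \<le> m" "m - (T - t) * ubar = m - ubar * (T - t)"
    using assms cap by (auto simp: e_def)
  have up: "val x \<le> val y" if "m - (T - t) * ubar \<le> x" "x \<le> y" "y \<le> e" for x y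
    using mono_onD[OF val_mono, of x y] that by (auto simp: e_def)
  have down: "val y \<le> val x" if "m \<le> x" "x \<le> y" "y \<le> M" for x y
    using monotone_onD[OF val_antimono, of x y] that by auto
  have const: "val z = val e" if "z \<in> {m..e}" for z
    using up[of z e] down[of z e] that e by auto
  have "val z' \<le> val e" if "z' \<in> {m - ubar * (T - t)..M}" for z'
    using up[of z' e] down[of e z'] that e by (cases "z' \<le> e") auto
  then show ?thesis unfolding constant_on_def e_def[symmetric] using const by metis
qed

end
end

lemma linear_growth:
  fixes g :: "real \<Rightarrow> real \<Rightarrow> real" and T :: real
  assumes "continuous_on ({0..T} \<times> UNIV) (\<lambda>(s, p). g s p :: real)"
    and "\<exists>L. \<forall>s\<in>{0..T}. L-lipschitz_on UNIV (g s)"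
  shows "\<exists>k\<ge>0. \<forall>s\<in>{0..T}. \<forall>x::real. \<bar>g s x\<bar> \<le> k * (1 + \<bar>x\<bar>)"
proof -
  obtain L where L: "\<And>s. s \<in> {0..T} \<Longrightarrow> L-lipschitz_on UNIV (g s)" using assms(2) by blast
  have "continuous_on {0..T} (\<lambda>s. (\<lambda>(s, p). g s p) (s, 0))"
    by (rule continuous_on_compose2[OF assms(1)]) (auto intro!: continuous_intros)
  then have "bounded ((\<lambda>s. g s 0) ` {0..T})"
    by (intro compact_imp_bounded compact_continuous_image) auto
  then obtain B where "\<forall>s\<in>{0..T}. \<bar>g s 0\<bar> \<le> B" by (auto simp: bounded_iff)
  then have B: "\<And>s. s \<in> {0..T} \<Longrightarrow> \<bar>g s 0\<bar> \<le> B" by blast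
  have "\<bar>g s x\<bar> \<le> (\<bar>B\<bar> + \<bar>L\<bar>) * (1 + \<bar>x\<bar>)" if s: "s \<in> {0..T}" for s x
  proof -
    have "\<bar>g s x - g s 0\<bar> \<le> L * \<bar>x\<bar>"
      using lipschitz_onD[OF L[OF s], of x 0] by (simp add: dist_real_def)
    also have "\<dots> \<le> \<bar>L\<bar> * \<bar>x\<bar>" by (intro mult_right_mono) auto
    finally have "\<bar>g s x\<bar> \<le> \<bar>B\<bar> + \<bar>L\<bar> * \<bar>x\<bar>" using B[OF s] by linarith
    also have "\<dots> \<le> (\<bar>B\<bar> + \<bar>L\<bar>) * (1 + \<bar>x\<bar>)" by (simp add: algebra_simps)
    finally show ?thesis .
  qed
  then show ?thesis by (intro exI[of _ "\<bar>B\<bar> + \<bar>L\<bar>"]) auto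
qed

theorem proposition4p6:
  fixes \<Omega> :: "'a measure"
    and F :: "real \<Rightarrow> 'a measure"
    and W :: "real \<Rightarrow> 'a \<Rightarrow> real"
    and f \<sigma> :: "real \<Rightarrow> real \<Rightarrow> real"
    and P :: "real \<Rightarrow> real \<Rightarrow> real \<Rightarrow> 'a \<Rightarrow> real"
    and T r K ubar m M :: real
  assumes "T > 0" "r \<ge> 0" "K > 0" "ubar > 0" "m \<ge> 0" "M \<ge> 0" "m < M"
    and "prob_space \<Omega>"
    and "filtration_upto \<Omega> T F"
    and "sets \<Omega> = sets (F T)"
    and "brownian_motion \<Omega> T F W"
    and "continuous_on ({0..T} \<times> UNIV) (\<lambda>(s, p). f s p)"
    and "continuous_on ({0..T} \<times> UNIV) (\<lambda>(s, p). \<sigma> s p)"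
    and "\<exists>L. \<forall>s\<in>{0..T}. L-lipschitz_on UNIV (f s)"
    and "\<exists>L. \<forall>s\<in>{0..T}. L-lipschitz_on UNIV (\<sigma> s)"
    and "\<forall>t\<in>{0..T}. \<forall>p. strong_solution \<Omega> F W f \<sigma> T t p (P t p)"
  defines "V \<equiv> swing_value \<Omega> F P T r K ubar m M"
  shows "\<forall>t\<in>{0..T}. \<forall>p.
    concave_on {m - ubar * (T - t)..M} (V t p) \<and>
    (\<exists>L. L-lipschitz_on {m - ubar * (T - t)..M} (V t p)) \<and>
    (AE z in lborel. z \<in> {m - ubar * (T - t)..M} \<longrightarrow> twice_differentiable_at (V t p) z) \<and>
    mono_on {m - (T - t) * ubar..M - (T - t) * ubar} (V t p) \<and>
    antimono_on {m..M} (V t p) \<and>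
    (M - (T - t) * ubar \<ge> m \<longrightarrow>
       V t p constant_on {m..M - (T - t) * ubar} \<and>
       (\<forall>z\<in>{m..M - (T - t) * ubar}. \<forall>z'\<in>{m - ubar * (T - t)..M}. V t p z' \<le> V t p z))"
proof (intro ballI allI)
  fix t p assume t: "t \<in> {0..T}"
  obtain kf where kf: "0 \<le> kf" "\<And>s x. s \<in> {0..T} \<Longrightarrow> \<bar>f s x\<bar> \<le> kf * (1 + \<bar>x\<bar>)"
    using linear_growth[OF assms(12,14)] by blast
  obtain ks where ks: "0 \<le> ks" "\<And>s x. s \<in> {0..T} \<Longrightarrow> \<bar>\<sigma> s x\<bar> \<le> ks * (1 + \<bar>x\<bar>)"
    using linear_growth[OF assms(13,15)] by blast
  interpret prob_space \<Omega> by fact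
  interpret sde_solution \<Omega> F W T f \<sigma> "kf + ks" t p "P t p"
  proof
    show "\<bar>f s x\<bar> \<le> (kf + ks) * (1 + \<bar>x\<bar>)" "\<bar>\<sigma> s x\<bar> \<le> (kf + ks) * (1 + \<bar>x\<bar>)" if s: "s \<in> {0..T}" for s x
    proof -
      have "0 \<le> kf * (1 + \<bar>x\<bar>)" "0 \<le> ks * (1 + \<bar>x\<bar>)" using kf(1) ks(1) by simp_all
      then show "\<bar>f s x\<bar> \<le> (kf + ks) * (1 + \<bar>x\<bar>)" "\<bar>\<sigma> s x\<bar> \<le> (kf + ks) * (1 + \<bar>x\<bar>)"
        using kf(2)[OF s, of x] ks(2)[OF s, of x] unfolding distrib_right by linarith+
    qed
  qed (use assms t kf(1) ks(1) in auto)
  define w where "w s = exp (- r * (s - t))" for s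
  have wm: "w \<in> borel_measurable borel" unfolding w_def[abs_def] by measurable
  have wb: "\<bar>w s\<bar> \<le> 1" if "s \<in> {t..T}" for s
    using that assms(2) by (simp add: w_def)
  note ctx = wm wb assms(4) assms(7)
  have V: "V t p = val w K ubar m M"
  proof
    fix z
    have "val w K ubar m M z = (SUP u\<in>admissible_controls \<Omega> F T ubar m M t z. payoff w K u)"
      by (rule val_def[OF ctx])
    then show "V t p z = val w K ubar m M z"
      by (simp add: V_def swing_value_def payoff_def w_def)
  qed
  note lip = val_lipschitz[OF ctx, of K] and conc = val_concave[OF ctx, of K]
  obtain L where L: "L-lipschitz_on {m - ubar * (T - t)..M} (V t p)" using lip unfolding V by blast
  have conc': "concave_on {m - ubar * (T - t)..M} (V t p)" using conc unfolding V .
  show "concave_on {m - ubar * (T - t)..M} (V t p) \<and>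
    (\<exists>L. L-lipschitz_on {m - ubar * (T - t)..M} (V t p)) \<and>
    (AE z in lborel. z \<in> {m - ubar * (T - t)..M} \<longrightarrow> twice_differentiable_at (V t p) z) \<and>
    mono_on {m - (T - t) * ubar..M - (T - t) * ubar} (V t p) \<and>
    antimono_on {m..M} (V t p) \<and>
    (M - (T - t) * ubar \<ge> m \<longrightarrow>
       V t p constant_on {m..M - (T - t) * ubar} \<and>
       (\<forall>z\<in>{m..M - (T - t) * ubar}. \<forall>z'\<in>{m - ubar * (T - t)..M}. V t p z' \<le> V t p z))"
  proof (intro conjI impI)
    show "concave_on {m - ubar * (T - t)..M} (V t p)" by (rule conc')
    show "\<exists>L. L-lipschitz_on {m - ubar * (T - t)..M} (V t p)" using L by blast
    show "AE z in lborel. z \<in> {m - ubar * (T - t)..M} \<longrightarrow> twice_differentiable_at (V t p) z"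
      by (rule concave_twice_differentiable_AE[OF conc' L])
    show "mono_on {m - (T - t) * ubar..M - (T - t) * ubar} (V t p)"
      unfolding V by (rule val_mono[OF ctx])
    show "antimono_on {m..M} (V t p)" unfolding V by (rule val_antimono[OF ctx])
    assume "M - (T - t) * ubar \<ge> m"
    then show "V t p constant_on {m..M - (T - t) * ubar}"
      "\<forall>z\<in>{m..M - (T - t) * ubar}. \<forall>z'\<in>{m - ubar * (T - t)..M}. V t p z' \<le> V t p z"
      using val_plateau[OF ctx, of K] unfolding V by blast+
  qed
qed

end
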